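(* Let $X$ be a continuous martingale in the market with sample space $\Omega=C[0,\infty)^J$ and $J^*$ traded securities. Consider the extended market in which $X$ is traded as a new security: its sample space is $\Omega':=C[0,\infty)^{J+1}$ with elements $(X',S_1,\dots,S_J)$, where $X',S_1,\dots,S_{J^*}$ are traded price paths and $S_{J^*+1},\dots,S_J$ are information paths. Let $Y$ be a continuous martingale in the new market. For $t\ge0$ and $z:[0,\infty)\to(\mathbb{R}\cup\{\partial\})^{J+1}$, set $Y_t(z):=\partial$ if $z(s)\notin\mathbb{R}^{J+1}$ for some $s\in[0,t]$, and otherwise $Y_t(z):=Y_t(z')$ for any $z'\in\Omega'$ with $z'|_{[0,t]}=z|_{[0,t]}$. Then $Y'_t(\omega):=Y_t(X(\omega),\omega)$, where $X(\omega)$ denotes $t\mapsto X_t(\omega)$, is a continuous martingale in the original market.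
   Context: Setup. Fix integers $1\le J^*\le J$. The sample space is $\Omega:=C[0,\infty)^J$, whose elements are $\omega=(S_1,\dots,S_J)$ with each $S_j:[0,\infty)\to\mathbb{R}$ continuous; $S_1,\dots,S_{J^*}$ are price paths of traded securities, $S_{J^*+1},\dots,S_J$ are information paths. Write $\omega(t):=(S_1(t),\dots,S_J(t))$ and $\omega^*:=(S_1,\dots,S_{J^*})$. $\mathcal{F}$ is the $\sigma$-algebra generated by $\omega\mapsto\omega(t)$, $t\ge0$. A stopping time is an $\mathcal F$-measurable $\tau:\Omega\to[0,\infty]$ such that $\omega|_{[0,\tau(\omega)]}=\omega'|_{[0,\tau(\omega)]}$ implies $\tau(\omega)=\tau(\omega')$; an $\mathcal F$-measurable $h:\Omega\to\mathbb{R}^d$ is $\tau$-measurable if that restriction equality implies $h(\omega)=h(\omega')$. A process is a function $X:[0,\infty)\times\Omega\to[-\infty,\infty]$; it is adapted if $\omega|_{[0,t]}=\omega'|_{[0,t]}$ implies $X_t(\omega)=X_t(\omega')$. A simple trading strategy $G$ consists of stopping times $\tau_1\le\tau_2\le\cdots$ with $\tau_n(\omega)\to\infty$ for every $\omega$ and bounded $\tau_n$-measurable $h_n:\Omega\to\mathbb{R}^{J^*}$; its simple capital process with initial capital $c\in\mathbb{R}$ is $\mathcal K^{G,c}_t(\omega):=c+\sum_{n\ge1}h_n(\omega)\cdot(\omega^*(\tau_{n+1}\wedge t)-\omega^*(\tau_n\wedge t))$. A class of nonnegative processes is $\liminf$-closed if it contains the pointwise $\liminf_kX^k$ whenever it contains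 every $X^k$; nonnegative supermartingales form the smallest $\liminf$-closed class of nonnegative processes containing all nonnegative simple capital processes. A set $E\subseteq[0,\infty)\times\Omega$ holds quasi-always (q.a.) if there is a nonnegative supermartingale $X$ with $X_0=1$ and $X_t(\omega)=\infty$ for all $(t,\omega)\notin E$. Let $\partial\notin\mathbb{R}$ be a cemetery symbol. A continuous process is an adapted $X:[0,\infty)\times\Omega\to\mathbb{R}\cup\{\partial\}$ such that $\{(t,\omega):X_t(\omega)\in\mathbb{R}\}$ holds q.a. and, for every $\omega$, the set of $t$ with $X_t(\omega)\in\mathbb{R}$ contains $0$, is connected, and $t\mapsto X_t(\omega)$ is continuous on it; $\mathrm{dom}\,X:=\{(t,\omega):X_t(\omega)\in\mathbb{R}\}$. A class $\mathcal C$ of continuous processes is lim-closed if it contains every continuous process $X$ for which there exist $X^k\in\mathcal C$ with $\mathrm{dom}\,X\subseteq\mathrm{dom}\,X^k$ for all $k$ and $\lim_k\sup_{s\in[0,t]}|X^k_s(\omega)-X_s(\omega)|=0$ for all $(t,\omega)\in\mathrm{dom}\,X$. The continuous martingales form the smallest lim-closed class of continuous processes containing all simple capital processes. All notions are defined analogously for the new market (with $J+1$ paths, the first $J^*+1$ of which are traded). *)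

theory Defs
  imports "HOL-Analysis.Analysis"
begin

text \<open>A sample point is a J-tuple of paths, encoded as nat => real => real;
  components i >= J and values at negative times are normalised to 0, so that
  mkt_Omega J is in bijection with C[0,oo)^J.\<close>
type_synonym sample = "nat \<Rightarrow> real \<Rightarrow> real"

definition mkt_Omega :: "nat \<Rightarrow> sample set" where
  "mkt_Omega J = {\<omega>. (\<forall>i<J. continuous_on {0..} (\<omega> i)) \<and>
                      (\<forall>i t. (J \<le> i \<or> t < 0) \<longrightarrow> \<omega> i t = 0)}"

definition mkt_F :: "nat \<Rightarrow> sample measure" where
  "mkt_F J = sigma (mkt_Omega J)
     {{\<omega> \<in> mkt_Omega J. \<omega> i t \<in> B} | i t B. i < J \<and> 0 \<le> t \<and> B \<in> sets borel}"

definition agree_upto :: "nat \<Rightarrow> ereal \<Rightarrow> sample \<Rightarrow> sample \<Rightarrow> bool" where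
  "agree_upto J T \<omega> \<omega>' \<longleftrightarrow> (\<forall>i<J. \<forall>s. 0 \<le> s \<and> ereal s \<le> T \<longrightarrow> \<omega> i s = \<omega>' i s)"

definition mkt_stopping_time :: "nat \<Rightarrow> (sample \<Rightarrow> ereal) \<Rightarrow> bool" where
  "mkt_stopping_time J \<tau> \<longleftrightarrow>
     \<tau> \<in> borel_measurable (mkt_F J) \<and> (\<forall>\<omega>\<in>mkt_Omega J. 0 \<le> \<tau> \<omega>) \<and>
     (\<forall>\<omega>\<in>mkt_Omega J. \<forall>\<omega>'\<in>mkt_Omega J. agree_upto J (\<tau> \<omega>) \<omega> \<omega>' \<longrightarrow> \<tau> \<omega> = \<tau> \<omega>')"

definition tau_measurable ::
  "nat \<Rightarrow> nat \<Rightarrow> (sample \<Rightarrow> ereal) \<Rightarrow> (sample \<Rightarrow> nat \<Rightarrow> real) \<Rightarrow> bool" where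
  "tau_measurable J d \<tau> h \<longleftrightarrow>
     (\<forall>i<d. (\<lambda>\<omega>. h \<omega> i) \<in> borel_measurable (mkt_F J)) \<and>
     (\<forall>\<omega>\<in>mkt_Omega J. \<forall>\<omega>'\<in>mkt_Omega J.
        agree_upto J (\<tau> \<omega>) \<omega> \<omega>' \<longrightarrow> (\<forall>i<d. h \<omega> i = h \<omega>' i))"

definition simple_strategy ::
  "nat \<Rightarrow> nat \<Rightarrow> (nat \<Rightarrow> sample \<Rightarrow> ereal) \<Rightarrow> (nat \<Rightarrow> sample \<Rightarrow> nat \<Rightarrow> real) \<Rightarrow> bool" where
  "simple_strategy Jstar J \<tau> h \<longleftrightarrow>
     (\<forall>n. mkt_stopping_time J (\<tau> n)) \<and>
     (\<forall>\<omega>\<in>mkt_Omega J. \<forall>n. \<tau> n \<omega> \<le> \<tau> (Suc n) \<omega>) \<and>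
     (\<forall>\<omega>\<in>mkt_Omega J. (\<lambda>n. \<tau> n \<omega>) \<longlonglongrightarrow> \<infinity>) \<and>
     (\<forall>n. tau_measurable J Jstar (\<tau> n) (h n) \<and>
          (\<exists>C. \<forall>\<omega>\<in>mkt_Omega J. \<forall>i<Jstar. \<bar>h n \<omega> i\<bar> \<le> C))"

text \<open>Simple capital process; the series has only finitely many nonzero terms.\<close>
definition capital ::
  "nat \<Rightarrow> (nat \<Rightarrow> sample \<Rightarrow> ereal) \<Rightarrow> (nat \<Rightarrow> sample \<Rightarrow> nat \<Rightarrow> real) \<Rightarrow> real \<Rightarrow> real \<Rightarrow> sample \<Rightarrow> real" where
  "capital Jstar \<tau> h c t \<omega> = c + (\<Sum>n. \<Sum>i<Jstar. h n \<omega> i *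
      (\<omega> i (real_of_ereal (min (\<tau> (Suc n) \<omega>) (ereal t))) -
       \<omega> i (real_of_ereal (min (\<tau> n \<omega>) (ereal t)))))"

text \<open>Nonnegative supermartingales: smallest liminf-closed class containing all
  nonnegative simple capital processes (processes are identified with their
  restriction to [0,oo) x Omega).\<close>
inductive_set nn_supermart :: "nat \<Rightarrow> nat \<Rightarrow> (real \<Rightarrow> sample \<Rightarrow> ereal) set"
  for Jstar J :: nat where
  simple: "simple_strategy Jstar J \<tau> h \<Longrightarrow>
     (\<forall>t\<ge>0. \<forall>\<omega>\<in>mkt_Omega J. 0 \<le> capital Jstar \<tau> h c t \<omega>) \<Longrightarrow>
     (\<forall>t\<ge>0. \<forall>\<omega>\<in>mkt_Omega J. X t \<omega> = ereal (capital Jstar \<tau> h c t \<omega>)) \<Longrightarrow>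
     X \<in> nn_supermart Jstar J"
| liminf: "(\<forall>k. Xs k \<in> nn_supermart Jstar J) \<Longrightarrow>
     (\<forall>t\<ge>0. \<forall>\<omega>\<in>mkt_Omega J. X t \<omega> = liminf (\<lambda>k. Xs k t \<omega>)) \<Longrightarrow>
     X \<in> nn_supermart Jstar J"

definition quasi_always :: "nat \<Rightarrow> nat \<Rightarrow> (real \<times> sample) set \<Rightarrow> bool" where
  "quasi_always Jstar J E \<longleftrightarrow>
     (\<exists>X\<in>nn_supermart Jstar J. (\<forall>\<omega>\<in>mkt_Omega J. X 0 \<omega> = 1) \<and>
        (\<forall>t\<ge>0. \<forall>\<omega>\<in>mkt_Omega J. (t, \<omega>) \<notin> E \<longrightarrow> X t \<omega> = \<infinity>))"

text \<open>Processes with values in R \<union> {cemetery}: None plays the role of the cemetery.\<close>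
definition pdom :: "nat \<Rightarrow> (real \<Rightarrow> sample \<Rightarrow> real option) \<Rightarrow> (real \<times> sample) set" where
  "pdom J X = {(t, \<omega>). 0 \<le> t \<and> \<omega> \<in> mkt_Omega J \<and> X t \<omega> \<noteq> None}"

definition continuous_process :: "nat \<Rightarrow> nat \<Rightarrow> (real \<Rightarrow> sample \<Rightarrow> real option) \<Rightarrow> bool" where
  "continuous_process Jstar J X \<longleftrightarrow>
     (\<forall>t\<ge>0. \<forall>\<omega>\<in>mkt_Omega J. \<forall>\<omega>'\<in>mkt_Omega J.
        agree_upto J (ereal t) \<omega> \<omega>' \<longrightarrow> X t \<omega> = X t \<omega>') \<and>
     quasi_always Jstar J (pdom J X) \<and>
     (\<forall>\<omega>\<in>mkt_Omega J. X 0 \<omega> \<noteq> None \<and>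
        connected {t. 0 \<le> t \<and> X t \<omega> \<noteq> None} \<and>
        continuous_on {t. 0 \<le> t \<and> X t \<omega> \<noteq> None} (\<lambda>t. the (X t \<omega>)))"

inductive_set cont_mart :: "nat \<Rightarrow> nat \<Rightarrow> (real \<Rightarrow> sample \<Rightarrow> real option) set"
  for Jstar J :: nat where
  simple: "simple_strategy Jstar J \<tau> h \<Longrightarrow> continuous_process Jstar J X \<Longrightarrow>
     (\<forall>t\<ge>0. \<forall>\<omega>\<in>mkt_Omega J. X t \<omega> = Some (capital Jstar \<tau> h c t \<omega>)) \<Longrightarrow>
     X \<in> cont_mart Jstar J"
| lim: "continuous_process Jstar J X \<Longrightarrow> (\<forall>k. Xs k \<in> cont_mart Jstar J) \<Longrightarrow>
     (\<forall>k. pdom J X \<subseteq> pdom J (Xs k)) \<Longrightarrow>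
     (\<forall>(t, \<omega>)\<in>pdom J X.
        (\<lambda>k. SUP s\<in>{0..t}. \<bar>the (Xs k s \<omega>) - the (X s \<omega>)\<bar>) \<longlonglongrightarrow> 0) \<Longrightarrow>
     X \<in> cont_mart Jstar J"

text \<open>Y'_t(omega) := Y_t(X(omega), omega), where the new market has sample points
  (X', S_1, ..., S_J) encoded with index 0 for X' and index i+1 for S_(i+1).\<close>
definition lift_process ::
  "nat \<Rightarrow> (real \<Rightarrow> sample \<Rightarrow> real option) \<Rightarrow> (real \<Rightarrow> sample \<Rightarrow> real option) \<Rightarrow> real \<Rightarrow> sample \<Rightarrow> real option" where
  "lift_process J X Y t \<omega> =
     (if \<exists>s\<in>{0..t}. X s \<omega> = None then None
      else Y t (SOME z. z \<in> mkt_Omega (Suc J) \<and>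
                  agree_upto (Suc J) (ereal t) z
                    (\<lambda>i s. if i = 0 then the (X s \<omega>) else \<omega> (i - 1) s)))"

end

theory Submission
  imports Defs
begin

text \<open>
  Rounding trading times up to a deterministic grid shows that the continuous martingales are already
  generated by the elementary capital processes, which trade finitely often and at fixed rational
  times. Lifting an elementary process of the new market along \<open>X\<close> gives an elementary integral
  against \<open>X\<close> and the old securities; its integrands are \<open>\<F>\<close>-measurable after modification outside
  the domain of \<open>X\<close>, and since such integrals preserve local uniform limits it is a continuous
  martingale by induction on \<open>X\<close>. Induction on \<open>Y\<close> then gives the theorem, provided that the domain of
  every lifted process holds quasi-always. For this, nonnegative supermartingales of the new market
  are lifted too: stopping elementary processes when they hit \<open>0\<close> turns a continuous martingale that is
  nonnegative on its domain into a nonnegative supermartingale with the same values there. The lift of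
  a supermartingale that explodes outside the domain of \<open>Y\<close> is finally averaged with one that explodes
  outside the domain of \<open>X\<close>.
\<close>

section \<open>Elementary capital processes\<close>

text \<open>Lifting must get by with finite horizons. Where X reaches the cemetery there is no
  sample point of the new market to which a stopping time of that market could be applied, so
  trading at random times does not carry over directly. A position opened at a fixed time
  \<open>u\<close> needs the path of X only on [0,u], and before \<open>u\<close> its gain is zero.
  Measurability is a second obstacle: a continuous martingale is by definition only adapted, and
  nothing makes the event that X_t is real measurable, so integrands have to be built from
  measurable versions of X at rational times. There is also an apparent circle: admitting a limit to
  the class requires its domain to hold quasi-always, and the supermartingales that prove this must
  themselves be lifted. It is broken by the totality of simple capital processes: their lifts have
  exactly the domain of X, for which the property is already known.\<close>

lemma agree_upto_sym: "agree_upto J T z z' \<Longrightarrow> agree_upto J T z' z"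
  by (simp add: agree_upto_def)

lemma agree_upto_trans:
  "agree_upto J T z z' \<Longrightarrow> agree_upto J T z' z'' \<Longrightarrow> agree_upto J T z z''"
  by (simp add: agree_upto_def)

lemma agree_upto_mono: "agree_upto J T z z' \<Longrightarrow> S \<le> T \<Longrightarrow> agree_upto J S z z'"
  unfolding agree_upto_def by (meson order_trans)

lemma agree_uptoD: "agree_upto J (ereal t) z z' \<Longrightarrow> i < J \<Longrightarrow> 0 \<le> s \<Longrightarrow> s \<le> t \<Longrightarrow> z i s = z' i s"
  by (simp add: agree_upto_def)

lemma space_mkt_F [simp]: "space (mkt_F J) = mkt_Omega J"
  unfolding mkt_F_def by (rule space_measure_of) auto

lemma coordinate_measurable:
  assumes "i < J" "0 \<le> t"
  shows "(\<lambda>\<omega>. \<omega> i t) \<in> borel_measurable (mkt_F J)"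
proof (rule measurableI)
  fix B :: "real set" assume B: "B \<in> sets borel"
  have "(\<lambda>\<omega>. \<omega> i t) -` B \<inter> space (mkt_F J) = {\<omega> \<in> mkt_Omega J. \<omega> i t \<in> B}"
    by auto
  moreover have "\<dots> \<in> sets (mkt_F J)"
    unfolding mkt_F_def by (subst sets_measure_of) (use B assms in \<open>auto intro!: sigma_sets.Basic\<close>)
  ultimately show "(\<lambda>\<omega>. \<omega> i t) -` B \<inter> space (mkt_F J) \<in> sets (mkt_F J)" by simp
qed auto

lemma measurable_into_mkt_F:
  assumes "\<And>\<omega>. \<omega> \<in> space M \<Longrightarrow> f \<omega> \<in> mkt_Omega J"
    and "\<And>i t. i < J \<Longrightarrow> 0 \<le> t \<Longrightarrow> (\<lambda>\<omega>. f \<omega> i t) \<in> borel_measurable M"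
  shows "f \<in> measurable M (mkt_F J)"
  unfolding mkt_F_def
proof (rule measurable_measure_of)
  show "f \<in> space M \<rightarrow> mkt_Omega J" using assms(1) by auto
  fix y assume "y \<in> {{\<omega> \<in> mkt_Omega J. \<omega> i t \<in> B} |i t B. i < J \<and> 0 \<le> t \<and> B \<in> sets borel}"
  then obtain i t B where y: "y = {\<omega> \<in> mkt_Omega J. \<omega> i t \<in> B}" "i < J" "0 \<le> t" "B \<in> sets borel"
    by auto
  have "f -` y \<inter> space M = (\<lambda>\<omega>. f \<omega> i t) -` B \<inter> space M"
    using assms(1) y(1) by auto
  then show "f -` y \<inter> space M \<in> sets M"
    using measurable_sets[OF assms(2)[OF y(2,3)] y(4)] by simp
qed auto

section \<open>Bounded integrands known at a deterministic time\<close>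

definition position_at :: "nat \<Rightarrow> real \<Rightarrow> (sample \<Rightarrow> real) \<Rightarrow> bool" where
  "position_at J u g \<longleftrightarrow> g \<in> borel_measurable (mkt_F J) \<and>
     (\<exists>C. \<forall>\<omega>\<in>mkt_Omega J. \<bar>g \<omega>\<bar> \<le> C) \<and>
     (\<forall>\<omega>\<in>mkt_Omega J. \<forall>\<omega>'\<in>mkt_Omega J. agree_upto J (ereal u) \<omega> \<omega>' \<longrightarrow> g \<omega> = g \<omega>')"

lemma position_atD:
  assumes "position_at J u g"
  shows "g \<in> borel_measurable (mkt_F J)"
    and "\<omega> \<in> mkt_Omega J \<Longrightarrow> \<omega>' \<in> mkt_Omega J \<Longrightarrow> agree_upto J (ereal u) \<omega> \<omega>' \<Longrightarrow> g \<omega> = g \<omega>'"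
  using assms unfolding position_at_def by blast+

lemma position_at_agree:
  assumes "position_at J u g" "u \<le> t" "\<omega> \<in> mkt_Omega J" "\<omega>' \<in> mkt_Omega J"
    "agree_upto J (ereal t) \<omega> \<omega>'"
  shows "g \<omega> = g \<omega>'"
  using assms by (intro position_atD(2)[OF assms(1)]) (auto elim: agree_upto_mono)

lemma position_at_const: "position_at J u (\<lambda>_. c)"
  unfolding position_at_def by auto

lemma position_at_mono:
  assumes "position_at J u g" "u \<le> v"
  shows "position_at J v g"
  unfolding position_at_def
proof (intro conjI ballI impI)
  show "\<exists>C. \<forall>\<omega>\<in>mkt_Omega J. \<bar>g \<omega>\<bar> \<le> C" using assms(1) unfolding position_at_def by blast
qed (fact position_atD(1)[OF assms(1)], rule position_at_agree[OF assms])

lemma position_at_mult: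
  assumes "position_at J u f" "position_at J u g"
  shows "position_at J u (\<lambda>\<omega>. f \<omega> * g \<omega>)"
proof -
  obtain C D where C: "\<forall>\<omega>\<in>mkt_Omega J. \<bar>f \<omega>\<bar> \<le> C" and D: "\<forall>\<omega>\<in>mkt_Omega J. \<bar>g \<omega>\<bar> \<le> D"
    using assms unfolding position_at_def by blast
  have "\<bar>f \<omega> * g \<omega>\<bar> \<le> C * D" if "\<omega> \<in> mkt_Omega J" for \<omega>
    unfolding abs_mult using C D that
    by (intro mult_mono) (auto intro: order_trans[OF abs_ge_zero])
  moreover have "(\<lambda>\<omega>. f \<omega> * g \<omega>) \<in> borel_measurable (mkt_F J)"
    using assms by (intro borel_measurable_times position_atD(1))
  moreover have "f \<omega> = f \<omega>'" "g \<omega> = g \<omega>'"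
    if "\<omega> \<in> mkt_Omega J" "\<omega>' \<in> mkt_Omega J" "agree_upto J (ereal u) \<omega> \<omega>'" for \<omega> \<omega>'
    by (rule position_atD(2)[OF assms(1) that], rule position_atD(2)[OF assms(2) that])
  ultimately show ?thesis
    unfolding position_at_def by metis
qed

lemma position_at_add:
  assumes "position_at J u f" "position_at J u g"
  shows "position_at J u (\<lambda>\<omega>. f \<omega> + g \<omega>)"
proof -
  obtain C D where C: "\<forall>\<omega>\<in>mkt_Omega J. \<bar>f \<omega>\<bar> \<le> C" and D: "\<forall>\<omega>\<in>mkt_Omega J. \<bar>g \<omega>\<bar> \<le> D"
    using assms unfolding position_at_def by blast
  have "\<bar>f \<omega> + g \<omega>\<bar> \<le> C + D" if "\<omega> \<in> mkt_Omega J" for \<omega>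
    using C D that by (meson abs_triangle_ineq add_mono order_trans)
  moreover have "(\<lambda>\<omega>. f \<omega> + g \<omega>) \<in> borel_measurable (mkt_F J)"
    using assms by (intro borel_measurable_add position_atD(1))
  moreover have "f \<omega> = f \<omega>'" "g \<omega> = g \<omega>'"
    if "\<omega> \<in> mkt_Omega J" "\<omega>' \<in> mkt_Omega J" "agree_upto J (ereal u) \<omega> \<omega>'" for \<omega> \<omega>'
    by (rule position_atD(2)[OF assms(1) that], rule position_atD(2)[OF assms(2) that])
  ultimately show ?thesis
    unfolding position_at_def by metis
qed

text \<open>The pathwise half of \<open>continuous_process\<close>. It does not involve the traded
  securities and can be checked sample by sample, whereas the quasi-always condition on the domain
  is the hard point of the lift and is treated separately.\<close>

definition path_process :: "nat \<Rightarrow> (real \<Rightarrow> sample \<Rightarrow> real option) \<Rightarrow> bool" where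
  "path_process J X \<longleftrightarrow>
     (\<forall>t\<ge>0. \<forall>\<omega>\<in>mkt_Omega J. \<forall>\<omega>'\<in>mkt_Omega J.
        agree_upto J (ereal t) \<omega> \<omega>' \<longrightarrow> X t \<omega> = X t \<omega>') \<and>
     (\<forall>\<omega>\<in>mkt_Omega J. X 0 \<omega> \<noteq> None \<and>
        connected {t. 0 \<le> t \<and> X t \<omega> \<noteq> None} \<and>
        continuous_on {t. 0 \<le> t \<and> X t \<omega> \<noteq> None} (\<lambda>t. the (X t \<omega>)))"

lemma continuous_process_alt:
  "continuous_process Jstar J X \<longleftrightarrow> path_process J X \<and> quasi_always Jstar J (pdom J X)"
  unfolding continuous_process_def path_process_def by blast

lemma path_process_adapted:
  "path_process J X \<Longrightarrow> 0 \<le> t \<Longrightarrow> \<omega> \<in> mkt_Omega J \<Longrightarrow> \<omega>' \<in> mkt_Omega J \<Longrightarrow>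
    agree_upto J (ereal t) \<omega> \<omega>' \<Longrightarrow> X t \<omega> = X t \<omega>'"
  unfolding path_process_def by blast

lemma path_process_dom:
  assumes "path_process J X" "\<omega> \<in> mkt_Omega J"
  shows path_process_0: "X 0 \<omega> \<noteq> None"
    and "connected {t. 0 \<le> t \<and> X t \<omega> \<noteq> None}"
    and "continuous_on {t. 0 \<le> t \<and> X t \<omega> \<noteq> None} (\<lambda>t. the (X t \<omega>))"
proof -
  note * = bspec[OF conjunct2[OF assms(1)[unfolded path_process_def]] assms(2)]
  show "X 0 \<omega> \<noteq> None" by (rule conjunct1[OF *])
  show "connected {t. 0 \<le> t \<and> X t \<omega> \<noteq> None}" by (rule conjunct1[OF conjunct2[OF *]])
  show "continuous_on {t. 0 \<le> t \<and> X t \<omega> \<noteq> None} (\<lambda>t. the (X t \<omega>))"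
    by (rule conjunct2[OF conjunct2[OF *]])
qed

lemma path_process_down:
  assumes "path_process J X" "\<omega> \<in> mkt_Omega J" "X t \<omega> \<noteq> None" "0 \<le> s" "s \<le> t"
  shows "X s \<omega> \<noteq> None"
proof -
  have "s \<in> {t. 0 \<le> t \<and> X t \<omega> \<noteq> None}"
    by (rule connectedD_interval[OF path_process_dom(2)[OF assms(1,2)], of 0 t])
      (use path_process_dom(1)[OF assms(1,2)] assms(3-) in simp_all)
  then show ?thesis by simp
qed

lemma path_process_cont:
  assumes "path_process J X" "\<omega> \<in> mkt_Omega J" "X t \<omega> \<noteq> None"
  shows "continuous_on {0..t} (\<lambda>s. the (X s \<omega>))"
proof (rule continuous_on_subset)
  show "continuous_on {t. 0 \<le> t \<and> X t \<omega> \<noteq> None} (\<lambda>t. the (X t \<omega>))"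
    by (rule path_process_dom(3)[OF assms(1,2)])
  show "{0..t} \<subseteq> {t. 0 \<le> t \<and> X t \<omega> \<noteq> None}"
  proof
    fix s assume "s \<in> {0..t}"
    then show "s \<in> {t. 0 \<le> t \<and> X t \<omega> \<noteq> None}"
      using path_process_down[OF assms(1), of \<omega> t s] assms(2,3) by auto
  qed
qed

text \<open>Continuity is local: if \<open>D\<close> has a point above \<open>s\<close>, then near
  \<open>s\<close> it coincides with a compact interval on which \<open>f\<close> is continuous; if
  not, \<open>s\<close> is the maximum and \<open>D\<close> is itself such an interval.\<close>

lemma continuous_on_interval_from_0:
  fixes f :: "real \<Rightarrow> real"
  assumes down: "\<And>s t. t \<in> D \<Longrightarrow> 0 \<le> s \<Longrightarrow> s \<le> t \<Longrightarrow> s \<in> D" and D: "D \<subseteq> {0..}"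
    and cont: "\<And>t. t \<in> D \<Longrightarrow> continuous_on {0..t} f"
  shows "continuous_on D f"
  unfolding continuous_on_eq_continuous_within
proof
  fix s assume s: "s \<in> D"
  show "continuous (at s within D) f"
  proof (cases "\<exists>t\<in>D. s < t")
    case True
    then obtain t where t: "t \<in> D" "s < t" by auto
    have "at s within D = at s within {0..t}"
    proof (rule at_within_nhd[of s "{..<t}"])
      show "D \<inter> {..<t} - {s} = {0..t} \<inter> {..<t} - {s}"
        using down[OF t(1)] D by auto
    qed (use t in auto)
    moreover have "s \<in> {0..t}" using s t D by auto
    ultimately show ?thesis
      using cont[OF t(1)] unfolding continuous_on_eq_continuous_within by auto
  next
    case False
    then have "D = {0..s}" using down[OF s] D s by force
    then show ?thesis
      using cont[OF s] s unfolding continuous_on_eq_continuous_within by auto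
  qed
qed

text \<open>A set of nonnegative times containing 0 is connected exactly when it is closed downwards
  in [0,oo). In this form the domain condition and continuity can both be verified on compact
  intervals [0,t].\<close>

lemma path_processI:
  assumes "\<And>t \<omega> \<omega>'. 0 \<le> t \<Longrightarrow> \<omega> \<in> mkt_Omega J \<Longrightarrow> \<omega>' \<in> mkt_Omega J \<Longrightarrow>
      agree_upto J (ereal t) \<omega> \<omega>' \<Longrightarrow> X t \<omega> = X t \<omega>'"
    and "\<And>\<omega>. \<omega> \<in> mkt_Omega J \<Longrightarrow> X 0 \<omega> \<noteq> None"
    and down: "\<And>s t \<omega>. \<omega> \<in> mkt_Omega J \<Longrightarrow> X t \<omega> \<noteq> None \<Longrightarrow> 0 \<le> s \<Longrightarrow> s \<le> t \<Longrightarrow> X s \<omega> \<noteq> None"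
    and cont: "\<And>t \<omega>. \<omega> \<in> mkt_Omega J \<Longrightarrow> 0 \<le> t \<Longrightarrow> X t \<omega> \<noteq> None \<Longrightarrow>
      continuous_on {0..t} (\<lambda>s. the (X s \<omega>))"
  shows "path_process J X"
proof -
  have *: "connected {t. 0 \<le> t \<and> X t \<omega> \<noteq> None} \<and>
      continuous_on {t. 0 \<le> t \<and> X t \<omega> \<noteq> None} (\<lambda>t. the (X t \<omega>))"
    if \<omega>: "\<omega> \<in> mkt_Omega J" for \<omega>
  proof
    let ?D = "{t. 0 \<le> t \<and> X t \<omega> \<noteq> None}"
    have D: "s \<in> ?D" if "t \<in> ?D" "0 \<le> s" "s \<le> t" for s t
      using down[OF \<omega>, of t s] that by simp
    show "connected ?D"
      unfolding connected_iff_interval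
    proof (intro ballI allI impI)
      fix x y z assume "x \<in> ?D" "y \<in> ?D" "x \<le> z" "z \<le> y"
      moreover from this have "0 \<le> z" by simp
      ultimately show "z \<in> ?D" using D[of y z] by blast
    qed
    show "continuous_on ?D (\<lambda>t. the (X t \<omega>))"
    proof (rule continuous_on_interval_from_0[OF D])
      fix t assume "t \<in> ?D"
      then show "continuous_on {0..t} (\<lambda>t. the (X t \<omega>))" using cont[OF \<omega>, of t] by simp
    qed auto
  qed
  show ?thesis
    unfolding path_process_def
    by (intro conjI allI ballI impI) (fact assms(1) assms(2) *[THEN conjunct1] *[THEN conjunct2])+
qed

text \<open>The trading times are rational so that finitely many gambles fit on a common grid.\<close>
inductive_set elem :: "nat \<Rightarrow> nat \<Rightarrow> (real \<Rightarrow> sample \<Rightarrow> real) set" for Jstar J :: nat where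
  const: "(\<lambda>t \<omega>. c) \<in> elem Jstar J"
| gamble: "K \<in> elem Jstar J \<Longrightarrow> i < Jstar \<Longrightarrow> u \<in> \<rat> \<Longrightarrow> v \<in> \<rat> \<Longrightarrow> 0 \<le> u \<Longrightarrow> u \<le> v \<Longrightarrow>
    position_at J u g \<Longrightarrow>
    (\<lambda>t \<omega>. K t \<omega> + g \<omega> * (\<omega> i (min v t) - \<omega> i (min u t))) \<in> elem Jstar J"

text \<open>Here \<open>x\<close> stands for the price process of the new security.\<close>
inductive_set efun :: "nat \<Rightarrow> nat \<Rightarrow> ((real \<Rightarrow> sample \<Rightarrow> real) \<Rightarrow> real \<Rightarrow> sample \<Rightarrow> real) set"
  for Jstar J :: nat where
  const: "(\<lambda>x t \<omega>. c) \<in> efun Jstar J"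
| gamble: "F \<in> efun Jstar J \<Longrightarrow> i < Jstar \<Longrightarrow> u \<in> \<rat> \<Longrightarrow> v \<in> \<rat> \<Longrightarrow> 0 \<le> u \<Longrightarrow> u \<le> v \<Longrightarrow>
    position_at J u g \<Longrightarrow>
    (\<lambda>x t \<omega>. F x t \<omega> + g \<omega> * (\<omega> i (min v t) - \<omega> i (min u t))) \<in> efun Jstar J"
| gamble_x: "F \<in> efun Jstar J \<Longrightarrow> u \<in> \<rat> \<Longrightarrow> v \<in> \<rat> \<Longrightarrow> 0 \<le> u \<Longrightarrow> u \<le> v \<Longrightarrow>
    position_at J u g \<Longrightarrow>
    (\<lambda>x t \<omega>. F x t \<omega> + g \<omega> * (x (min v t) \<omega> - x (min u t) \<omega>)) \<in> efun Jstar J"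

text \<open>Regarded as a functional that ignores the price process \<open>x\<close>, an elementary
  process inherits the continuity and adaptedness proved for \<open>efun\<close>.\<close>

lemma elem_imp_efun: "K \<in> elem Jstar J \<Longrightarrow> (\<lambda>x. K) \<in> efun Jstar J"
proof (induction rule: elem.induct)
  case (gamble K i u v g)
  show ?case by (rule efun.gamble[OF gamble.IH gamble.hyps(2-)])
qed (rule efun.const)

lemma efun_cong:
  "F \<in> efun Jstar J \<Longrightarrow> 0 \<le> t \<Longrightarrow> (\<And>s. 0 \<le> s \<Longrightarrow> s \<le> t \<Longrightarrow> x s \<omega> = y s \<omega>) \<Longrightarrow> F x t \<omega> = F y t \<omega>"
  by (induction rule: efun.induct) (auto simp: min_def)

lemma efun_adapted:
  assumes "F \<in> efun Jstar J" "Jstar \<le> J" "0 \<le> t" and \<omega>: "\<omega> \<in> mkt_Omega J" "\<omega>' \<in> mkt_Omega J"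
    and agree: "agree_upto J (ereal t) \<omega> \<omega>'"
    and x: "\<And>s. 0 \<le> s \<Longrightarrow> s \<le> t \<Longrightarrow> x s \<omega> = x s \<omega>'"
  shows "F x t \<omega> = F x t \<omega>'"
  using assms(1)
proof (induction rule: efun.induct)
  case (gamble F i u v g)
  then have "\<omega> i (min v t) = \<omega>' i (min v t)" "\<omega> i (min u t) = \<omega>' i (min u t)"
    using assms(2,3) by (auto intro!: agree_uptoD[OF agree])
  \<comment> \<open>For \<open>t < u\<close> the two samples may give different positions, but then
    both clamped times equal \<open>t\<close> and the increment is zero.\<close>
  moreover have "u \<le> t \<Longrightarrow> g \<omega> = g \<omega>'"
    using gamble.hyps \<omega> agree position_at_agree[of J u g t \<omega> \<omega>'] by auto
  ultimately show ?case
    using gamble by (cases "u \<le> t") (auto simp: min_def)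
next
  case (gamble_x F u v g)
  then have "x (min v t) \<omega> = x (min v t) \<omega>'" "x (min u t) \<omega> = x (min u t) \<omega>'"
    using assms(3) by (auto intro!: x)
  moreover have "u \<le> t \<Longrightarrow> g \<omega> = g \<omega>'"
    using gamble_x.hyps \<omega> agree position_at_agree[of J u g t \<omega> \<omega>'] by auto
  ultimately show ?case
    using gamble_x by (cases "u \<le> t") (auto simp: min_def)
qed auto

lemma continuous_on_sample:
  "\<omega> \<in> mkt_Omega J \<Longrightarrow> i < J \<Longrightarrow> continuous_on {0..t} (\<omega> i)"
  by (rule continuous_on_subset[of "{0..}"]) (auto simp: mkt_Omega_def)

lemma efun_cont:
  assumes "F \<in> efun Jstar J" "Jstar \<le> J" "\<omega> \<in> mkt_Omega J"
    and x: "continuous_on {0..t} (\<lambda>s. x s \<omega>)"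
  shows "continuous_on {0..t} (\<lambda>s. F x s \<omega>)"
  using assms(1)
proof (induction rule: efun.induct)
  case (gamble F i u v g)
  have "continuous_on {0..t} (\<lambda>s. \<omega> i (min w s))" if "0 \<le> w" for w
    using gamble.hyps assms(2,3) that
    by (intro continuous_on_compose2[OF continuous_on_sample[of \<omega> J i t]] continuous_intros) auto
  then show ?case using gamble by (intro continuous_intros) auto
next
  case (gamble_x F u v g)
  have "continuous_on {0..t} (\<lambda>s. x (min w s) \<omega>)" if "0 \<le> w" for w
    using that by (intro continuous_on_compose2[OF x] continuous_intros) auto
  then show ?case using gamble_x by (intro continuous_intros) auto
qed auto

text \<open>For a fixed sample the functional is affine in finitely many clamped values of
  \<open>x\<close>, with coefficients that do not depend on \<open>x\<close>. Hence uniform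
  convergence of the integrators passes to the integrals without any stochastic calculus.\<close>

lemma efun_uniform_limit:
  assumes "F \<in> efun Jstar J"
    and x: "uniform_limit {0..t} (\<lambda>k s. X k s \<omega>) (\<lambda>s. x s \<omega>) sequentially"
  shows "uniform_limit {0..t} (\<lambda>k s. F (X k) s \<omega>) (\<lambda>s. F x s \<omega>) sequentially"
  using assms(1)
proof (induction rule: efun.induct)
  case (const c)
  show ?case by (rule uniform_limit_const)
next
  case (gamble F i u v g)
  show ?case by (rule uniform_limit_add[OF gamble.IH uniform_limit_const])
next
  case (gamble_x F u v g)
  have lim: "uniform_limit {0..t} (\<lambda>k s. X k (min w s) \<omega>) (\<lambda>s. x (min w s) \<omega>) sequentially"
    if "0 \<le> w" for w
    using that by (intro uniform_limit_compose'[OF x]) auto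
  have "uniform_limit {0..t} (\<lambda>k s. g \<omega> * (X k (min v s) \<omega> - X k (min u s) \<omega>))
      (\<lambda>s. g \<omega> * (x (min v s) \<omega> - x (min u s) \<omega>)) sequentially"
    using gamble_x.hyps
    by (intro bounded_linear.uniform_limit[OF bounded_linear_mult_right] uniform_limit_minus lim) auto
  then show ?case by (rule uniform_limit_add[OF gamble_x.IH])
qed

lemma elem_cont:
  "K \<in> elem Jstar J \<Longrightarrow> Jstar \<le> J \<Longrightarrow> \<omega> \<in> mkt_Omega J \<Longrightarrow> continuous_on {0..t} (\<lambda>s. K s \<omega>)"
  using efun_cont[OF elem_imp_efun, of K Jstar J _ t "\<lambda>_ _. 0"] by simp

lemma elem_adapted:
  "K \<in> elem Jstar J \<Longrightarrow> Jstar \<le> J \<Longrightarrow> 0 \<le> t \<Longrightarrow> \<omega> \<in> mkt_Omega J \<Longrightarrow> \<omega>' \<in> mkt_Omega J \<Longrightarrow>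
    agree_upto J (ereal t) \<omega> \<omega>' \<Longrightarrow> K t \<omega> = K t \<omega>'"
  using efun_adapted[OF elem_imp_efun, of K Jstar J t \<omega> \<omega>' "\<lambda>_ _. 0"] by simp

lemma path_process_elem:
  assumes "K \<in> elem Jstar J" "Jstar \<le> J"
  shows "path_process J (\<lambda>t \<omega>. Some (K t \<omega>))"
proof (rule path_processI)
  fix t \<omega> \<omega>' assume "0 \<le> t" "\<omega> \<in> mkt_Omega J" "\<omega>' \<in> mkt_Omega J" "agree_upto J (ereal t) \<omega> \<omega>'"
  from elem_adapted[OF assms this] show "Some (K t \<omega>) = Some (K t \<omega>')" by simp
next
  fix t \<omega> assume "\<omega> \<in> mkt_Omega J"
  from elem_cont[OF assms this] show "continuous_on {0..t} (\<lambda>s. the (Some (K s \<omega>)))" by simp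
qed (rule option.distinct)+

lemma elem_measurable:
  assumes "K \<in> elem Jstar J" "Jstar \<le> J" "0 \<le> t"
  shows "K t \<in> borel_measurable (mkt_F J)"
  using assms(1)
proof (induction rule: elem.induct)
  case (gamble K i u v g)
  then show ?case
    using assms(2,3)
    by (intro borel_measurable_add borel_measurable_times borel_measurable_diff
        coordinate_measurable) (auto dest: position_atD(1))
qed simp

lemma elem_at_0:
  assumes "K \<in> elem Jstar J"
  shows "\<exists>c. \<forall>\<omega>. K 0 \<omega> = c"
  using assms by (induction rule: elem.induct) simp_all

lemma elem_add:
  assumes "K \<in> elem Jstar J" "L \<in> elem Jstar J"
  shows "(\<lambda>t \<omega>. K t \<omega> + L t \<omega>) \<in> elem Jstar J"
  using assms
proof (induction rule: elem.induct)
  case (const c)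
  then show ?case
  proof (induction rule: elem.induct)
    case (const d) show ?case by (rule elem.const)
  next
    case (gamble K i u v g)
    from elem.gamble[OF gamble.IH gamble.hyps(2-)] show ?case by (simp add: add_ac)
  qed
next
  case (gamble K i u v g)
  from elem.gamble[OF gamble.IH gamble.hyps(2-)] gamble.prems show ?case by (simp add: add_ac)
qed

lemma elem_sum:
  "finite A \<Longrightarrow> (\<And>a. a \<in> A \<Longrightarrow> K a \<in> elem Jstar J) \<Longrightarrow> (\<lambda>t \<omega>. \<Sum>a\<in>A. K a t \<omega>) \<in> elem Jstar J"
proof (induction A rule: finite_induct)
  case (insert a A)
  have "(\<lambda>t \<omega>. K a t \<omega> + (\<Sum>b\<in>A. K b t \<omega>)) \<in> elem Jstar J"
    using insert by (intro elem_add) auto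
  then show ?case using insert.hyps by simp
qed (simp add: elem.const)

lemma elem_single:
  assumes "i < Jstar" "u \<in> \<rat>" "v \<in> \<rat>" "0 \<le> u" "u \<le> v" "position_at J u g"
  shows "(\<lambda>t \<omega>. g \<omega> * (\<omega> i (min v t) - \<omega> i (min u t))) \<in> elem Jstar J"
  using elem.gamble[OF elem.const[of 0] assms] by simp

lemma elem_scale:
  "K \<in> elem Jstar J \<Longrightarrow> (\<lambda>t \<omega>. c * K t \<omega>) \<in> elem Jstar J"
proof (induction rule: elem.induct)
  case (gamble K i u v g)
  from elem.gamble[OF gamble.IH gamble.hyps(2-6) position_at_mult[OF position_at_const[of _ _ c] gamble.hyps(7)]]
  show ?case by (simp add: algebra_simps)
qed (rule elem.const)

text \<open>Clamping to [u,v] first leaves only the part of [u1,v1] inside [u,v]. If the two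
  intervals do not meet, the outer \<open>max\<close> collapses the right endpoint onto the left one
  and the increment is zero.\<close>

lemma increment_clamp:
  fixes f :: "real \<Rightarrow> real"
  assumes "u \<le> v" "u1 \<le> v1"
  shows "f (min v1 (min v t)) - f (min u1 (min v t)) - (f (min v1 (min u t)) - f (min u1 (min u t)))
    = f (min (max (max u u1) (min v v1)) t) - f (min (max u u1) t)"
proof -
  consider "v \<le> u1" | "v1 \<le> u" | "u1 < v" "u < v1" by linarith
  then show ?thesis
  proof cases
    case 1
    then have "max (max u u1) (min v v1) = max u u1" "min u1 (min v t) = min v t"
      "min v1 (min v t) = min v t" "min u1 (min u t) = min u t" "min v1 (min u t) = min u t"
      using assms by linarith+
    then show ?thesis by simp
  next
    case 2
    then have "max (max u u1) (min v v1) = max u u1" "min v1 (min v t) = min v1 t"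
      "min v1 (min u t) = min v1 t" "min u1 (min u t) = min u1 t" "min u1 (min v t) = min u1 t"
      using assms by linarith+
    then show ?thesis by simp
  next
    case 3
    then have *: "max (max u u1) (min v v1) = min v v1" "min u1 (min v t) = min u1 t"
      "min v1 (min u t) = min u t" "min v1 (min v t) = min (min v v1) t"
      using assms by linarith+
    show ?thesis
    proof (cases "u \<le> u1")
      case True
      then have "max u u1 = u1" "min u1 (min u t) = min u t" by linarith+
      then show ?thesis unfolding * by simp
    next
      case False
      then have "max u u1 = u" "min u1 (min u t) = min u1 t" by linarith+
      then show ?thesis unfolding * by simp
    qed
  qed
qed

text \<open>Associativity of elementary integration: integrating against an integral multiplies the
  positions. The product is known at the later opening time \<open>max u u1\<close>, which is again
  rational.\<close>

lemma elem_integral: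
  assumes "K \<in> elem Jstar J" "u \<in> \<rat>" "v \<in> \<rat>" "0 \<le> u" "u \<le> v" "position_at J u g"
  shows "(\<lambda>t \<omega>. g \<omega> * (K (min v t) \<omega> - K (min u t) \<omega>)) \<in> elem Jstar J"
  using assms(1)
proof (induction rule: elem.induct)
  case (const c)
  then show ?case using elem.const[of 0] by simp
next
  case (gamble K i u1 v1 g1)
  let ?u = "max u u1" and ?v = "max (max u u1) (min v v1)"
  have "(\<lambda>t \<omega>. g \<omega> * (K (min v t) \<omega> - K (min u t) \<omega>) +
      (g \<omega> * g1 \<omega>) * (\<omega> i (min ?v t) - \<omega> i (min ?u t))) \<in> elem Jstar J"
    by (intro elem.gamble[OF gamble.IH \<open>i < Jstar\<close>] position_at_mult
          position_at_mono[OF assms(6)] position_at_mono[OF \<open>position_at J u1 g1\<close>])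
      (use gamble.hyps assms in \<open>simp_all add: max_def min_def\<close>)
  moreover have "g \<omega> * (K (min v t) \<omega> - K (min u t) \<omega>) +
      (g \<omega> * g1 \<omega>) * (\<omega> i (min ?v t) - \<omega> i (min ?u t)) =
     g \<omega> * (K (min v t) \<omega> + g1 \<omega> * (\<omega> i (min v1 (min v t)) - \<omega> i (min u1 (min v t))) -
         (K (min u t) \<omega> + g1 \<omega> * (\<omega> i (min v1 (min u t)) - \<omega> i (min u1 (min u t)))))" for t \<omega>
    unfolding increment_clamp[OF \<open>u \<le> v\<close> \<open>u1 \<le> v1\<close>, symmetric] by (simp add: algebra_simps)
  ultimately show ?case by simp
qed

text \<open>This is the base of the later induction on the integrator: integrals against elementary
  integrators need no limit at all.\<close>

lemma efun_elem:
  assumes "F \<in> efun Jstar J" "K \<in> elem Jstar J"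
  shows "F K \<in> elem Jstar J"
  using assms(1)
proof (induction rule: efun.induct)
  case (gamble_x F u v g)
  then show ?case using elem_add[OF _ elem_integral[OF assms(2)]] by auto
qed (auto intro: elem.intros)

section \<open>Stopping elementary capital processes\<close>

lemma stopping_timeD:
  assumes "mkt_stopping_time J \<tau>"
  shows "\<tau> \<in> borel_measurable (mkt_F J)" and "\<omega> \<in> mkt_Omega J \<Longrightarrow> 0 \<le> \<tau> \<omega>"
    and "\<omega> \<in> mkt_Omega J \<Longrightarrow> \<omega>' \<in> mkt_Omega J \<Longrightarrow> agree_upto J (\<tau> \<omega>) \<omega> \<omega>' \<Longrightarrow> \<tau> \<omega> = \<tau> \<omega>'"
  using assms unfolding mkt_stopping_time_def by (elim conjE, blast)+

lemma stopping_time_eq: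
  assumes "mkt_stopping_time J \<tau>" "\<omega> \<in> mkt_Omega J" "\<omega>' \<in> mkt_Omega J"
    and "agree_upto J T \<omega> \<omega>'" "\<tau> \<omega> \<le> T"
  shows "\<tau> \<omega> = \<tau> \<omega>'"
  by (rule stopping_timeD(3)[OF assms(1-3) agree_upto_mono[OF assms(4,5)]])

lemma stopping_time_le_iff:
  assumes "mkt_stopping_time J \<tau>" "\<omega> \<in> mkt_Omega J" "\<omega>' \<in> mkt_Omega J"
    and "agree_upto J T \<omega> \<omega>'"
  shows "\<tau> \<omega> \<le> T \<longleftrightarrow> \<tau> \<omega>' \<le> T"
  using stopping_time_eq[OF assms] stopping_time_eq[OF assms(1,3,2) agree_upto_sym[OF assms(4)]]
  by metis

text \<open>One inequality is enough: it gives agreement up to the smaller value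
  \<open>\<tau> \<omega>'\<close>, so the same hypothesis applies with the samples
  exchanged.\<close>

lemma stopping_timeI_le:
  assumes "\<tau> \<in> borel_measurable (mkt_F J)" "\<And>\<omega>. \<omega> \<in> mkt_Omega J \<Longrightarrow> 0 \<le> \<tau> \<omega>"
    and "\<And>\<omega> \<omega>'. \<omega> \<in> mkt_Omega J \<Longrightarrow> \<omega>' \<in> mkt_Omega J \<Longrightarrow> agree_upto J (\<tau> \<omega>) \<omega> \<omega>' \<Longrightarrow> \<tau> \<omega>' \<le> \<tau> \<omega>"
  shows "mkt_stopping_time J \<tau>"
  unfolding mkt_stopping_time_def
proof (intro conjI ballI impI)
  fix \<omega> \<omega>' assume \<omega>: "\<omega> \<in> mkt_Omega J" "\<omega>' \<in> mkt_Omega J" "agree_upto J (\<tau> \<omega>) \<omega> \<omega>'"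
  then have "\<tau> \<omega>' \<le> \<tau> \<omega>" by (rule assms(3))
  moreover from this have "agree_upto J (\<tau> \<omega>') \<omega>' \<omega>"
    using agree_upto_mono[OF agree_upto_sym[OF \<omega>(3)]] by blast
  then have "\<tau> \<omega> \<le> \<tau> \<omega>'" by (rule assms(3)[OF \<omega>(2,1)])
  ultimately show "\<tau> \<omega> = \<tau> \<omega>'" by (rule antisym[rotated])
qed (use assms(1,2) in simp_all)

lemma stopping_time_const: "0 \<le> c \<Longrightarrow> mkt_stopping_time J (\<lambda>_. c)"
  by (rule stopping_timeI_le) simp_all

lemma stopping_time_min:
  assumes "mkt_stopping_time J \<sigma>" "mkt_stopping_time J \<tau>"
  shows "mkt_stopping_time J (\<lambda>\<omega>. min (\<sigma> \<omega>) (\<tau> \<omega>))"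
proof (rule stopping_timeI_le)
  show "(\<lambda>\<omega>. min (\<sigma> \<omega>) (\<tau> \<omega>)) \<in> borel_measurable (mkt_F J)"
    by (intro borel_measurable_min stopping_timeD(1)[OF assms(1)] stopping_timeD(1)[OF assms(2)])
next
  fix \<omega> assume "\<omega> \<in> mkt_Omega J"
  then show "0 \<le> min (\<sigma> \<omega>) (\<tau> \<omega>)"
    using stopping_timeD(2)[OF assms(1)] stopping_timeD(2)[OF assms(2)] by simp
next
  fix \<omega> \<omega>' assume \<omega>: "\<omega> \<in> mkt_Omega J" "\<omega>' \<in> mkt_Omega J" "agree_upto J (min (\<sigma> \<omega>) (\<tau> \<omega>)) \<omega> \<omega>'"
  show "min (\<sigma> \<omega>') (\<tau> \<omega>') \<le> min (\<sigma> \<omega>) (\<tau> \<omega>)"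
  proof (cases "\<sigma> \<omega> \<le> \<tau> \<omega>")
    case True
    then have "\<sigma> \<omega> = \<sigma> \<omega>'" using stopping_time_eq[OF assms(1) \<omega>] by simp
    with True show ?thesis by (simp add: min.coboundedI1)
  next
    case False
    then have "\<tau> \<omega> = \<tau> \<omega>'" using stopping_time_eq[OF assms(2) \<omega>] by simp
    with False show ?thesis by (simp add: min.coboundedI2)
  qed
qed

lemma stopping_time_max:
  assumes "mkt_stopping_time J \<sigma>" "mkt_stopping_time J \<tau>"
  shows "mkt_stopping_time J (\<lambda>\<omega>. max (\<sigma> \<omega>) (\<tau> \<omega>))"
proof (rule stopping_timeI_le)
  show "(\<lambda>\<omega>. max (\<sigma> \<omega>) (\<tau> \<omega>)) \<in> borel_measurable (mkt_F J)"
    by (intro borel_measurable_max stopping_timeD(1)[OF assms(1)] stopping_timeD(1)[OF assms(2)])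
next
  fix \<omega> assume "\<omega> \<in> mkt_Omega J"
  then show "0 \<le> max (\<sigma> \<omega>) (\<tau> \<omega>)"
    using stopping_timeD(2)[OF assms(1)] by (simp add: le_max_iff_disj)
next
  fix \<omega> \<omega>' assume \<omega>: "\<omega> \<in> mkt_Omega J" "\<omega>' \<in> mkt_Omega J" "agree_upto J (max (\<sigma> \<omega>) (\<tau> \<omega>)) \<omega> \<omega>'"
  have "\<sigma> \<omega> = \<sigma> \<omega>'" "\<tau> \<omega> = \<tau> \<omega>'"
    using stopping_time_eq[OF assms(1) \<omega>] stopping_time_eq[OF assms(2) \<omega>] by simp_all
  then show "max (\<sigma> \<omega>') (\<tau> \<omega>') \<le> max (\<sigma> \<omega>) (\<tau> \<omega>)" by simp
qed

section \<open>Elementary processes on a common grid\<close>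

lemma sum_increments_between:
  fixes f :: "nat \<Rightarrow> real"
  assumes "U \<le> V" "V \<le> L"
  shows "(\<Sum>n<L. if U \<le> n \<and> n < V then f (Suc n) - f n else 0) = f V - f U"
proof -
  have "{n \<in> {..<L}. U \<le> n \<and> n < V} = {U..<V}" using assms by auto
  then have "(\<Sum>n<L. if U \<le> n \<and> n < V then f (Suc n) - f n else 0) = (\<Sum>n = U..<V. f (Suc n) - f n)"
    by (subst sum.inter_filter[symmetric]) simp_all
  then show ?thesis using sum_Suc_diff'[OF assms(1), of f] by simp
qed

definition on_grid :: "nat \<Rightarrow> nat \<Rightarrow> nat \<Rightarrow> (real \<Rightarrow> sample \<Rightarrow> real) \<Rightarrow>
    (nat \<Rightarrow> sample \<Rightarrow> nat \<Rightarrow> real) \<Rightarrow> nat \<Rightarrow> real \<Rightarrow> bool" where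
  "on_grid Jstar J M K h L c \<longleftrightarrow>
      (\<forall>n i. position_at J (real n / real M) (\<lambda>\<omega>. h n \<omega> i)) \<and>
      (\<forall>n\<ge>L. \<forall>\<omega> i. h n \<omega> i = 0) \<and>
      (\<forall>t \<omega>. K t \<omega> = c + (\<Sum>n<L. \<Sum>i<Jstar. h n \<omega> i *
          (\<omega> i (min (real (Suc n) / real M) t) - \<omega> i (min (real n / real M) t))))"

lemma on_gridD:
  assumes "on_grid Jstar J M K h L c"
  shows "position_at J (real n / real M) (\<lambda>\<omega>. h n \<omega> i)"
    and "n \<ge> L \<Longrightarrow> h n \<omega> i = 0"
    and "K t \<omega> = c + (\<Sum>n<L. \<Sum>i<Jstar. h n \<omega> i *
          (\<omega> i (min (real (Suc n) / real M) t) - \<omega> i (min (real n / real M) t)))"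
  using assms unfolding on_grid_def by simp_all

text \<open>Demanding a representation for every multiple of \<open>M0\<close>, not just for one
  mesh, is what carries the induction: the new gamble multiplies \<open>M0\<close> by the
  denominators of its rational endpoints, and the old process can still be rewritten on the finer
  grid.\<close>

lemma elem_on_grid:
  assumes "K \<in> elem Jstar J"
  shows "\<exists>M0>0. \<forall>M>0. M0 dvd M \<longrightarrow> (\<exists>h L c. on_grid Jstar J M K h L c)"
  using assms
proof (induction rule: elem.induct)
  case (const c)
  have "on_grid Jstar J M (\<lambda>t \<omega>. c) (\<lambda>_ _ _. 0) 0 c" for M
    unfolding on_grid_def by (simp add: position_at_const)
  then show ?case by (metis zero_less_one)
next
  case (gamble K i0 u v g)
  from gamble.IH obtain M0 where "M0 > 0"
    and M0: "\<And>M. M > 0 \<Longrightarrow> M0 dvd M \<Longrightarrow> \<exists>h L c. on_grid Jstar J M K h L c"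
    by blast
  from Rats_abs_nat_div_natE[OF gamble.hyps(3)] obtain a b :: nat
    where b: "b \<noteq> 0" "u = real a / real b" using gamble.hyps(5) by (metis abs_of_nonneg)
  from Rats_abs_nat_div_natE[OF gamble.hyps(4)] obtain p q :: nat
    where q: "q \<noteq> 0" "v = real p / real q" using gamble.hyps(5,6) by (metis abs_of_nonneg order_trans)
  show ?case
  proof (intro exI[of _ "M0 * b * q"] conjI allI impI)
    show "0 < M0 * b * q" using \<open>0 < M0\<close> b q by simp
    fix M :: nat assume M: "0 < M" "M0 * b * q dvd M"
    then have "M0 dvd M" "b dvd M" "q dvd M" by (metis dvd_mult_left dvd_mult_right)+
    obtain B where B: "M = b * B" using \<open>b dvd M\<close> by blast
    obtain Q where Q: "M = q * Q" using \<open>q dvd M\<close> by blast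
    define U V where "U = a * B" and "V = p * Q"
    have U: "real U / real M = u" using b B M by (simp add: U_def)
    have V: "real V / real M = v" using q Q M by (simp add: V_def)
    have "real U / real M \<le> real V / real M" using U V gamble.hyps(6) by simp
    then have UV: "U \<le> V" using M(1) by (simp add: divide_le_cancel)
    obtain h L c where *: "on_grid Jstar J M K h L c"
      using M0[OF M(1) \<open>M0 dvd M\<close>] by blast
    note h = on_gridD(1)[OF *] and L = on_gridD(2)[OF *] and K = on_gridD(3)[OF *]
    define e where "e n \<omega> i = (if i = i0 \<and> U \<le> n \<and> n < V then g \<omega> else 0)" for n i and \<omega> :: sample
    have "on_grid Jstar J M (\<lambda>t \<omega>. K t \<omega> + g \<omega> * (\<omega> i0 (min v t) - \<omega> i0 (min u t)))
        (\<lambda>n \<omega> i. h n \<omega> i + e n \<omega> i) (max L V) c"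
      unfolding on_grid_def
    proof (intro conjI allI impI)
      fix n i
      have "position_at J (real n / real M) (\<lambda>\<omega>. e n \<omega> i)"
      proof (cases "i = i0 \<and> U \<le> n \<and> n < V")
        case True
        then have "u \<le> real n / real M" using U M(1) by (metis divide_right_mono of_nat_0_le_iff of_nat_le_iff)
        then show ?thesis unfolding e_def using True position_at_mono[OF gamble.hyps(7)] by simp
      next
        case False
        then show ?thesis unfolding e_def using position_at_const[of J _ 0] by (simp only: if_False)
      qed
      then show "position_at J (real n / real M) (\<lambda>\<omega>. h n \<omega> i + e n \<omega> i)"
        by (rule position_at_add[OF h])
    next
      fix n \<omega> i assume "max L V \<le> n"
      then show "h n \<omega> i + e n \<omega> i = 0" using L by (simp add: e_def)
    next
      fix t and \<omega> :: sample
      define d where "d n i = \<omega> i (min (real (Suc n) / real M) t) - \<omega> i (min (real n / real M) t)" for n i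
      have "(\<Sum>n<max L V. \<Sum>i<Jstar. (h n \<omega> i + e n \<omega> i) * d n i) =
          (\<Sum>n<max L V. \<Sum>i<Jstar. h n \<omega> i * d n i) + (\<Sum>n<max L V. \<Sum>i<Jstar. e n \<omega> i * d n i)"
        by (simp add: distrib_right sum.distrib)
      also have "(\<Sum>n<max L V. \<Sum>i<Jstar. h n \<omega> i * d n i) = (\<Sum>n<L. \<Sum>i<Jstar. h n \<omega> i * d n i)"
        by (rule sum.mono_neutral_right) (auto simp: L)
      also have "(\<Sum>n<max L V. \<Sum>i<Jstar. e n \<omega> i * d n i) =
          (\<Sum>n<max L V. g \<omega> * (if U \<le> n \<and> n < V then d n i0 else 0))"
      proof (rule sum.cong[OF refl])
        fix n
        have "(\<Sum>i<Jstar. e n \<omega> i * d n i) =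
          (\<Sum>i<Jstar. if i = i0 then g \<omega> * (if U \<le> n \<and> n < V then d n i0 else 0) else 0)"
          by (rule sum.cong) (auto simp: e_def)
        then show "(\<Sum>i<Jstar. e n \<omega> i * d n i) = g \<omega> * (if U \<le> n \<and> n < V then d n i0 else 0)"
          using gamble.hyps(2) by simp
      qed
      also have "\<dots> = g \<omega> * (\<Sum>n<max L V. if U \<le> n \<and> n < V then d n i0 else 0)"
        by (rule sum_distrib_left[symmetric])
      also have "(\<Sum>n<max L V. if U \<le> n \<and> n < V then d n i0 else 0) = \<omega> i0 (min v t) - \<omega> i0 (min u t)"
        unfolding d_def using sum_increments_between[OF UV, of "max L V" "\<lambda>n. \<omega> i0 (min (real n / real M) t)"] U V
        by simp
      finally show "K t \<omega> + g \<omega> * (\<omega> i0 (min v t) - \<omega> i0 (min u t)) =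
         c + (\<Sum>n<max L V. \<Sum>i<Jstar. (h n \<omega> i + e n \<omega> i) *
          (\<omega> i (min (real (Suc n) / real M) t) - \<omega> i (min (real n / real M) t)))"
        unfolding K d_def by simp
    qed
    then show "\<exists>h L c. on_grid Jstar J M (\<lambda>t \<omega>. K t \<omega> + g \<omega> * (\<omega> i0 (min v t) - \<omega> i0 (min u t))) h L c"
      by blast
  qed
qed

text \<open>Stopping at a random time may leave the class \<open>elem\<close>, whose trading times
  are deterministic, but not the simple strategies: each grid interval is cut at
  \<open>\<tau>\<close>, and the positions of all intervals that start at or after
  \<open>\<tau>\<close> are dropped.\<close>

lemma elem_stopped:
  assumes "K \<in> elem Jstar J" "Jstar \<le> J" and \<tau>: "mkt_stopping_time J \<tau>"
  shows "\<exists>\<sigma> h c. simple_strategy Jstar J \<sigma> h \<and>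
    (\<forall>t\<ge>0. \<forall>\<omega>\<in>mkt_Omega J.
       capital Jstar \<sigma> h c t \<omega> = K (real_of_ereal (min (\<tau> \<omega>) (ereal t))) \<omega>)"
proof -
  obtain M h L c where M: "M > 0" and *: "on_grid Jstar J M K h L c"
    using elem_on_grid[OF assms(1)] by (metis dvd_refl)
  note h = on_gridD(1)[OF *] and L = on_gridD(2)[OF *] and K = on_gridD(3)[OF *]
  define q where "q n = real n / real M" for n
  have q: "0 \<le> q n" "q n \<le> q (Suc n)" "q (n - 1) \<le> q n" for n
    using M by (auto simp: q_def divide_right_mono)
  \<comment> \<open>\<open>\<sigma>\<close> runs through the grid up to \<open>\<tau>\<close>, stops at \<open>\<tau>\<close>, and then lags one grid point behind,
    so that it still tends to infinity.\<close>
  define \<sigma> where "\<sigma> n \<omega> = min (ereal (q n)) (max (\<tau> \<omega>) (ereal (q (n - 1))))" for n \<omega>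
  \<comment> \<open>The position has to be known at \<open>\<sigma> n\<close>. If \<open>q n\<close>
    lies strictly before \<open>\<tau>\<close>, then \<open>\<sigma> n\<close> is \<open>q n\<close>
    itself. Otherwise \<open>\<tau> \<le> \<sigma> n\<close>, so a sample that agrees up to
    \<open>\<sigma> n\<close> has the same \<open>\<tau>\<close> and also holds nothing.\<close>
  define h' where "h' n \<omega> i = (if ereal (q n) < \<tau> \<omega> then h n \<omega> i else 0)" for n \<omega> i
  have \<sigma>: "mkt_stopping_time J (\<sigma> n)" for n
    unfolding \<sigma>_def using q(1)
    by (intro stopping_time_min[OF stopping_time_const stopping_time_max[OF \<tau> stopping_time_const]]) simp_all
  have "simple_strategy Jstar J \<sigma> h'"
    unfolding simple_strategy_def
  proof (intro conjI allI ballI)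
    fix n \<omega>
    have "q (n - 1) \<le> q (Suc n - 1)" using q by simp
    then show "\<sigma> n \<omega> \<le> \<sigma> (Suc n) \<omega>"
      unfolding \<sigma>_def using q(2)[of n] by (intro min.mono max.mono) simp_all
  next
    fix \<omega> show "(\<lambda>n. \<sigma> n \<omega>) \<longlonglongrightarrow> \<infinity>"
      unfolding tendsto_PInfty
    proof
      fix r
      obtain N where N: "r * real M < real N" using reals_Archimedean2 by blast
      have "ereal r < \<sigma> n \<omega>" if "n \<ge> Suc N" for n
      proof -
        have "real N \<le> real (n - 1)" using that by simp
        then have "r < q (n - 1)" using N M by (simp add: q_def field_simps)
        then show ?thesis using q(3)[of n] unfolding \<sigma>_def by (simp add: less_max_iff_disj)
      qed
      then show "\<forall>\<^sub>F n in sequentially. ereal r < \<sigma> n \<omega>" by (rule eventually_sequentiallyI)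
    qed
  next
    fix n show "tau_measurable J Jstar (\<sigma> n) (h' n)"
      unfolding tau_measurable_def
    proof (intro conjI allI impI ballI)
      fix i
      have [measurable]: "(\<lambda>\<omega>. h n \<omega> i) \<in> borel_measurable (mkt_F J)" "\<tau> \<in> borel_measurable (mkt_F J)"
        by (rule position_atD(1)[OF h], rule stopping_timeD(1)[OF \<tau>])
      show "(\<lambda>\<omega>. h' n \<omega> i) \<in> borel_measurable (mkt_F J)"
        unfolding h'_def by measurable
    next
      fix \<omega> \<omega>' i assume \<omega>: "\<omega> \<in> mkt_Omega J" "\<omega>' \<in> mkt_Omega J" "agree_upto J (\<sigma> n \<omega>) \<omega> \<omega>'"
      show "h' n \<omega> i = h' n \<omega>' i"
      proof (cases "ereal (q n) < \<tau> \<omega>")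
        case True
        then have "\<sigma> n \<omega> = ereal (q n)" unfolding \<sigma>_def by (intro min_absorb1) (auto simp: le_max_iff_disj)
        with \<omega>(3) have agree: "agree_upto J (ereal (q n)) \<omega> \<omega>'" by simp
        then have "h n \<omega> i = h n \<omega>' i"
          unfolding q_def by (rule position_atD(2)[OF h \<omega>(1,2)])
        moreover have "ereal (q n) < \<tau> \<omega>'"
          using True stopping_time_le_iff[OF \<tau> \<omega>(1,2) agree] by (metis not_le)
        ultimately show ?thesis using True by (simp add: h'_def)
      next
        case False
        then have "\<tau> \<omega> \<le> \<sigma> n \<omega>" unfolding \<sigma>_def by simp
        then have "\<tau> \<omega> = \<tau> \<omega>'" by (rule stopping_time_eq[OF \<tau> \<omega>])
        with False show ?thesis by (simp add: h'_def)
      qed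
    qed
  next
    fix n
    have "\<exists>C. \<forall>\<omega>\<in>mkt_Omega J. \<bar>h n \<omega> i\<bar> \<le> C" for i
      using h[of n i] unfolding position_at_def by blast
    then obtain C where C: "\<And>i \<omega>. \<omega> \<in> mkt_Omega J \<Longrightarrow> \<bar>h n \<omega> i\<bar> \<le> C i" by metis
    have "\<bar>h' n \<omega> i\<bar> \<le> (\<Sum>i<Jstar. \<bar>C i\<bar>)" if "\<omega> \<in> mkt_Omega J" "i < Jstar" for \<omega> i
    proof -
      have "\<bar>h' n \<omega> i\<bar> \<le> \<bar>h n \<omega> i\<bar>" by (simp add: h'_def)
      also have "\<dots> \<le> \<bar>C i\<bar>" using C[OF that(1), of i] by linarith
      also have "\<dots> \<le> (\<Sum>i<Jstar. \<bar>C i\<bar>)" using that(2) by (intro member_le_sum) simp_all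
      finally show ?thesis .
    qed
    then show "\<exists>C. \<forall>\<omega>\<in>mkt_Omega J. \<forall>i<Jstar. \<bar>h' n \<omega> i\<bar> \<le> C" by blast
  qed (rule \<sigma>)
  moreover have "capital Jstar \<sigma> h' c t \<omega> = K (real_of_ereal (min (\<tau> \<omega>) (ereal t))) \<omega>"
    if "0 \<le> t" "\<omega> \<in> mkt_Omega J" for t \<omega>
  proof -
    define T where "T = real_of_ereal (min (\<tau> \<omega>) (ereal t))"
    have \<tau>0: "0 \<le> \<tau> \<omega>" by (rule stopping_timeD(2)[OF \<tau> that(2)])
    have "(\<Sum>n. \<Sum>i<Jstar. h' n \<omega> i * (\<omega> i (real_of_ereal (min (\<sigma> (Suc n) \<omega>) (ereal t))) -
        \<omega> i (real_of_ereal (min (\<sigma> n \<omega>) (ereal t))))) =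
      (\<Sum>n<L. \<Sum>i<Jstar. h' n \<omega> i * (\<omega> i (real_of_ereal (min (\<sigma> (Suc n) \<omega>) (ereal t))) -
        \<omega> i (real_of_ereal (min (\<sigma> n \<omega>) (ereal t)))))"
    proof (rule suminf_finite)
      fix n assume "n \<notin> {..<L}"
      then have "h' n \<omega> i = 0" for i by (simp add: h'_def L)
      then show "(\<Sum>i<Jstar. h' n \<omega> i * (\<omega> i (real_of_ereal (min (\<sigma> (Suc n) \<omega>) (ereal t))) -
        \<omega> i (real_of_ereal (min (\<sigma> n \<omega>) (ereal t))))) = 0" by simp
    qed simp
    also have "\<dots> = (\<Sum>n<L. \<Sum>i<Jstar. h n \<omega> i * (\<omega> i (min (q (Suc n)) T) - \<omega> i (min (q n) T)))"
    proof (intro sum.cong refl)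
      fix n i
      show "h' n \<omega> i * (\<omega> i (real_of_ereal (min (\<sigma> (Suc n) \<omega>) (ereal t))) -
          \<omega> i (real_of_ereal (min (\<sigma> n \<omega>) (ereal t)))) =
        h n \<omega> i * (\<omega> i (min (q (Suc n)) T) - \<omega> i (min (q n) T))"
      proof (cases "ereal (q n) < \<tau> \<omega>")
        case True
        have "min (\<sigma> n \<omega>) (ereal t) = ereal (min (q n) T)"
          using True \<tau>0 unfolding \<sigma>_def T_def by (cases "\<tau> \<omega>") (auto simp: min_def max_def)
        moreover have "min (\<sigma> (Suc n) \<omega>) (ereal t) = ereal (min (q (Suc n)) T)"
          using True \<tau>0 unfolding \<sigma>_def T_def by (cases "\<tau> \<omega>") (auto simp: min_def max_def)
        ultimately show ?thesis using True by (simp add: h'_def del: ereal_min)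
      next
        case False
        then have "T \<le> q n" using \<tau>0 unfolding T_def by (cases "\<tau> \<omega>") (auto simp: min_def)
        then have "min (q (Suc n)) T = T" "min (q n) T = T" using q(2)[of n] by linarith+
        with False show ?thesis by (simp add: h'_def)
      qed
    qed
    finally show ?thesis unfolding capital_def K T_def[symmetric] q_def by simp
  qed
  ultimately show ?thesis by blast
qed

lemma elem_simple:
  assumes "K \<in> elem Jstar J" "Jstar \<le> J"
  shows "\<exists>\<sigma> h c. simple_strategy Jstar J \<sigma> h \<and>
    (\<forall>t\<ge>0. \<forall>\<omega>\<in>mkt_Omega J. capital Jstar \<sigma> h c t \<omega> = K t \<omega>)"
  using elem_stopped[OF assms stopping_time_const[of \<infinity>]] by simp

lemma elem_nn_supermart:
  assumes K: "K \<in> elem Jstar J" "Jstar \<le> J" and \<tau>: "mkt_stopping_time J \<tau>"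
    and V: "\<And>t \<omega>. 0 \<le> t \<Longrightarrow> \<omega> \<in> mkt_Omega J \<Longrightarrow>
      V t \<omega> = ereal (K (real_of_ereal (min (\<tau> \<omega>) (ereal t))) \<omega>)"
    and nonneg: "\<And>t \<omega>. 0 \<le> t \<Longrightarrow> \<omega> \<in> mkt_Omega J \<Longrightarrow>
      0 \<le> K (real_of_ereal (min (\<tau> \<omega>) (ereal t))) \<omega>"
  shows "V \<in> nn_supermart Jstar J"
proof -
  obtain \<sigma> h c where "simple_strategy Jstar J \<sigma> h" "\<And>t \<omega>. 0 \<le> t \<Longrightarrow> \<omega> \<in> mkt_Omega J \<Longrightarrow>
       capital Jstar \<sigma> h c t \<omega> = K (real_of_ereal (min (\<tau> \<omega>) (ereal t))) \<omega>"
    using elem_stopped[OF assms(1-3)] by blast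
  then show ?thesis
    using V nonneg by (intro nn_supermart.simple[of Jstar J \<sigma> h c]) simp_all
qed

lemma nn_supermart_const:
  assumes "Jstar \<le> J" "0 \<le> c"
  shows "(\<lambda>t \<omega>. ereal c) \<in> nn_supermart Jstar J"
  by (rule elem_nn_supermart[OF elem.const[of c] assms(1) stopping_time_const[of \<infinity>]])
    (use assms in simp_all)

lemma quasi_alwaysI:
  assumes "Jstar \<le> J" "\<And>t \<omega>. 0 \<le> t \<Longrightarrow> \<omega> \<in> mkt_Omega J \<Longrightarrow> (t, \<omega>) \<in> E"
  shows "quasi_always Jstar J E"
  unfolding quasi_always_def
  by (rule bexI[of _ "\<lambda>t \<omega>. ereal 1"]) (use assms nn_supermart_const[OF assms(1)] in auto)

section \<open>Elementary approximation of continuous martingales\<close>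

text \<open>The indicators select the grid times from the first one not before \<open>r\<close>
  onwards, so the sum telescopes to the increment from there to \<open>s\<close>. With mesh
  \<open>1 / k\<close>, the \<open>k * k\<close> cells reach exactly to time \<open>k\<close>,
  whence the bound on \<open>s\<close>.\<close>

lemma entry_sum:
  fixes f :: "real \<Rightarrow> real" and k :: nat
  assumes k: "0 < k" and s: "0 \<le> s" "s \<le> real k" and r: "0 \<le> r"
  shows "\<exists>q. 0 \<le> q \<and> q \<le> s \<and> \<bar>q - min r s\<bar> \<le> 1 / real k \<and>
    (\<Sum>j<k * k. if ereal r \<le> ereal (real j / real k)
       then f (min (real (Suc j) / real k) s) - f (min (real j / real k) s) else 0) = f s - f q"
proof -
  define m where "m = nat \<lceil>real k * r\<rceil>"
  define m' where "m' = min m (k * k)"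
  have m: "r \<le> real j / real k \<longleftrightarrow> m \<le> j" for j
    unfolding m_def nat_ceiling_le_eq using k by (simp add: field_simps)
  have m_less: "real m < real k * r + 1"
    unfolding m_def using r by (simp add: ceiling_less_iff of_nat_nat) linarith
  have m_ge: "real k * r \<le> real m" unfolding m_def by linarith
  have "(\<Sum>j<k * k. if ereal r \<le> ereal (real j / real k)
       then f (min (real (Suc j) / real k) s) - f (min (real j / real k) s) else 0) =
    (\<Sum>j<k * k. if m' \<le> j \<and> j < k * k
       then f (min (real (Suc j) / real k) s) - f (min (real j / real k) s) else 0)"
    by (rule sum.cong) (auto simp: m m'_def)
  also have "\<dots> = f (min (real (k * k) / real k) s) - f (min (real m' / real k) s)"
    by (rule sum_increments_between) (simp_all add: m'_def)
  also have "min (real (k * k) / real k) s = s" using k s by simp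
  finally have *: "(\<Sum>j<k * k. if ereal r \<le> ereal (real j / real k)
       then f (min (real (Suc j) / real k) s) - f (min (real j / real k) s) else 0) =
       f s - f (min (real m' / real k) s)" .
  have "\<bar>min (real m' / real k) s - min r s\<bar> \<le> 1 / real k"
  proof (cases "m \<le> k * k")
    case True
    then have "real m' / real k = real m / real k" by (simp add: m'_def)
    moreover have "r \<le> real m / real k" "real m / real k \<le> r + 1 / real k"
      using m_less m_ge k by (simp_all add: field_simps)
    moreover have "0 \<le> 1 / real k" by simp
    ultimately show ?thesis by linarith
  next
    \<comment> \<open>The grid ends before \<open>r\<close>; then \<open>s \<le> k < r\<close>, and
      both times are cut down to \<open>s\<close>.\<close>
    case False
    then have "real (k * k) + 1 \<le> real m" by linarith
    then have "real k * real k < real k * r" using m_less by simp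
    then have "real k < r" using k by simp
    moreover have "real m' / real k = real k" using False k by (simp add: m'_def)
    ultimately show ?thesis using s by simp
  qed
  with * show ?thesis using s by (intro exI[of _ "min (real m' / real k) s"]) simp
qed

text \<open>The rounded entry time differs from the true one by at most \<open>1 / k\<close>,
  uniformly in \<open>s\<close>, so uniform continuity of \<open>f\<close> on the compact interval
  gives the limit. For infinite \<open>\<tau>\<close> both sides vanish.\<close>

lemma entry_uniform_limit:
  fixes f :: "real \<Rightarrow> real" and \<tau> :: ereal
  assumes f: "continuous_on {0..T} f" and \<tau>: "0 \<le> \<tau>"
  shows "uniform_limit {0..T} (\<lambda>k s. \<Sum>j<k * k. if \<tau> \<le> ereal (real j / real k)
       then f (min (real (Suc j) / real k) s) - f (min (real j / real k) s) else 0)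
     (\<lambda>s. f s - f (real_of_ereal (min \<tau> (ereal s)))) sequentially"
proof (cases \<tau>)
  case (real r)
  with \<tau> have r: "0 \<le> r" by simp
  have uc: "uniformly_continuous_on {0..T} f"
    using f by (intro compact_uniformly_continuous) simp_all
  show ?thesis
    unfolding uniform_limit_sequentially_iff
  proof (intro allI impI)
    fix e :: real assume "0 < e"
    with uc obtain d where d: "0 < d"
      and fd: "\<And>x y. x \<in> {0..T} \<Longrightarrow> y \<in> {0..T} \<Longrightarrow> dist x y < d \<Longrightarrow> dist (f x) (f y) < e"
      unfolding uniformly_continuous_on_def by blast
    \<comment> \<open>From \<open>T\<close> on, the grid covers the whole interval; from
      \<open>1 / d\<close> on, its mesh is finer than \<open>d\<close>.\<close>
    obtain N where N: "max T (1 / d) < real N" using reals_Archimedean2 by blast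
    show "\<exists>N. \<forall>k\<ge>N. \<forall>s\<in>{0..T}. dist (\<Sum>j<k * k. if \<tau> \<le> ereal (real j / real k)
       then f (min (real (Suc j) / real k) s) - f (min (real j / real k) s) else 0)
       (f s - f (real_of_ereal (min \<tau> (ereal s)))) < e"
    proof (intro exI[of _ "Suc N"] allI impI ballI)
      fix k s assume ks: "Suc N \<le> k" "s \<in> {0..T}"
      then have k: "0 < k" "real N < real k" by simp_all
      have "1 / d < real k" using k N by simp
      then have kd: "1 / real k < d" using d k by (simp add: field_simps)
      obtain q where q: "0 \<le> q" "q \<le> s" "\<bar>q - min r s\<bar> \<le> 1 / real k"
        and sum: "(\<Sum>j<k * k. if ereal r \<le> ereal (real j / real k)
          then f (min (real (Suc j) / real k) s) - f (min (real j / real k) s) else 0) = f s - f q"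
        using entry_sum[OF k(1) _ _ r, of s f] ks N k by auto
      have "dist (f q) (f (min r s)) < e"
        using q ks r kd by (intro fd) (auto simp: dist_real_def)
      then show "dist (\<Sum>j<k * k. if \<tau> \<le> ereal (real j / real k)
        then f (min (real (Suc j) / real k) s) - f (min (real j / real k) s) else 0)
        (f s - f (real_of_ereal (min \<tau> (ereal s)))) < e"
        unfolding real sum by (simp add: dist_real_def flip: ereal_min)
    qed
  qed
qed (use \<tau> in \<open>simp_all add: uniform_limit_const\<close>)

lemma uniform_limit_sum_real:
  fixes f :: "'b \<Rightarrow> 'c \<Rightarrow> 'a \<Rightarrow> real"
  assumes "finite A" "\<And>a. a \<in> A \<Longrightarrow> uniform_limit S (f a) (g a) F"
  shows "uniform_limit S (\<lambda>k s. \<Sum>a\<in>A. f a k s) (\<lambda>s. \<Sum>a\<in>A. g a s) F"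
  using assms
proof (induction A rule: finite_induct)
  case (insert a A)
  have "uniform_limit S (\<lambda>k s. f a k s + (\<Sum>a\<in>A. f a k s)) (\<lambda>s. g a s + (\<Sum>a\<in>A. g a s)) F"
    using insert by (intro uniform_limit_add) simp_all
  then show ?case using insert.hyps by simp
qed (simp add: uniform_limit_const)

lemma simple_strategyD:
  assumes "simple_strategy Jstar J \<tau> h"
  shows "mkt_stopping_time J (\<tau> n)" and "tau_measurable J Jstar (\<tau> n) (h n)"
    and "\<omega> \<in> mkt_Omega J \<Longrightarrow> \<tau> n \<omega> \<le> \<tau> (Suc n) \<omega>"
    and "\<omega> \<in> mkt_Omega J \<Longrightarrow> (\<lambda>n. \<tau> n \<omega>) \<longlonglongrightarrow> \<infinity>"
    and "\<exists>C. \<forall>\<omega>\<in>mkt_Omega J. \<forall>i<Jstar. \<bar>h n \<omega> i\<bar> \<le> C"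
  using assms unfolding simple_strategy_def by blast+

text \<open>The position in force at time \<open>q\<close> belongs to the \<open>n\<close> with
  \<open>\<tau> n \<le> q < \<tau> (Suc n)\<close>. The path up to \<open>q\<close> decides this
  event, and on it also determines \<open>h n\<close>, which depends only on the path up to
  \<open>\<tau> n\<close>.\<close>

lemma strategy_position_at:
  assumes strat: "simple_strategy Jstar J \<tau> h" and i: "i < Jstar"
  shows "position_at J q (\<lambda>\<omega>. if \<tau> n \<omega> \<le> ereal q \<and> \<not> \<tau> (Suc n) \<omega> \<le> ereal q then h n \<omega> i else 0)"
  unfolding position_at_def
proof (intro conjI ballI impI)
  note st = simple_strategyD(1)[OF strat]
  have [measurable]: "\<tau> n \<in> borel_measurable (mkt_F J)" "\<tau> (Suc n) \<in> borel_measurable (mkt_F J)"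
    by (rule stopping_timeD(1)[OF st])+
  have tm: "tau_measurable J Jstar (\<tau> n) (h n)" by (rule simple_strategyD(2)[OF strat])
  then have [measurable]: "(\<lambda>\<omega>. h n \<omega> i) \<in> borel_measurable (mkt_F J)"
    using i unfolding tau_measurable_def by blast
  show "(\<lambda>\<omega>. if \<tau> n \<omega> \<le> ereal q \<and> \<not> \<tau> (Suc n) \<omega> \<le> ereal q then h n \<omega> i else 0)
      \<in> borel_measurable (mkt_F J)" by measurable
  obtain C where C: "\<forall>\<omega>\<in>mkt_Omega J. \<forall>i<Jstar. \<bar>h n \<omega> i\<bar> \<le> C"
    using simple_strategyD(5)[OF strat] by blast
  show "\<exists>C. \<forall>\<omega>\<in>mkt_Omega J.
      \<bar>if \<tau> n \<omega> \<le> ereal q \<and> \<not> \<tau> (Suc n) \<omega> \<le> ereal q then h n \<omega> i else 0\<bar> \<le> C"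
  proof (intro exI[of _ "\<bar>C\<bar>"] ballI)
    fix \<omega> assume "\<omega> \<in> mkt_Omega J"
    with C i have "\<bar>h n \<omega> i\<bar> \<le> C" by blast
    then show "\<bar>if \<tau> n \<omega> \<le> ereal q \<and> \<not> \<tau> (Suc n) \<omega> \<le> ereal q then h n \<omega> i else 0\<bar> \<le> \<bar>C\<bar>"
      by (auto intro: order_trans)
  qed
  fix \<omega> \<omega>' assume \<omega>: "\<omega> \<in> mkt_Omega J" "\<omega>' \<in> mkt_Omega J" "agree_upto J (ereal q) \<omega> \<omega>'"
  have "h n \<omega> i = h n \<omega>' i" if "\<tau> n \<omega> \<le> ereal q"
    using tm \<omega>(1,2) agree_upto_mono[OF \<omega>(3) that] i unfolding tau_measurable_def by blast
  then show "(if \<tau> n \<omega> \<le> ereal q \<and> \<not> \<tau> (Suc n) \<omega> \<le> ereal q then h n \<omega> i else 0) =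
      (if \<tau> n \<omega>' \<le> ereal q \<and> \<not> \<tau> (Suc n) \<omega>' \<le> ereal q then h n \<omega>' i else 0)"
    using stopping_time_le_iff[OF st \<omega>] by simp
qed

text \<open>The idea is to round the trading times up to the grid of mesh \<open>1/k\<close>.\<close>
lemma capital_approx:
  assumes strat: "simple_strategy Jstar J \<tau> h" and "Jstar \<le> J"
  obtains K where "\<And>k. K k \<in> elem Jstar J"
    and "\<And>\<omega> t. \<omega> \<in> mkt_Omega J \<Longrightarrow>
      uniform_limit {0..t} (\<lambda>k s. K k s \<omega>) (\<lambda>s. capital Jstar \<tau> h c s \<omega>) sequentially"
proof
  define g where "g k n j i \<omega> =
    (if \<tau> n \<omega> \<le> ereal (real j / real k) \<and> \<not> \<tau> (Suc n) \<omega> \<le> ereal (real j / real k) then h n \<omega> i else 0)"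
    for k n j i \<omega>
  \<comment> \<open>The index \<open>k\<close> plays three parts: mesh \<open>1 / k\<close>, horizon
    \<open>k\<close>, and number of trading times taken into account. On a compact time interval the
    last two stop mattering once \<open>k\<close> is large.\<close>
  define K where "K k t \<omega> = c + (\<Sum>n<k. \<Sum>j<k * k. \<Sum>i<Jstar. g k n j i \<omega> *
      (\<omega> i (min (real (Suc j) / real k) t) - \<omega> i (min (real j / real k) t)))" for k :: nat and t \<omega>
  show "K k \<in> elem Jstar J" for k
    unfolding K_def
  proof (intro elem_add[OF elem.const] elem_sum elem_single)
    fix n j i assume "i \<in> {..<Jstar}"
    then show "position_at J (real j / real k) (g k n j i)"
      unfolding g_def using strategy_position_at[OF strat] by simp
  qed (auto simp: divide_right_mono)
  fix \<omega> T assume \<omega>: "\<omega> \<in> mkt_Omega J"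
  \<comment> \<open>The gain at time \<open>s\<close> from one unit of security \<open>i\<close>
    bought at the rounded \<open>\<tau> n\<close>. A position that is closed again is a difference
    of two such gains.\<close>
  define S where "S i n k s = (\<Sum>j<k * k. if \<tau> n \<omega> \<le> ereal (real j / real k)
       then \<omega> i (min (real (Suc j) / real k) s) - \<omega> i (min (real j / real k) s) else 0)" for i n k s
  have inc: "\<tau> n \<omega> \<le> \<tau> (Suc n) \<omega>" for n by (rule simple_strategyD(3)[OF strat \<omega>])
  have nonneg: "0 \<le> \<tau> n \<omega>" for n by (rule stopping_timeD(2)[OF simple_strategyD(1)[OF strat] \<omega>])
  have "eventually (\<lambda>n. ereal T < \<tau> n \<omega>) sequentially"
    using simple_strategyD(4)[OF strat \<omega>] unfolding tendsto_PInfty by blast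
  then obtain N where N: "\<And>n. n \<ge> N \<Longrightarrow> ereal T < \<tau> n \<omega>"
    unfolding eventually_sequentially by blast
  \<comment> \<open>As \<open>\<tau> n \<le> \<tau> (Suc n)\<close>, the indicator of lying between
    the two times is the difference of the indicators of having passed each.\<close>
  have K_eq: "K k s \<omega> = c + (\<Sum>n<k. \<Sum>i<Jstar. h n \<omega> i * (S i n k s - S i (Suc n) k s))" for k s
  proof -
    have "(\<Sum>j<k * k. \<Sum>i<Jstar. g k n j i \<omega> *
        (\<omega> i (min (real (Suc j) / real k) s) - \<omega> i (min (real j / real k) s))) =
      (\<Sum>i<Jstar. h n \<omega> i * (S i n k s - S i (Suc n) k s))" for n
    proof (subst sum.swap, rule sum.cong[OF refl])
      fix i
      show "(\<Sum>j<k * k. g k n j i \<omega> *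
          (\<omega> i (min (real (Suc j) / real k) s) - \<omega> i (min (real j / real k) s))) =
        h n \<omega> i * (S i n k s - S i (Suc n) k s)"
        unfolding S_def sum_subtractf[symmetric] sum_distrib_left g_def
        using inc[of n] by (intro sum.cong refl) (auto dest: order_trans)
    qed
    then show ?thesis unfolding K_def by simp
  qed
  \<comment> \<open>Only trading times with index below \<open>N\<close> can act on [0,T], so the
    number of summands may be frozen while \<open>k\<close> grows.\<close>
  have S_0: "S i n k s = 0" if "s \<le> T" "n \<ge> N" for i n k s
    unfolding S_def
  proof (intro sum.neutral ballI)
    fix j
    have "min (real (Suc j) / real k) s = s" "min (real j / real k) s = s"
      if "\<tau> n \<omega> \<le> ereal (real j / real k)"
    proof -
      have "ereal T < ereal (real j / real k)" using N[OF \<open>n \<ge> N\<close>] that by (rule less_le_trans)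
      then have "s \<le> real j / real k" using \<open>s \<le> T\<close> by simp
      moreover have "real j / real k \<le> real (Suc j) / real k" by (simp add: divide_right_mono)
      ultimately show "min (real (Suc j) / real k) s = s" "min (real j / real k) s = s" by linarith+
    qed
    then show "(if \<tau> n \<omega> \<le> ereal (real j / real k)
       then \<omega> i (min (real (Suc j) / real k) s) - \<omega> i (min (real j / real k) s) else 0) = 0" by simp
  qed
  \<comment> \<open>Each increment is routed through the current price at \<open>s\<close>, which
    brings it to the form of \<open>entry_uniform_limit\<close>.\<close>
  have cap: "capital Jstar \<tau> h c s \<omega> = c + (\<Sum>n<N. \<Sum>i<Jstar. h n \<omega> i *
      ((\<omega> i s - \<omega> i (real_of_ereal (min (\<tau> n \<omega>) (ereal s)))) -
       (\<omega> i s - \<omega> i (real_of_ereal (min (\<tau> (Suc n) \<omega>) (ereal s))))))" if "s \<le> T" for s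
  proof -
    have "(\<Sum>n. \<Sum>i<Jstar. h n \<omega> i *
      (\<omega> i (real_of_ereal (min (\<tau> (Suc n) \<omega>) (ereal s))) -
       \<omega> i (real_of_ereal (min (\<tau> n \<omega>) (ereal s))))) =
      (\<Sum>n<N. \<Sum>i<Jstar. h n \<omega> i *
      (\<omega> i (real_of_ereal (min (\<tau> (Suc n) \<omega>) (ereal s))) -
       \<omega> i (real_of_ereal (min (\<tau> n \<omega>) (ereal s)))))"
    proof (rule suminf_finite)
      fix n assume "n \<notin> {..<N}"
      then have "ereal T < \<tau> n \<omega>" using N[of n] by simp
      moreover have "ereal s \<le> ereal T" using that by simp
      ultimately have "ereal s \<le> \<tau> n \<omega>" "ereal s \<le> \<tau> (Suc n) \<omega>"
        using inc[of n] by (meson le_less_trans less_imp_le order_trans)+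
      then have "min (\<tau> n \<omega>) (ereal s) = ereal s" "min (\<tau> (Suc n) \<omega>) (ereal s) = ereal s"
        by (simp_all only: min_absorb2)
      then show "(\<Sum>i<Jstar. h n \<omega> i *
        (\<omega> i (real_of_ereal (min (\<tau> (Suc n) \<omega>) (ereal s))) -
         \<omega> i (real_of_ereal (min (\<tau> n \<omega>) (ereal s))))) = 0" by simp
    qed simp
    then show ?thesis unfolding capital_def by simp
  qed
  have "uniform_limit {0..T} (\<lambda>k s. c + (\<Sum>n<N. \<Sum>i<Jstar. h n \<omega> i * (S i n k s - S i (Suc n) k s)))
     (\<lambda>s. c + (\<Sum>n<N. \<Sum>i<Jstar. h n \<omega> i *
      ((\<omega> i s - \<omega> i (real_of_ereal (min (\<tau> n \<omega>) (ereal s)))) -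
       (\<omega> i s - \<omega> i (real_of_ereal (min (\<tau> (Suc n) \<omega>) (ereal s))))))) sequentially"
    unfolding S_def using \<open>Jstar \<le> J\<close>
    by (intro uniform_limit_add uniform_limit_const uniform_limit_sum_real uniform_limit_minus
        bounded_linear.uniform_limit[OF bounded_linear_mult_right] entry_uniform_limit nonneg
        continuous_on_sample[OF \<omega>]) simp_all
  also have "?this \<longleftrightarrow> uniform_limit {0..T} (\<lambda>k s. K k s \<omega>) (\<lambda>s. capital Jstar \<tau> h c s \<omega>) sequentially"
  proof (intro uniform_limit_cong eventually_sequentiallyI[of N] ballI)
    fix k s assume "N \<le> k" "s \<in> {0..T}"
    then have "(\<Sum>n<N. \<Sum>i<Jstar. h n \<omega> i * (S i n k s - S i (Suc n) k s)) =
       (\<Sum>n<k. \<Sum>i<Jstar. h n \<omega> i * (S i n k s - S i (Suc n) k s))"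
      by (intro sum.mono_neutral_left) (auto simp: S_0)
    then show "c + (\<Sum>n<N. \<Sum>i<Jstar. h n \<omega> i * (S i n k s - S i (Suc n) k s)) = K k s \<omega>"
      unfolding K_eq by simp
  qed (simp add: cap)
  finally show "uniform_limit {0..T} (\<lambda>k s. K k s \<omega>) (\<lambda>s. capital Jstar \<tau> h c s \<omega>) sequentially" .
qed

text \<open>This turns the limit condition of \<open>cont_mart\<close> into uniform limits, which
  are easier to combine. A real \<open>SUP\<close> is informative only on sets bounded above;
  continuity on the compact interval supplies the bound.\<close>

lemma SUP_tendsto_0_iff_uniform_limit:
  fixes f :: "nat \<Rightarrow> real \<Rightarrow> real"
  assumes "0 \<le> t" "\<And>k. continuous_on {0..t} (f k)" "continuous_on {0..t} g"
  shows "(\<lambda>k. SUP s\<in>{0..t}. \<bar>f k s - g s\<bar>) \<longlonglongrightarrow> 0 \<longleftrightarrow> uniform_limit {0..t} f g sequentially"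
proof -
  have bdd: "bdd_above ((\<lambda>s. \<bar>f k s - g s\<bar>) ` {0..t})" for k
    using assms by (intro bounded_imp_bdd_above compact_imp_bounded compact_continuous_image
        continuous_intros) simp_all
  have le: "\<bar>f k s - g s\<bar> \<le> (SUP s\<in>{0..t}. \<bar>f k s - g s\<bar>)" if "s \<in> {0..t}" for k s
    by (rule cSUP_upper[OF that bdd])
  have nonneg: "0 \<le> (SUP s\<in>{0..t}. \<bar>f k s - g s\<bar>)" for k
    using order_trans[OF abs_ge_zero le[of 0 k]] assms(1) by simp
  show ?thesis
  proof
    assume lim: "(\<lambda>k. SUP s\<in>{0..t}. \<bar>f k s - g s\<bar>) \<longlonglongrightarrow> 0"
    show "uniform_limit {0..t} f g sequentially"
    proof (rule uniform_limitI)
      fix e :: real assume "0 < e"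
      with lim have "eventually (\<lambda>k. (SUP s\<in>{0..t}. \<bar>f k s - g s\<bar>) < e) sequentially"
        by (rule order_tendstoD)
      then show "\<forall>\<^sub>F k in sequentially. \<forall>s\<in>{0..t}. dist (f k s) (g s) < e"
        by eventually_elim (auto simp: dist_real_def intro: le_less_trans[OF le])
    qed
  next
    assume lim: "uniform_limit {0..t} f g sequentially"
    show "(\<lambda>k. SUP s\<in>{0..t}. \<bar>f k s - g s\<bar>) \<longlonglongrightarrow> 0"
    proof (rule LIMSEQ_I)
      fix e :: real assume "0 < e"
      \<comment> \<open>Half of \<open>e\<close>, because the supremum of values below a bound may
        equal that bound.\<close>
      then have "eventually (\<lambda>k. \<forall>s\<in>{0..t}. dist (f k s) (g s) < e / 2) sequentially"
        using uniform_limitD[OF lim, of "e / 2"] by simp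
      then obtain N where N: "\<And>k s. k \<ge> N \<Longrightarrow> s \<in> {0..t} \<Longrightarrow> \<bar>f k s - g s\<bar> < e / 2"
        unfolding eventually_sequentially dist_real_def by blast
      have "(SUP s\<in>{0..t}. \<bar>f k s - g s\<bar>) \<le> e / 2" if "k \<ge> N" for k
        using N[OF that] assms(1) by (intro cSUP_least) (auto intro: less_imp_le)
      then show "\<exists>N. \<forall>k\<ge>N. norm ((SUP s\<in>{0..t}. \<bar>f k s - g s\<bar>) - 0) < e"
        using nonneg \<open>0 < e\<close> by (intro exI[of _ N]) fastforce
    qed
  qed
qed

section \<open>Continuous martingales as limits of elementary processes\<close>

lemma pdom_iff: "(t, \<omega>) \<in> pdom J X \<longleftrightarrow> 0 \<le> t \<and> \<omega> \<in> mkt_Omega J \<and> X t \<omega> \<noteq> None"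
  by (simp add: pdom_def)

lemma path_process_cong:
  assumes pp: "path_process J X" and eq: "\<And>t \<omega>. 0 \<le> t \<Longrightarrow> \<omega> \<in> mkt_Omega J \<Longrightarrow> X t \<omega> = X' t \<omega>"
  shows "path_process J X'"
proof (rule path_processI)
  fix t \<omega> \<omega>' assume *: "0 \<le> t" "\<omega> \<in> mkt_Omega J" "\<omega>' \<in> mkt_Omega J" "agree_upto J (ereal t) \<omega> \<omega>'"
  show "X' t \<omega> = X' t \<omega>'"
    using path_process_adapted[OF pp *] eq[OF *(1,2)] eq[OF *(1,3)] by simp
next
  fix \<omega> assume *: "\<omega> \<in> mkt_Omega J"
  show "X' 0 \<omega> \<noteq> None" using path_process_0[OF pp *] eq[OF order_refl *] by simp
next
  fix s t \<omega> assume *: "\<omega> \<in> mkt_Omega J" "X' t \<omega> \<noteq> None" "0 \<le> s" "s \<le> t"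
  then have "X t \<omega> \<noteq> None" using eq[of t \<omega>] by simp
  then have "X s \<omega> \<noteq> None" using * by (intro path_process_down[OF pp, of \<omega> t s])
  then show "X' s \<omega> \<noteq> None" using eq[OF *(3,1)] by simp
next
  fix t \<omega> assume *: "\<omega> \<in> mkt_Omega J" "0 \<le> t" "X' t \<omega> \<noteq> None"
  then have "continuous_on {0..t} (\<lambda>s. the (X s \<omega>))"
    using eq[OF *(2,1)] by (intro path_process_cont[OF pp]) simp_all
  then show "continuous_on {0..t} (\<lambda>s. the (X' s \<omega>))"
    by (rule continuous_on_eq) (simp add: eq *(1))
qed

lemma continuous_process_cong:
  assumes "continuous_process Jstar J X" and eq: "\<And>t \<omega>. 0 \<le> t \<Longrightarrow> \<omega> \<in> mkt_Omega J \<Longrightarrow> X t \<omega> = X' t \<omega>"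
  shows "continuous_process Jstar J X'"
proof -
  have X: "path_process J X" "quasi_always Jstar J (pdom J X)"
    using assms(1) unfolding continuous_process_alt by blast+
  have "path_process J X'" by (rule path_process_cong[OF X(1) eq])
  moreover have "pdom J X' = pdom J X" by (auto simp: pdom_iff eq)
  ultimately show ?thesis using X(2) unfolding continuous_process_alt by simp
qed

lemma continuous_process_total:
  assumes "Jstar \<le> J" "path_process J X" "\<And>t \<omega>. 0 \<le> t \<Longrightarrow> \<omega> \<in> mkt_Omega J \<Longrightarrow> X t \<omega> \<noteq> None"
  shows "continuous_process Jstar J X"
  unfolding continuous_process_alt
  by (intro conjI assms(2) quasi_alwaysI[OF assms(1)]) (simp add: pdom_iff assms(3))

text \<open>This turns out to be the class of continuous martingales, but the induction starts from much
  simpler processes.\<close>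
inductive_set elem_mart :: "nat \<Rightarrow> nat \<Rightarrow> (real \<Rightarrow> sample \<Rightarrow> real option) set"
  for Jstar J :: nat where
  elem: "K \<in> elem Jstar J \<Longrightarrow> (\<And>t \<omega>. 0 \<le> t \<Longrightarrow> \<omega> \<in> mkt_Omega J \<Longrightarrow> X t \<omega> = Some (K t \<omega>)) \<Longrightarrow>
    X \<in> elem_mart Jstar J"
| lim: "continuous_process Jstar J X \<Longrightarrow> (\<And>k. Xs k \<in> elem_mart Jstar J) \<Longrightarrow>
    (\<And>k t \<omega>. 0 \<le> t \<Longrightarrow> \<omega> \<in> mkt_Omega J \<Longrightarrow> X t \<omega> \<noteq> None \<Longrightarrow> Xs k t \<omega> \<noteq> None) \<Longrightarrow>
    (\<And>t \<omega>. 0 \<le> t \<Longrightarrow> \<omega> \<in> mkt_Omega J \<Longrightarrow> X t \<omega> \<noteq> None \<Longrightarrow>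
      uniform_limit {0..t} (\<lambda>k s. the (Xs k s \<omega>)) (\<lambda>s. the (X s \<omega>)) sequentially) \<Longrightarrow>
    X \<in> elem_mart Jstar J"

lemma elem_mart_continuous:
  assumes "X \<in> elem_mart Jstar J" "Jstar \<le> J"
  shows "continuous_process Jstar J X"
  using assms(1)
proof (cases rule: elem_mart.cases)
  case (elem K)
  have "path_process J X"
    by (rule path_process_cong[OF path_process_elem[OF elem(1) assms(2)]]) (simp add: elem(2))
  then show ?thesis
    by (rule continuous_process_total[OF assms(2)]) (simp add: elem(2))
qed

lemma elem_mart_path_process: "X \<in> elem_mart Jstar J \<Longrightarrow> Jstar \<le> J \<Longrightarrow> path_process J X"
  using elem_mart_continuous unfolding continuous_process_alt by blast

text \<open>The rule \<open>lim\<close> with a constant sequence absorbs a change of values at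
  negative times or outside \<open>mkt_Omega J\<close>.\<close>

lemma elem_mart_cong:
  assumes "X \<in> elem_mart Jstar J" "Jstar \<le> J"
    and eq: "\<And>t \<omega>. 0 \<le> t \<Longrightarrow> \<omega> \<in> mkt_Omega J \<Longrightarrow> X t \<omega> = X' t \<omega>"
  shows "X' \<in> elem_mart Jstar J"
proof (rule elem_mart.lim[of _ _ _ "\<lambda>_. X"])
  show "continuous_process Jstar J X'"
    by (rule continuous_process_cong[OF elem_mart_continuous[OF assms(1,2)] eq])
  fix t \<omega> assume *: "0 \<le> t" "\<omega> \<in> mkt_Omega J" "X' t \<omega> \<noteq> None"
  then show "X t \<omega> \<noteq> None" by (simp add: eq)
  have "uniform_limit {0..t} (\<lambda>k s. the (X s \<omega>)) (\<lambda>s. the (X s \<omega>)) sequentially"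
    by (rule uniform_limit_const)
  also have "?this \<longleftrightarrow> uniform_limit {0..t} (\<lambda>k s. the (X s \<omega>)) (\<lambda>s. the (X' s \<omega>)) sequentially"
    by (rule uniform_limit_cong') (simp_all add: eq *)
  finally show "uniform_limit {0..t} (\<lambda>k s. the (X s \<omega>)) (\<lambda>s. the (X' s \<omega>)) sequentially" .
qed (rule assms(1))

lemma path_process_uniform_limit:
  assumes J: "Jstar \<le> J" and K: "\<And>k. K k \<in> elem Jstar J"
    and lim: "\<And>\<omega> t. \<omega> \<in> mkt_Omega J \<Longrightarrow>
      uniform_limit {0..t} (\<lambda>k s. K k s \<omega>) (\<lambda>s. P s \<omega>) sequentially"
  shows "path_process J (\<lambda>t \<omega>. Some (P t \<omega>))"
proof (rule path_processI)
  fix t \<omega> \<omega>'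
  assume *: "0 \<le> t" "\<omega> \<in> mkt_Omega J" "\<omega>' \<in> mkt_Omega J" "agree_upto J (ereal t) \<omega> \<omega>'"
  have "(\<lambda>k. K k t \<omega>) \<longlonglongrightarrow> P t \<omega>" "(\<lambda>k. K k t \<omega>') \<longlonglongrightarrow> P t \<omega>'"
    using tendsto_uniform_limitI[OF lim[OF *(2)], of t t] tendsto_uniform_limitI[OF lim[OF *(3)], of t t] *(1)
    by simp_all
  moreover have "K k t \<omega> = K k t \<omega>'" for k by (rule elem_adapted[OF K J *])
  ultimately show "Some (P t \<omega>) = Some (P t \<omega>')" using LIMSEQ_unique by simp
next
  fix t \<omega> assume *: "\<omega> \<in> mkt_Omega J"
  have "continuous_on {0..t} (\<lambda>s. P s \<omega>)"
    by (rule uniform_limit_theorem[OF _ lim[OF *]]) (simp_all add: elem_cont[OF K J *])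
  then show "continuous_on {0..t} (\<lambda>s. the (Some (P s \<omega>)))" by simp
qed simp_all

lemma elem_mart_uniform_limit:
  assumes J: "Jstar \<le> J" and K: "\<And>k. K k \<in> elem Jstar J"
    and lim: "\<And>\<omega> t. \<omega> \<in> mkt_Omega J \<Longrightarrow>
      uniform_limit {0..t} (\<lambda>k s. K k s \<omega>) (\<lambda>s. P s \<omega>) sequentially"
  shows "(\<lambda>t \<omega>. Some (P t \<omega>)) \<in> elem_mart Jstar J"
proof (rule elem_mart.lim[of _ _ _ "\<lambda>k t \<omega>. Some (K k t \<omega>)"])
  show "continuous_process Jstar J (\<lambda>t \<omega>. Some (P t \<omega>))"
  proof (rule continuous_process_total[OF J])
    show "path_process J (\<lambda>t \<omega>. Some (P t \<omega>))"
      by (rule path_process_uniform_limit[of Jstar J K P, OF J K lim])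
  qed simp
  show "(\<lambda>t \<omega>. Some (K k t \<omega>)) \<in> elem_mart Jstar J" for k
    by (rule elem_mart.elem[OF K]) simp
qed (simp_all add: lim)

lemma path_process_SUP_iff:
  assumes "path_process J X" "\<And>k. path_process J (Xs k)" "\<omega> \<in> mkt_Omega J" "0 \<le> t"
    and "X t \<omega> \<noteq> None" "\<And>k. Xs k t \<omega> \<noteq> None"
  shows "(\<lambda>k. SUP s\<in>{0..t}. \<bar>the (Xs k s \<omega>) - the (X s \<omega>)\<bar>) \<longlonglongrightarrow> 0 \<longleftrightarrow>
    uniform_limit {0..t} (\<lambda>k s. the (Xs k s \<omega>)) (\<lambda>s. the (X s \<omega>)) sequentially"
proof (rule SUP_tendsto_0_iff_uniform_limit[OF assms(4)])
  show "continuous_on {0..t} (\<lambda>s. the (Xs k s \<omega>))" for k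
    by (rule path_process_cont[where X = "Xs k"]) (fact assms)+
  show "continuous_on {0..t} (\<lambda>s. the (X s \<omega>))"
    by (rule path_process_cont[where X = X]) (fact assms)+
qed

text \<open>Here and in the converse inclusion the limit steps correspond by
  \<open>path_process_SUP_iff\<close>. Only the base cases carry content: here the approximation of
  random trading times, there the fact that elementary processes are simple capital
  processes.\<close>

lemma cont_mart_subset_elem_mart:
  assumes "Jstar \<le> J" "X \<in> cont_mart Jstar J"
  shows "X \<in> elem_mart Jstar J"
  using assms(2)
proof (induction rule: cont_mart.induct)
  case (simple \<tau> h X c)
  obtain K where K: "\<And>k. K k \<in> elem Jstar J" "\<And>\<omega> t. \<omega> \<in> mkt_Omega J \<Longrightarrow>
      uniform_limit {0..t} (\<lambda>k s. K k s \<omega>) (\<lambda>s. capital Jstar \<tau> h c s \<omega>) sequentially"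
    using capital_approx[OF simple(1) assms(1), of c] by blast
  show ?case
    by (rule elem_mart_cong[OF elem_mart_uniform_limit[OF assms(1) K] assms(1)])
      (simp_all add: simple(3))
next
  case (lim X Xs)
  have X: "path_process J X" using lim.hyps(1) unfolding continuous_process_alt by blast
  have mart: "Xs k \<in> elem_mart Jstar J" for k using lim.IH by blast
  have dom: "Xs k t \<omega> \<noteq> None" if "0 \<le> t" "\<omega> \<in> mkt_Omega J" "X t \<omega> \<noteq> None" for k t \<omega>
    using lim.hyps(2) that pdom_iff[of t \<omega> J X] pdom_iff[of t \<omega> J "Xs k"] by blast
  show ?case
  proof (rule elem_mart.lim[OF lim.hyps(1) mart dom])
    fix t \<omega> assume *: "0 \<le> t" "\<omega> \<in> mkt_Omega J" "X t \<omega> \<noteq> None"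
    have "(\<lambda>k. SUP s\<in>{0..t}. \<bar>the (Xs k s \<omega>) - the (X s \<omega>)\<bar>) \<longlonglongrightarrow> 0"
      using bspec[OF lim.hyps(3), of "(t, \<omega>)"] * pdom_iff[of t \<omega> J X] by simp
    then show "uniform_limit {0..t} (\<lambda>k s. the (Xs k s \<omega>)) (\<lambda>s. the (X s \<omega>)) sequentially"
      using path_process_SUP_iff[of J X Xs \<omega> t, OF X elem_mart_path_process[OF mart assms(1)] *(2,1,3) dom[OF *]]
      by blast
  qed
qed

lemma elem_mart_subset_cont_mart:
  assumes "Jstar \<le> J" "X \<in> elem_mart Jstar J"
  shows "X \<in> cont_mart Jstar J"
  using assms(2)
proof (induction rule: elem_mart.induct)
  case (elem K X)
  obtain \<sigma> h c where "simple_strategy Jstar J \<sigma> h"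
    "\<forall>t\<ge>0. \<forall>\<omega>\<in>mkt_Omega J. capital Jstar \<sigma> h c t \<omega> = K t \<omega>"
    using elem_simple[OF elem.hyps(1) assms(1)] by blast
  then show ?case
    using elem_mart_continuous[OF elem_mart.elem[OF elem.hyps] assms(1)]
    by (intro cont_mart.simple[of _ _ \<sigma> h _ c]) (simp_all add: elem.hyps(2))
next
  case (lim X Xs)
  have X: "path_process J X" using lim.hyps(1) unfolding continuous_process_alt by blast
  show ?case
  proof (rule cont_mart.lim[OF lim.hyps(1), of Xs])
    show "\<forall>k. Xs k \<in> cont_mart Jstar J" using lim.IH by blast
    show "\<forall>k. pdom J X \<subseteq> pdom J (Xs k)"
    proof (intro allI subsetI)
      fix k p assume "p \<in> pdom J X"
      then show "p \<in> pdom J (Xs k)" using lim.hyps(3)[of "fst p" "snd p" k]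
        by (cases p) (simp add: pdom_iff)
    qed
    show "\<forall>(t, \<omega>)\<in>pdom J X. (\<lambda>k. SUP s\<in>{0..t}. \<bar>the (Xs k s \<omega>) - the (X s \<omega>)\<bar>) \<longlonglongrightarrow> 0"
    proof (intro ballI, clarify)
      fix t \<omega> assume "(t, \<omega>) \<in> pdom J X"
      then have *: "0 \<le> t" "\<omega> \<in> mkt_Omega J" "X t \<omega> \<noteq> None" unfolding pdom_iff by blast+
      show "(\<lambda>k. SUP s\<in>{0..t}. \<bar>the (Xs k s \<omega>) - the (X s \<omega>)\<bar>) \<longlonglongrightarrow> 0"
        using path_process_SUP_iff[of J X Xs \<omega> t, OF X elem_mart_path_process[OF lim.hyps(2) assms(1)] *(2,1,3)
            lim.hyps(3)[OF *]] lim.hyps(4)[OF *]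
        by blast
    qed
  qed
qed

section \<open>Elementary integrals against a continuous martingale\<close>

definition efun_process ::
  "((real \<Rightarrow> sample \<Rightarrow> real) \<Rightarrow> real \<Rightarrow> sample \<Rightarrow> real) \<Rightarrow> (real \<Rightarrow> sample \<Rightarrow> real option) \<Rightarrow>
    real \<Rightarrow> sample \<Rightarrow> real option" where
  "efun_process F X t \<omega> = (if X t \<omega> = None then None else Some (F (\<lambda>s \<omega>. the (X s \<omega>)) t \<omega>))"

lemma path_process_efun:
  assumes X: "path_process J X" and F: "F \<in> efun Jstar J" and J: "Jstar \<le> J"
  shows "path_process J (efun_process F X)"
proof (rule path_processI)
  fix t \<omega> \<omega>'
  assume *: "0 \<le> t" "\<omega> \<in> mkt_Omega J" "\<omega>' \<in> mkt_Omega J" "agree_upto J (ereal t) \<omega> \<omega>'"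
  have X_eq: "X s \<omega> = X s \<omega>'" if "0 \<le> s" "s \<le> t" for s
    using that *(4) by (intro path_process_adapted[OF X that(1) *(2,3)] agree_upto_mono[OF *(4)]) simp
  have "F (\<lambda>s \<omega>. the (X s \<omega>)) t \<omega> = F (\<lambda>s \<omega>. the (X s \<omega>)) t \<omega>'"
    by (rule efun_adapted[OF F J *]) (simp add: X_eq)
  then show "efun_process F X t \<omega> = efun_process F X t \<omega>'"
    unfolding efun_process_def using X_eq[of t] *(1) by simp
next
  fix \<omega> assume "\<omega> \<in> mkt_Omega J"
  then show "efun_process F X 0 \<omega> \<noteq> None"
    using path_process_0[OF X] unfolding efun_process_def by simp
next
  fix s t \<omega> assume *: "\<omega> \<in> mkt_Omega J" "efun_process F X t \<omega> \<noteq> None" "0 \<le> s" "s \<le> t"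
  then have "X t \<omega> \<noteq> None" unfolding efun_process_def by (metis (full_types))
  then have "X s \<omega> \<noteq> None" using * by (intro path_process_down[OF X, of \<omega> t s])
  then show "efun_process F X s \<omega> \<noteq> None" unfolding efun_process_def by simp
next
  fix t \<omega> assume *: "\<omega> \<in> mkt_Omega J" "0 \<le> t" "efun_process F X t \<omega> \<noteq> None"
  then have X_t: "X t \<omega> \<noteq> None" unfolding efun_process_def by (metis (full_types))
  have "continuous_on {0..t} (\<lambda>s. F (\<lambda>s \<omega>. the (X s \<omega>)) s \<omega>)"
    by (rule efun_cont[of F Jstar J \<omega> t "\<lambda>s \<omega>. the (X s \<omega>)", OF F J *(1) path_process_cont[of J X \<omega> t, OF X *(1) X_t]])
  then show "continuous_on {0..t} (\<lambda>s. the (efun_process F X s \<omega>))"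
  proof (rule continuous_on_eq)
    fix s assume "s \<in> {0..t}"
    then have "X s \<omega> \<noteq> None" using X_t by (intro path_process_down[OF X *(1), of t s]) simp_all
    then show "F (\<lambda>s \<omega>. the (X s \<omega>)) s \<omega> = the (efun_process F X s \<omega>)"
      by (auto simp: efun_process_def)
  qed
qed

text \<open>The integral has the domain of \<open>X\<close>, so its quasi-always condition needs no
  new supermartingale. The limit step transfers the uniform convergence of the integrators path by
  path, up to each time at which \<open>X\<close> is real.\<close>

lemma efun_elem_mart:
  assumes "X \<in> elem_mart Jstar J" and F: "F \<in> efun Jstar J" and J: "Jstar \<le> J"
  shows "efun_process F X \<in> elem_mart Jstar J"
  using assms(1)
proof (induction rule: elem_mart.induct)
  case (elem K X)
  show ?case
  proof (rule elem_mart.elem[OF efun_elem[OF F elem.hyps(1)]])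
    fix t :: real and \<omega> assume *: "0 \<le> t" "\<omega> \<in> mkt_Omega J"
    have "F (\<lambda>s \<omega>. the (X s \<omega>)) t \<omega> = F K t \<omega>"
      by (rule efun_cong[OF F *(1)]) (simp add: elem.hyps(2) *(2))
    then show "efun_process F X t \<omega> = Some (F K t \<omega>)"
      by (simp add: efun_process_def elem.hyps(2) *)
  qed
next
  case (lim X Xs)
  have X: "path_process J X" using lim.hyps(1) unfolding continuous_process_alt by blast
  have dom: "efun_process F X t \<omega> \<noteq> None \<longleftrightarrow> X t \<omega> \<noteq> None" for X t \<omega>
    by (simp add: efun_process_def)
  show ?case
  proof (rule elem_mart.lim[OF _ lim.IH])
    have "pdom J (efun_process F X) = pdom J X" unfolding pdom_def dom ..
    then show "continuous_process Jstar J (efun_process F X)"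
      using lim.hyps(1) path_process_efun[OF X F J] unfolding continuous_process_alt by simp
    fix t \<omega> assume *: "0 \<le> t" "\<omega> \<in> mkt_Omega J" "efun_process F X t \<omega> \<noteq> None"
    then have X_t: "X t \<omega> \<noteq> None" unfolding dom by blast
    then show "efun_process F (Xs k) t \<omega> \<noteq> None" for k
      unfolding dom by (rule lim.hyps(3)[OF *(1,2)])
    have X_s: "X s \<omega> \<noteq> None" if "s \<in> {0..t}" for s
      using that X_t by (intro path_process_down[OF X *(2), of t s]) simp_all
    have Xs_s: "Xs k s \<omega> \<noteq> None" if "s \<in> {0..t}" for s k
      using that X_s by (intro lim.hyps(3) *(2)) simp_all
    have "uniform_limit {0..t} (\<lambda>k s. F (\<lambda>s \<omega>. the (Xs k s \<omega>)) s \<omega>)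
        (\<lambda>s. F (\<lambda>s \<omega>. the (X s \<omega>)) s \<omega>) sequentially"
      by (rule efun_uniform_limit[where X = "\<lambda>k s \<omega>. the (Xs k s \<omega>)" and x = "\<lambda>s \<omega>. the (X s \<omega>)", OF F lim.hyps(4)[OF *(1,2) X_t]])
    also have "?this \<longleftrightarrow> uniform_limit {0..t} (\<lambda>k s. the (efun_process F (Xs k) s \<omega>))
        (\<lambda>s. the (efun_process F X s \<omega>)) sequentially"
      by (rule uniform_limit_cong') (simp_all add: efun_process_def X_s Xs_s)
    finally show "uniform_limit {0..t} (\<lambda>k s. the (efun_process F (Xs k) s \<omega>))
        (\<lambda>s. the (efun_process F X s \<omega>)) sequentially" .
  qed
qed

text \<open>Where \<open>X\<close> is not real, its approximants need not converge. The pointwise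
  \<open>lim\<close> of their versions is nevertheless measurable on the whole sample space; without
  convergence it is one fixed value, so it still depends on the path up to \<open>t\<close>
  only.\<close>

lemma elem_mart_measurable_version:
  assumes "X \<in> elem_mart Jstar J" "Jstar \<le> J" and t: "0 \<le> t"
  shows "\<exists>Z. Z \<in> borel_measurable (mkt_F J) \<and>
    (\<forall>\<omega>\<in>mkt_Omega J. \<forall>\<omega>'\<in>mkt_Omega J. agree_upto J (ereal t) \<omega> \<omega>' \<longrightarrow> Z \<omega> = Z \<omega>') \<and>
    (\<forall>\<omega>\<in>mkt_Omega J. X t \<omega> \<noteq> None \<longrightarrow> Z \<omega> = the (X t \<omega>))"
  using assms(1)
proof (induction rule: elem_mart.induct)
  case (elem K X)
  show ?case
  proof (intro exI[of _ "K t"] conjI ballI impI)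
    show "K t \<in> borel_measurable (mkt_F J)" by (rule elem_measurable[OF elem.hyps(1) assms(2) t])
    show "K t \<omega> = K t \<omega>'"
      if "\<omega> \<in> mkt_Omega J" "\<omega>' \<in> mkt_Omega J" "agree_upto J (ereal t) \<omega> \<omega>'" for \<omega> \<omega>'
      by (rule elem_adapted[OF elem.hyps(1) assms(2) t that])
    show "K t \<omega> = the (X t \<omega>)" if "\<omega> \<in> mkt_Omega J" for \<omega>
      by (simp add: elem.hyps(2)[OF t that])
  qed
next
  case (lim X Xs)
  from choice[OF allI[OF lim.IH]] obtain Z where *: "\<And>k. Z k \<in> borel_measurable (mkt_F J) \<and>
    (\<forall>\<omega>\<in>mkt_Omega J. \<forall>\<omega>'\<in>mkt_Omega J. agree_upto J (ereal t) \<omega> \<omega>' \<longrightarrow> Z k \<omega> = Z k \<omega>') \<and>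
    (\<forall>\<omega>\<in>mkt_Omega J. Xs k t \<omega> \<noteq> None \<longrightarrow> Z k \<omega> = the (Xs k t \<omega>))"
    by fast
  then have Z: "\<And>k. Z k \<in> borel_measurable (mkt_F J)" by (rule conjunct1)
  have agree: "Z k \<omega> = Z k \<omega>'"
    if "\<omega> \<in> mkt_Omega J" "\<omega>' \<in> mkt_Omega J" "agree_upto J (ereal t) \<omega> \<omega>'" for k \<omega> \<omega>'
    using conjunct1[OF conjunct2[OF *[of k]]] that by blast
  have eq: "Z k \<omega> = the (Xs k t \<omega>)" if "\<omega> \<in> mkt_Omega J" "Xs k t \<omega> \<noteq> None" for k \<omega>
    using conjunct2[OF conjunct2[OF *[of k]]] that by blast
  show ?case
  proof (intro exI[of _ "\<lambda>\<omega>. lim (\<lambda>k. Z k \<omega>)"] conjI ballI impI)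
    show "(\<lambda>\<omega>. lim (\<lambda>k. Z k \<omega>)) \<in> borel_measurable (mkt_F J)"
      by (rule borel_measurable_lim_metric[OF Z])
  next
    fix \<omega> \<omega>' assume *: "\<omega> \<in> mkt_Omega J" "\<omega>' \<in> mkt_Omega J" "agree_upto J (ereal t) \<omega> \<omega>'"
    have "(\<lambda>k. Z k \<omega>) = (\<lambda>k. Z k \<omega>')" by (rule ext) (rule agree[OF *])
    then show "lim (\<lambda>k. Z k \<omega>) = lim (\<lambda>k. Z k \<omega>')" by simp
  next
    fix \<omega> assume *: "\<omega> \<in> mkt_Omega J" "X t \<omega> \<noteq> None"
    have "(\<lambda>k. the (Xs k t \<omega>)) \<longlonglongrightarrow> the (X t \<omega>)"
      using tendsto_uniform_limitI[OF lim.hyps(4)[OF t *], of t] t by simp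
    moreover have "Z k \<omega> = the (Xs k t \<omega>)" for k
      by (rule eq[OF *(1) lim.hyps(3)[OF t *]])
    ultimately show "lim (\<lambda>k. Z k \<omega>) = the (X t \<omega>)" by (simp add: limI)
  qed
qed

section \<open>Lifting elementary processes from the new market\<close>

text \<open>Rounding down, rather than to a nearest rational, keeps the approximating times inside
  every interval [0,u] that contains \<open>s\<close>, and so inside the domain of
  \<open>X\<close>.\<close>

definition floor_frac :: "nat \<Rightarrow> real \<Rightarrow> real" where
  "floor_frac k s = of_int \<lfloor>real (Suc k) * s\<rfloor> / real (Suc k)"

lemma floor_frac:
  shows "floor_frac k s \<in> \<rat>" and "floor_frac k s \<le> s" and "0 \<le> s \<Longrightarrow> 0 \<le> floor_frac k s"
    and "(\<lambda>k. floor_frac k s) \<longlonglongrightarrow> s"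
proof -
  show "floor_frac k s \<in> \<rat>" unfolding floor_frac_def by (intro Rats_divide Rats_of_int Rats_of_nat)
  have le: "floor_frac k s \<le> s" for k
    using of_int_floor_le[of "real (Suc k) * s"] unfolding floor_frac_def
    by (simp add: divide_le_eq mult.commute)
  then show "floor_frac k s \<le> s" .
  show "0 \<le> floor_frac k s" if "0 \<le> s" using that unfolding floor_frac_def by simp
  have ge: "s + - inverse (real (Suc k)) \<le> floor_frac k s" for k
  proof -
    have "real (Suc k) * s - 1 \<le> of_int \<lfloor>real (Suc k) * s\<rfloor>" by linarith
    then have "(real (Suc k) * s - 1) / real (Suc k) \<le> floor_frac k s"
      unfolding floor_frac_def by (intro divide_right_mono) simp_all
    then show ?thesis by (simp add: diff_divide_distrib inverse_eq_divide)
  qed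
  show "(\<lambda>k. floor_frac k s) \<longlonglongrightarrow> s"
    by (rule tendsto_sandwich[OF _ _ LIMSEQ_inverse_real_of_nat_add_minus tendsto_const])
      (rule always_eventually, rule allI, rule ge, rule always_eventually, rule allI, rule le)
qed

section \<open>Sample points of the new market that extend X\<close>

definition cons_path :: "(real \<Rightarrow> real) \<Rightarrow> sample \<Rightarrow> sample" where
  "cons_path p \<omega> i = (case i of 0 \<Rightarrow> p | Suc i \<Rightarrow> \<omega> i)"

lemma cons_path_simps [simp]: "cons_path p \<omega> 0 = p" "cons_path p \<omega> (Suc i) = \<omega> i"
  by (simp_all add: cons_path_def)

lemma cons_path_in_Omega:
  assumes "continuous_on {0..} p" "\<And>s. s < 0 \<Longrightarrow> p s = 0" "\<omega> \<in> mkt_Omega J"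
  shows "cons_path p \<omega> \<in> mkt_Omega (Suc J)"
  using assms unfolding mkt_Omega_def cons_path_def by (auto split: nat.split)

text \<open>The predicate under the choice operator in \<open>lift_process\<close>. It ties the
  sample of the new market to \<open>X\<close> and \<open>\<omega>\<close> only up to time
  \<open>t\<close>.\<close>

definition extends :: "nat \<Rightarrow> (real \<Rightarrow> sample \<Rightarrow> real option) \<Rightarrow> real \<Rightarrow> sample \<Rightarrow> sample \<Rightarrow> bool" where
  "extends J X t \<omega> z \<longleftrightarrow> z \<in> mkt_Omega (Suc J) \<and>
     agree_upto (Suc J) (ereal t) z (\<lambda>i s. if i = 0 then the (X s \<omega>) else \<omega> (i - 1) s)"

lemma extends_iff:
  "extends J X t \<omega> z \<longleftrightarrow> z \<in> mkt_Omega (Suc J) \<and> (\<forall>s. 0 \<le> s \<and> s \<le> t \<longrightarrow>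
     z 0 s = the (X s \<omega>) \<and> (\<forall>i<J. z (Suc i) s = \<omega> i s))"
  unfolding extends_def agree_upto_def by (auto simp: less_Suc_eq_0_disj all_conj_distrib)

lemma extends_Omega: "extends J X t \<omega> z \<Longrightarrow> z \<in> mkt_Omega (Suc J)"
  unfolding extends_def by blast

lemma extends_mono: "extends J X t \<omega> z \<Longrightarrow> s \<le> t \<Longrightarrow> extends J X s \<omega> z"
  unfolding extends_def by (elim conjE, intro conjI, assumption, erule agree_upto_mono, simp)

lemma extends_agree: "extends J X t \<omega> z \<Longrightarrow> extends J X t \<omega> z' \<Longrightarrow> agree_upto (Suc J) (ereal t) z z'"
  unfolding extends_def by (elim conjE, erule agree_upto_trans, rule agree_upto_sym)

lemma extends_cong:
  assumes "path_process J X" "\<omega> \<in> mkt_Omega J" "\<omega>' \<in> mkt_Omega J" "agree_upto J (ereal t) \<omega> \<omega>'"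
    and "extends J X t \<omega> z"
  shows "extends J X t \<omega>' z"
proof -
  have "X s \<omega> = X s \<omega>'" if "0 \<le> s" "s \<le> t" for s
    using that by (intro path_process_adapted[OF assms(1) that(1) assms(2,3)] agree_upto_mono[OF assms(4)]) simp
  moreover have "\<omega> i s = \<omega>' i s" if "0 \<le> s" "s \<le> t" "i < J" for i s
    by (rule agree_uptoD[OF assms(4) that(3,1,2)])
  ultimately show ?thesis using assms(5) unfolding extends_iff by metis
qed

text \<open>Freezing \<open>X\<close> from time \<open>t\<close> on gives a real continuous path on
  [0,oo), whatever happens to \<open>X\<close> later.\<close>

lemma extends_exists:
  assumes "path_process J X" "\<omega> \<in> mkt_Omega J" "0 \<le> t" "X t \<omega> \<noteq> None"
  shows "\<exists>z. extends J X t \<omega> z"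
proof -
  define p where "p s = (if s < 0 then 0 else the (X (min s t) \<omega>))" for s
  have cont: "continuous_on {0..t} (\<lambda>s. the (X s \<omega>))"
    by (rule path_process_cont[of J X \<omega> t]) (fact assms)+
  have "continuous_on {0..} (\<lambda>s. the (X (min s t) \<omega>))"
    by (rule continuous_on_compose2[OF cont]) (use assms(3) in \<open>auto intro!: continuous_intros\<close>)
  then have "continuous_on {0..} p"
    by (rule continuous_on_eq) (simp add: p_def)
  then have "cons_path p \<omega> \<in> mkt_Omega (Suc J)"
    by (rule cons_path_in_Omega[OF _ _ assms(2)]) (simp add: p_def)
  then have "extends J X t \<omega> (cons_path p \<omega>)"
    unfolding extends_iff by (simp add: p_def)
  then show ?thesis by blast
qed

lemma lift_None:
  assumes "0 \<le> t" "X t \<omega> = None"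
  shows "lift_process J X Y t \<omega> = None"
proof -
  have "\<exists>s\<in>{0..t}. X s \<omega> = None" using assms by (intro bexI[of _ t]) simp_all
  then show ?thesis unfolding lift_process_def by (rule if_P)
qed

text \<open>The choice in \<open>lift_process\<close> is immaterial: two extensions agree up to
  \<open>t\<close>, and \<open>Y\<close> is adapted.\<close>

lemma lift_eq:
  assumes X: "path_process J X" and Y: "path_process (Suc J) Y"
    and \<omega>: "\<omega> \<in> mkt_Omega J" and t: "0 \<le> t" "X t \<omega> \<noteq> None" and z: "extends J X t \<omega> z"
  shows "lift_process J X Y t \<omega> = Y t z"
proof -
  have "X s \<omega> \<noteq> None" if "s \<in> {0..t}" for s
    using that by (intro path_process_down[OF X \<omega>, of t s] t) simp_all
  then have "\<not> (\<exists>s\<in>{0..t}. X s \<omega> = None)" by blast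
  then have "lift_process J X Y t \<omega> = Y t (SOME z. extends J X t \<omega> z)"
    unfolding lift_process_def extends_def by (rule if_not_P)
  moreover have *: "extends J X t \<omega> (SOME z. extends J X t \<omega> z)" by (rule someI[of "extends J X t \<omega>", OF z])
  ultimately show ?thesis
    using path_process_adapted[OF Y t(1) extends_Omega[OF *] extends_Omega[OF z] extends_agree[OF * z]]
    by simp
qed

lemma lift_dom:
  assumes "path_process J X" "path_process (Suc J) Y" "\<omega> \<in> mkt_Omega J" "0 \<le> t"
    and "lift_process J X Y t \<omega> \<noteq> None"
  obtains z where "X t \<omega> \<noteq> None" "extends J X t \<omega> z" "Y t z \<noteq> None"
proof -
  have t: "X t \<omega> \<noteq> None" using lift_None[OF assms(4), of X \<omega> J Y] assms(5) by blast
  obtain z where z: "extends J X t \<omega> z" using extends_exists[of J X \<omega> t] assms t by blast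
  have "Y t z \<noteq> None" using lift_eq[of J X Y \<omega> t z] assms t z by simp
  with t z show ?thesis by (rule that)
qed

text \<open>One \<open>z\<close>, taken at the last time \<open>t\<close>, serves all earlier times.
  The path of the lift on [0,t] is thus the path of \<open>Y\<close> at a single sample, which is
  how continuity and uniform limits are transferred.\<close>

lemma lift_eq_upto:
  assumes X: "path_process J X" and Y: "path_process (Suc J) Y"
    and \<omega>: "\<omega> \<in> mkt_Omega J" and t: "X t \<omega> \<noteq> None" and z: "extends J X t \<omega> z"
    and s: "0 \<le> s" "s \<le> t"
  shows "lift_process J X Y s \<omega> = Y s z"
proof (rule lift_eq[OF X Y \<omega> s(1) _ extends_mono[OF z s(2)]])
  show "X s \<omega> \<noteq> None" by (rule path_process_down[OF X \<omega>, of t s]) (fact t s)+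
qed

lemma path_process_lift:
  assumes X: "path_process J X" and Y: "path_process (Suc J) Y"
  shows "path_process J (lift_process J X Y)"
proof (rule path_processI)
  fix t \<omega> \<omega>'
  assume *: "0 \<le> t" "\<omega> \<in> mkt_Omega J" "\<omega>' \<in> mkt_Omega J" "agree_upto J (ereal t) \<omega> \<omega>'"
  have X_eq: "X t \<omega> = X t \<omega>'" by (rule path_process_adapted[OF X *])
  show "lift_process J X Y t \<omega> = lift_process J X Y t \<omega>'"
  proof (cases "X t \<omega> = None")
    case True
    then show ?thesis
      using X_eq lift_None[OF *(1), of X \<omega> J Y] lift_None[OF *(1), of X \<omega>' J Y] by simp
  next
    case False
    then obtain z where z: "extends J X t \<omega> z" using extends_exists[OF X *(2,1)] by blast
    have z': "extends J X t \<omega>' z" by (rule extends_cong[OF X *(2,3,4) z])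
    have "X t \<omega>' \<noteq> None" using False X_eq by simp
    from lift_eq[OF X Y *(3,1) this z'] lift_eq[OF X Y *(2,1) False z] show ?thesis by simp
  qed
next
  fix \<omega> assume \<omega>: "\<omega> \<in> mkt_Omega J"
  have X_0: "X 0 \<omega> \<noteq> None" by (rule path_process_0[OF X \<omega>])
  then obtain z where z: "extends J X 0 \<omega> z" using extends_exists[OF X \<omega> order_refl] by blast
  show "lift_process J X Y 0 \<omega> \<noteq> None"
    unfolding lift_eq[OF X Y \<omega> order_refl X_0 z] by (rule path_process_0[OF Y extends_Omega[OF z]])
next
  fix s t \<omega> assume *: "\<omega> \<in> mkt_Omega J" "lift_process J X Y t \<omega> \<noteq> None" "0 \<le> s" "s \<le> t"
  have "0 \<le> t" using * by simp
  then obtain z where z: "X t \<omega> \<noteq> None" "extends J X t \<omega> z" "Y t z \<noteq> None"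
    using lift_dom[OF X Y *(1) _ *(2)] by blast
  show "lift_process J X Y s \<omega> \<noteq> None"
    unfolding lift_eq_upto[OF X Y *(1) z(1,2) *(3,4)]
    by (rule path_process_down[OF Y extends_Omega[OF z(2)], of t s]) (fact z *)+
next
  fix t \<omega> assume *: "\<omega> \<in> mkt_Omega J" "0 \<le> t" "lift_process J X Y t \<omega> \<noteq> None"
  obtain z where z: "X t \<omega> \<noteq> None" "extends J X t \<omega> z" "Y t z \<noteq> None"
    using lift_dom[OF X Y *] by blast
  have "continuous_on {0..t} (\<lambda>s. the (Y s z))"
    by (rule path_process_cont[of "Suc J" Y z t, OF Y extends_Omega[OF z(2)] z(3)])
  then show "continuous_on {0..t} (\<lambda>s. the (lift_process J X Y s \<omega>))"
    by (rule continuous_on_eq) (simp add: lift_eq_upto[OF X Y *(1) z(1,2)])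
qed

section \<open>Measurable extension of X up to a fixed time\<close>

lemma uniformly_continuous_on_cong:
  fixes f g :: "'a::metric_space \<Rightarrow> 'b::metric_space"
  assumes "\<And>x. x \<in> S \<Longrightarrow> f x = g x"
  shows "uniformly_continuous_on S f \<longleftrightarrow> uniformly_continuous_on S g"
  unfolding uniformly_continuous_on_def using assms by (simp cong: ball_cong)

lemma sets_Collect_Ball_countable:
  assumes "countable X" "\<And>i. i \<in> X \<Longrightarrow> {x \<in> space M. P i x} \<in> sets M"
  shows "{x \<in> space M. \<forall>i\<in>X. P i x} \<in> sets M"
proof (cases "X = {}")
  case False
  then have "{x \<in> space M. \<forall>i\<in>X. P i x} = (\<Inter>i\<in>X. {x \<in> space M. P i x})" by auto
  also have "\<dots> \<in> sets M" using assms False by (intro sets.countable_INT') auto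
  finally show ?thesis .
qed simp

text \<open>\<open>X\<close> may explode in finite time, so its paths cannot be turned into elements of the new sample
  space globally; this is only possible up to a fixed time.\<close>
lemma measurable_extension:
  assumes mart: "X \<in> elem_mart Jstar J" and J: "Jstar \<le> J" and u: "0 \<le> u"
  obtains \<phi> where "\<phi> \<in> measurable (mkt_F J) (mkt_F (Suc J))"
    and "\<And>\<omega> \<omega>'. \<omega> \<in> mkt_Omega J \<Longrightarrow> \<omega>' \<in> mkt_Omega J \<Longrightarrow> agree_upto J (ereal u) \<omega> \<omega>' \<Longrightarrow>
      agree_upto (Suc J) (ereal u) (\<phi> \<omega>) (\<phi> \<omega>')"
    and "\<And>\<omega>. \<omega> \<in> mkt_Omega J \<Longrightarrow> X u \<omega> \<noteq> None \<Longrightarrow> extends J X u \<omega> (\<phi> \<omega>)"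
proof -
  note X = elem_mart_path_process[OF mart J]
  have "\<forall>t\<in>{0..}. \<exists>Z. Z \<in> borel_measurable (mkt_F J) \<and>
    (\<forall>\<omega>\<in>mkt_Omega J. \<forall>\<omega>'\<in>mkt_Omega J. agree_upto J (ereal t) \<omega> \<omega>' \<longrightarrow> Z \<omega> = Z \<omega>') \<and>
    (\<forall>\<omega>\<in>mkt_Omega J. X t \<omega> \<noteq> None \<longrightarrow> Z \<omega> = the (X t \<omega>))"
    using elem_mart_measurable_version[OF mart J] by simp
  from bchoice[OF this] obtain Z where "\<forall>t\<in>{0..}. Z t \<in> borel_measurable (mkt_F J) \<and>
    (\<forall>\<omega>\<in>mkt_Omega J. \<forall>\<omega>'\<in>mkt_Omega J. agree_upto J (ereal t) \<omega> \<omega>' \<longrightarrow> Z t \<omega> = Z t \<omega>') \<and>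
    (\<forall>\<omega>\<in>mkt_Omega J. X t \<omega> \<noteq> None \<longrightarrow> Z t \<omega> = the (X t \<omega>))"
    by (rule exE)
  note * = bspec[OF this atLeast_iff[THEN iffD2]]
  have Z: "Z t \<in> borel_measurable (mkt_F J)" if "0 \<le> t" for t
    by (rule conjunct1[OF *[OF that]])
  have agree: "Z t \<omega> = Z t \<omega>'"
    if "0 \<le> t" "\<omega> \<in> mkt_Omega J" "\<omega>' \<in> mkt_Omega J" "agree_upto J (ereal t) \<omega> \<omega>'" for t \<omega> \<omega>'
    using conjunct1[OF conjunct2[OF *[OF that(1)]]] that by blast
  have eq: "Z t \<omega> = the (X t \<omega>)" if "0 \<le> t" "\<omega> \<in> mkt_Omega J" "X t \<omega> \<noteq> None" for t \<omega>
    using conjunct2[OF conjunct2[OF *[OF that(1)]]] that by blast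
  \<comment> \<open>Only countably many times enter the construction, so versions \<open>Z t\<close>
    chosen separately for each \<open>t\<close> suffice.\<close>
  define Q where "Q = \<rat> \<inter> {0..u}"
  have Q: "countable Q" unfolding Q_def by (intro countable_Int1 countable_rat)
  have frac_Q: "floor_frac k s \<in> Q" if "0 \<le> s" "s \<le> u" for k s
    using floor_frac(1)[of k s] floor_frac(2)[of k s] floor_frac(3)[of s k] that unfolding Q_def by simp
  \<comment> \<open>Uniform continuity on the rational times is what permits a continuous extension.
    Spelled out with countable quantifiers it defines a measurable event, and this event contains
    all samples at which \<open>X u\<close> is real.\<close>
  define good where "good \<omega> \<longleftrightarrow> (\<forall>m::nat. \<exists>n::nat. \<forall>p\<in>Q. \<forall>q\<in>Q.
      \<bar>p - q\<bar> < inverse (real (Suc n)) \<longrightarrow> \<bar>Z p \<omega> - Z q \<omega>\<bar> < inverse (real (Suc m)))" for \<omega>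
  have good_iff: "good \<omega> \<longleftrightarrow> uniformly_continuous_on Q (\<lambda>q. Z q \<omega>)" for \<omega>
  proof
    assume good: "good \<omega>"
    show "uniformly_continuous_on Q (\<lambda>q. Z q \<omega>)"
      unfolding uniformly_continuous_on_def
    proof (intro allI impI)
      fix e :: real assume "0 < e"
      then obtain m where m: "inverse (real (Suc m)) < e" using reals_Archimedean by blast
      from good obtain n where n: "\<And>p q. p \<in> Q \<Longrightarrow> q \<in> Q \<Longrightarrow> \<bar>p - q\<bar> < inverse (real (Suc n)) \<Longrightarrow>
          \<bar>Z p \<omega> - Z q \<omega>\<bar> < inverse (real (Suc m))"
        unfolding good_def by blast
      show "\<exists>d>0. \<forall>x\<in>Q. \<forall>x'\<in>Q. dist x' x < d \<longrightarrow> dist (Z x' \<omega>) (Z x \<omega>) < e"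
      proof (intro exI[of _ "inverse (real (Suc n))"] conjI ballI impI)
        fix x x' assume "x \<in> Q" "x' \<in> Q" "dist x' x < inverse (real (Suc n))"
        from n[OF this(2,1)] this(3) m show "dist (Z x' \<omega>) (Z x \<omega>) < e"
          unfolding dist_real_def by linarith
      qed simp
    qed
  next
    assume uc: "uniformly_continuous_on Q (\<lambda>q. Z q \<omega>)"
    show "good \<omega>"
      unfolding good_def
    proof
      fix m :: nat
      have "0 < inverse (real (Suc m))" by simp
      with uc obtain d where d: "0 < d" "\<And>x x'. x \<in> Q \<Longrightarrow> x' \<in> Q \<Longrightarrow> dist x' x < d \<Longrightarrow>
          dist (Z x' \<omega>) (Z x \<omega>) < inverse (real (Suc m))"
        unfolding uniformly_continuous_on_def by metis
      obtain n where n: "inverse (real (Suc n)) < d" using reals_Archimedean[OF d(1)] by blast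
      show "\<exists>n. \<forall>p\<in>Q. \<forall>q\<in>Q. \<bar>p - q\<bar> < inverse (real (Suc n)) \<longrightarrow> \<bar>Z p \<omega> - Z q \<omega>\<bar> < inverse (real (Suc m))"
      proof (intro exI[of _ n] ballI impI)
        fix p q assume "p \<in> Q" "q \<in> Q" "\<bar>p - q\<bar> < inverse (real (Suc n))"
        then show "\<bar>Z p \<omega> - Z q \<omega>\<bar> < inverse (real (Suc m))"
          using d(2)[of q p] n unfolding dist_real_def by linarith
      qed
    qed
  qed
  have [measurable]: "Measurable.pred (mkt_F J) good"
    unfolding pred_def good_def
  proof (intro sets.sets_Collect_countable_All sets.sets_Collect_countable_Ex
      sets_Collect_Ball_countable[OF Q])
    fix m n :: nat and p q assume "p \<in> Q" "q \<in> Q"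
    then have "Z p \<in> borel_measurable (mkt_F J)" "Z q \<in> borel_measurable (mkt_F J)"
      using Z unfolding Q_def by simp_all
    then show "{\<omega> \<in> space (mkt_F J). \<bar>p - q\<bar> < inverse (real (Suc n)) \<longrightarrow>
        \<bar>Z p \<omega> - Z q \<omega>\<bar> < inverse (real (Suc m))} \<in> sets (mkt_F J)"
      by measurable
  qed
  \<comment> \<open>The continuous extension from \<open>Q\<close>, written as a sequential limit to
    be measurable in the sample; freezing at \<open>u\<close> prolongs it to [0,oo).\<close>
  define G where "G \<omega> s = lim (\<lambda>k. Z (floor_frac k (min s u)) \<omega>)" for \<omega> s
  have G_cont: "continuous_on {0..u} (G \<omega>)" if good: "good \<omega>" for \<omega>
  proof -
    obtain g where g: "uniformly_continuous_on (closure Q) g" "\<And>q. q \<in> Q \<Longrightarrow> Z q \<omega> = g q"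
      using uniformly_continuous_on_extension_on_closure[OF good[unfolded good_iff]] by metis
    have cl: "s \<in> closure Q" if "s \<in> {0..u}" for s
      unfolding closure_sequential
      using floor_frac(4)[of s] frac_Q[of s] that by (intro exI[of _ "\<lambda>k. floor_frac k s"]) simp
    have cont: "continuous_on (closure Q) g" by (rule uniformly_continuous_imp_continuous[OF g(1)])
    have "G \<omega> s = g s" if s: "s \<in> {0..u}" for s
    proof -
      have "(\<lambda>k. g (floor_frac k s)) \<longlonglongrightarrow> g s"
        by (rule continuous_on_tendsto_compose[OF cont floor_frac(4) cl[OF s]])
          (use s frac_Q[of s] closure_subset in \<open>auto intro!: always_eventually\<close>)
      moreover have "Z (floor_frac k s) \<omega> = g (floor_frac k s)" for k
        using s by (intro g(2) frac_Q) simp_all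
      ultimately show ?thesis using s unfolding G_def by (simp add: limI min_absorb1)
    qed
    moreover have "continuous_on {0..u} g" using cl by (intro continuous_on_subset[OF cont]) blast
    ultimately show ?thesis by (metis (no_types, lifting) continuous_on_cong)
  qed
  \<comment> \<open>Samples that are not \<open>good\<close> receive the zero path, so that
    \<open>\<phi>\<close> always takes values in the new sample space.\<close>
  define p where "p \<omega> s = (if good \<omega> \<and> 0 \<le> s then G \<omega> s else 0)" for \<omega> s
  define \<phi> where "\<phi> \<omega> = cons_path (p \<omega>) \<omega>" for \<omega>
  have \<phi>: "\<phi> \<in> measurable (mkt_F J) (mkt_F (Suc J))"
  proof (rule measurable_into_mkt_F)
    fix \<omega> assume "\<omega> \<in> space (mkt_F J)"
    then have \<omega>: "\<omega> \<in> mkt_Omega J" by simp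
    have "continuous_on {0..} (p \<omega>)"
    proof (cases "good \<omega>")
      case True
      have "continuous_on {0..} (\<lambda>s. G \<omega> (min s u))"
        by (rule continuous_on_compose2[OF G_cont[OF True]]) (use u in \<open>auto intro!: continuous_intros\<close>)
      then show ?thesis
        by (rule continuous_on_eq) (simp add: p_def True G_def)
    next
      case False
      then have "p \<omega> = (\<lambda>_. 0)" by (simp add: p_def fun_eq_iff)
      then show ?thesis by simp
    qed
    then show "\<phi> \<omega> \<in> mkt_Omega (Suc J)"
      unfolding \<phi>_def by (rule cons_path_in_Omega[OF _ _ \<omega>]) (simp add: p_def)
  next
    fix i :: nat and t :: real assume i: "i < Suc J" and t: "0 \<le> t"
    show "(\<lambda>\<omega>. \<phi> \<omega> i t) \<in> borel_measurable (mkt_F J)"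
    proof (cases i)
      case 0
      have [measurable]: "(\<lambda>\<omega>. G \<omega> t) \<in> borel_measurable (mkt_F J)"
        unfolding G_def using t u floor_frac(3) by (intro borel_measurable_lim_metric Z) simp
      show ?thesis unfolding 0 \<phi>_def cons_path_simps p_def by measurable
    next
      case (Suc j)
      then show ?thesis using i t by (simp add: \<phi>_def coordinate_measurable)
    qed
  qed
  moreover have "agree_upto (Suc J) (ereal u) (\<phi> \<omega>) (\<phi> \<omega>')"
    if \<omega>: "\<omega> \<in> mkt_Omega J" and \<omega>': "\<omega>' \<in> mkt_Omega J" and agr: "agree_upto J (ereal u) \<omega> \<omega>'" for \<omega> \<omega>'
  proof -
    have Z_eq: "Z s \<omega> = Z s \<omega>'" if "0 \<le> s" "s \<le> u" for s
      using that by (intro agree \<omega> \<omega>' agree_upto_mono[OF agr]) simp_all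
    have "good \<omega> \<longleftrightarrow> good \<omega>'"
      unfolding good_iff by (rule uniformly_continuous_on_cong) (auto simp: Q_def Z_eq)
    moreover have "G \<omega> s = G \<omega>' s" if "0 \<le> s" for s
    proof -
      have "Z (floor_frac k (min s u)) \<omega> = Z (floor_frac k (min s u)) \<omega>'" for k
        using floor_frac(2)[of k "min s u"] floor_frac(3)[of "min s u" k] that u by (intro Z_eq) simp_all
      then show ?thesis unfolding G_def by simp
    qed
    ultimately have "p \<omega> s = p \<omega>' s" for s by (simp add: p_def)
    then show ?thesis
      using agree_uptoD[OF agr] unfolding agree_upto_def \<phi>_def
      by (auto simp: less_Suc_eq_0_disj)
  qed
  moreover have "extends J X u \<omega> (\<phi> \<omega>)" if \<omega>: "\<omega> \<in> mkt_Omega J" and X_u: "X u \<omega> \<noteq> None" for \<omega>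
  proof -
    have X_s: "X s \<omega> \<noteq> None" if "0 \<le> s" "s \<le> u" for s
      by (rule path_process_down[OF X \<omega>, of u s]) (fact X_u that)+
    have cont: "continuous_on {0..u} (\<lambda>s. the (X s \<omega>))"
      by (rule path_process_cont[of J X \<omega> u]) (fact X \<omega> X_u)+
    have "uniformly_continuous_on {0..u} (\<lambda>s. the (X s \<omega>))"
      by (rule compact_uniformly_continuous[OF cont]) simp
    then have "uniformly_continuous_on Q (\<lambda>s. the (X s \<omega>))"
      unfolding uniformly_continuous_on_def Q_def Int_iff by fast
    also have "?this \<longleftrightarrow> good \<omega>"
      unfolding good_iff
    proof (rule uniformly_continuous_on_cong)
      fix q assume "q \<in> Q"
      then have "0 \<le> q" "q \<le> u" unfolding Q_def by simp_all
      then show "the (X q \<omega>) = Z q \<omega>" by (intro eq[symmetric] \<omega> X_s)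
    qed
    finally have good: "good \<omega>" .
    have "G \<omega> s = the (X s \<omega>)" if s: "0 \<le> s" "s \<le> u" for s
    proof -
      have *: "0 \<le> floor_frac k s" "floor_frac k s \<le> u" for k
        using floor_frac(2)[of k s] floor_frac(3)[of s k] s by simp_all
      have "(\<lambda>k. the (X (floor_frac k s) \<omega>)) \<longlonglongrightarrow> the (X s \<omega>)"
        by (rule continuous_on_tendsto_compose[OF cont floor_frac(4)])
          (use s * in \<open>auto intro!: always_eventually\<close>)
      moreover have "Z (floor_frac k s) \<omega> = the (X (floor_frac k s) \<omega>)" for k
        by (rule eq[OF *(1) \<omega> X_s[OF *]])
      ultimately show ?thesis using s unfolding G_def by (simp add: limI min_absorb1)
    qed
    moreover have "\<phi> \<omega> \<in> mkt_Omega (Suc J)"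
      using measurable_space[OF \<phi>, of \<omega>] \<omega> by simp
    ultimately show ?thesis
      unfolding extends_iff by (simp add: \<phi>_def p_def good)
  qed
  ultimately show thesis by (rule that)
qed

text \<open>One functional \<open>F\<close> serves all times and samples: bets on security 0 become
  bets on \<open>x\<close>, and the other bets keep their security with the index lowered by one.
  The position \<open>g\<close> is evaluated at an extension of \<open>X\<close> up to its opening
  time \<open>u\<close> only.\<close>

lemma elem_lift:
  assumes "K \<in> elem (Suc Jstar) (Suc J)" and mart: "X \<in> elem_mart Jstar J" and J: "Jstar \<le> J"
  shows "\<exists>F\<in>efun Jstar J. \<forall>t \<omega> z. 0 \<le> t \<longrightarrow> \<omega> \<in> mkt_Omega J \<longrightarrow> X t \<omega> \<noteq> None \<longrightarrow>
    extends J X t \<omega> z \<longrightarrow> K t z = F (\<lambda>s \<omega>. the (X s \<omega>)) t \<omega>"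
  using assms(1)
proof (induction rule: elem.induct)
  case (const c)
  show ?case by (rule bexI[OF _ efun.const[of c]]) simp
next
  case (gamble K i u v g)
  note X = elem_mart_path_process[OF mart J]
  from gamble.IH obtain F where F: "F \<in> efun Jstar J"
    and KF: "\<And>t \<omega> z. 0 \<le> t \<Longrightarrow> \<omega> \<in> mkt_Omega J \<Longrightarrow> X t \<omega> \<noteq> None \<Longrightarrow> extends J X t \<omega> z \<Longrightarrow>
      K t z = F (\<lambda>s \<omega>. the (X s \<omega>)) t \<omega>"
    by blast
  obtain \<phi> where \<phi>: "\<phi> \<in> measurable (mkt_F J) (mkt_F (Suc J))"
    and \<phi>_agree: "\<And>\<omega> \<omega>'. \<omega> \<in> mkt_Omega J \<Longrightarrow> \<omega>' \<in> mkt_Omega J \<Longrightarrow> agree_upto J (ereal u) \<omega> \<omega>' \<Longrightarrow>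
      agree_upto (Suc J) (ereal u) (\<phi> \<omega>) (\<phi> \<omega>')"
    and \<phi>_ext: "\<And>\<omega>. \<omega> \<in> mkt_Omega J \<Longrightarrow> X u \<omega> \<noteq> None \<Longrightarrow> extends J X u \<omega> (\<phi> \<omega>)"
    using measurable_extension[OF mart J gamble.hyps(5)] by blast
  have \<phi>_Omega: "\<phi> \<omega> \<in> mkt_Omega (Suc J)" if "\<omega> \<in> mkt_Omega J" for \<omega>
    using measurable_space[OF \<phi>, of \<omega>] that by simp
  have pos: "position_at J u (\<lambda>\<omega>. g (\<phi> \<omega>))"
    unfolding position_at_def
  proof (intro conjI ballI impI)
    show "(\<lambda>\<omega>. g (\<phi> \<omega>)) \<in> borel_measurable (mkt_F J)"
      by (rule measurable_compose[OF \<phi> position_atD(1)[OF gamble.hyps(7)]])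
    show "\<exists>C. \<forall>\<omega>\<in>mkt_Omega J. \<bar>g (\<phi> \<omega>)\<bar> \<le> C"
      using gamble.hyps(7) \<phi>_Omega unfolding position_at_def by blast
    fix \<omega> \<omega>' assume "\<omega> \<in> mkt_Omega J" "\<omega>' \<in> mkt_Omega J" "agree_upto J (ereal u) \<omega> \<omega>'"
    then show "g (\<phi> \<omega>) = g (\<phi> \<omega>')"
      by (intro position_atD(2)[OF gamble.hyps(7)] \<phi>_Omega \<phi>_agree)
  qed
  define x where "x s \<omega> = the (X s \<omega>)" for s \<omega>
  define d where "d t \<omega> = (case i of 0 \<Rightarrow> x (min v t) \<omega> - x (min u t) \<omega>
      | Suc j \<Rightarrow> \<omega> j (min v t) - \<omega> j (min u t))" for t \<omega>
  have eq: "K t z + g z * (z i (min v t) - z i (min u t)) = F x t \<omega> + g (\<phi> \<omega>) * d t \<omega>"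
    if t: "0 \<le> t" and \<omega>: "\<omega> \<in> mkt_Omega J" and X_t: "X t \<omega> \<noteq> None" and z: "extends J X t \<omega> z" for t \<omega> z
  proof -
    have K: "K t z = F x t \<omega>" using KF[OF t \<omega> X_t z] unfolding x_def .
    have uv: "0 \<le> min v t" "min v t \<le> t" "0 \<le> min u t" "min u t \<le> t"
      using t gamble.hyps(5,6) by simp_all
    have d: "z i (min v t) - z i (min u t) = d t \<omega>"
    proof (cases i)
      case 0
      then show ?thesis using z uv unfolding extends_iff d_def x_def by simp
    next
      case (Suc j)
      then have "j < J" using gamble.hyps(2) J by simp
      then show ?thesis using z uv unfolding extends_iff d_def Suc by simp
    qed
    show ?thesis
    proof (cases "t \<le> u")
      \<comment> \<open>Here \<open>\<phi> \<omega>\<close> need not follow \<open>X\<close>, which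
        may explode between \<open>t\<close> and \<open>u\<close>; the vanishing increment hides
        this.\<close>
      case True
      then have "min v t = min u t" using gamble.hyps(6) by simp
      then show ?thesis using K d by simp
    next
      case False
      then have X_u: "X u \<omega> \<noteq> None" using gamble.hyps(5)
        by (intro path_process_down[OF X \<omega>, of t u] X_t) simp_all
      have "g z = g (\<phi> \<omega>)"
        using False by (intro position_atD(2)[OF gamble.hyps(7) extends_Omega[OF z] \<phi>_Omega[OF \<omega>]]
            extends_agree[OF extends_mono[OF z] \<phi>_ext[OF \<omega> X_u]]) simp
      then show ?thesis using K d by simp
    qed
  qed
  have "(\<lambda>x t \<omega>. F x t \<omega> + g (\<phi> \<omega>) * (case i of 0 \<Rightarrow> x (min v t) \<omega> - x (min u t) \<omega>
      | Suc j \<Rightarrow> \<omega> j (min v t) - \<omega> j (min u t))) \<in> efun Jstar J"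
  proof (cases i)
    case 0
    show ?thesis
      unfolding 0 nat.case by (rule efun.gamble_x[OF F gamble.hyps(3-6) pos])
  next
    case (Suc j)
    then have "j < Jstar" using gamble.hyps(2) by simp
    then show ?thesis
      unfolding Suc nat.case by (rule efun.gamble[OF F _ gamble.hyps(3-6) pos])
  qed
  then show ?case
    by (rule bexI[rotated]) (intro allI impI, rule eq[unfolded d_def x_def[abs_def]])
qed

lemma lift_elem_mart_elem:
  assumes K: "K \<in> elem (Suc Jstar) (Suc J)" and mart: "X \<in> elem_mart Jstar J" and J: "Jstar \<le> J"
    and Y: "\<And>t z. 0 \<le> t \<Longrightarrow> z \<in> mkt_Omega (Suc J) \<Longrightarrow> Y t z = Some (K t z)"
  shows "lift_process J X Y \<in> elem_mart Jstar J"
proof -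
  note X = elem_mart_path_process[OF mart J]
  have J': "Suc Jstar \<le> Suc J" using J by simp
  have pY: "path_process (Suc J) Y"
    by (rule path_process_cong[OF path_process_elem[OF K J']]) (simp add: Y)
  obtain F where F: "F \<in> efun Jstar J"
    and KF: "\<And>t \<omega> z. 0 \<le> t \<Longrightarrow> \<omega> \<in> mkt_Omega J \<Longrightarrow> X t \<omega> \<noteq> None \<Longrightarrow> extends J X t \<omega> z \<Longrightarrow>
      K t z = F (\<lambda>s \<omega>. the (X s \<omega>)) t \<omega>"
    using elem_lift[OF K mart J] by blast
  show ?thesis
  proof (rule elem_mart_cong[OF efun_elem_mart[OF mart F J] J])
    fix t :: real and \<omega> assume t: "0 \<le> t" and \<omega>: "\<omega> \<in> mkt_Omega J"
    show "efun_process F X t \<omega> = lift_process J X Y t \<omega>"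
    proof (cases "X t \<omega> = None")
      case True
      then show ?thesis using lift_None[of t X \<omega> J Y, OF t True] by (simp add: efun_process_def)
    next
      case False
      obtain z where z: "extends J X t \<omega> z" using extends_exists[of J X \<omega> t, OF X \<omega> t False] by blast
      show ?thesis
        using lift_eq[of J X Y \<omega> t z, OF X pY \<omega> t False z] Y[OF t extends_Omega[OF z]] KF[OF t \<omega> False z] False
        by (simp add: efun_process_def)
    qed
  qed
qed

lemma lift_uniform_limit:
  assumes X: "path_process J X" and Y: "path_process (Suc J) Y" and Ys: "\<And>k. path_process (Suc J) (Ys k)"
    and \<omega>: "\<omega> \<in> mkt_Omega J" and t: "X t \<omega> \<noteq> None" and z: "extends J X t \<omega> z"
    and lim: "uniform_limit {0..t} (\<lambda>k s. the (Ys k s z)) (\<lambda>s. the (Y s z)) sequentially"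
  shows "uniform_limit {0..t} (\<lambda>k s. the (lift_process J X (Ys k) s \<omega>))
    (\<lambda>s. the (lift_process J X Y s \<omega>)) sequentially"
proof -
  note lim
  also have "?this \<longleftrightarrow> ?thesis"
    by (rule uniform_limit_cong')
      (simp_all add: lift_eq_upto[of J X _ \<omega> t z, OF X Y \<omega> t z] lift_eq_upto[of J X _ \<omega> t z, OF X Ys \<omega> t z])
  finally show ?thesis .
qed

text \<open>A capital process is real everywhere, so its lift has the domain of \<open>X\<close> and
  needs no lifted supermartingale for its quasi-always condition. This keeps the later lifting of
  supermartingales free of circularity.\<close>

lemma lift_capital:
  fixes c :: real
  assumes strat: "simple_strategy (Suc Jstar) (Suc J) \<tau> h"
    and mart: "X \<in> elem_mart Jstar J" and J: "Jstar \<le> J"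
  defines "Y \<equiv> \<lambda>t z. Some (capital (Suc Jstar) \<tau> h c t z)"
  shows "path_process (Suc J) Y" and "lift_process J X Y \<in> elem_mart Jstar J"
proof -
  note X = elem_mart_path_process[OF mart J]
  have J': "Suc Jstar \<le> Suc J" using J by simp
  obtain K where K: "\<And>k. K k \<in> elem (Suc Jstar) (Suc J)"
    and lim: "\<And>\<omega> t. \<omega> \<in> mkt_Omega (Suc J) \<Longrightarrow>
      uniform_limit {0..t} (\<lambda>k s. K k s \<omega>) (\<lambda>s. capital (Suc Jstar) \<tau> h c s \<omega>) sequentially"
    using capital_approx[OF strat J', of c] by blast
  show pY: "path_process (Suc J) Y"
    unfolding Y_def by (rule path_process_uniform_limit[of "Suc Jstar" "Suc J" K, OF J' K lim])
  have pK: "path_process (Suc J) (\<lambda>t z. Some (K k t z))" for k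
    by (rule path_process_elem[OF K J'])
  have dom: "lift_process J X Y t \<omega> \<noteq> None \<longleftrightarrow> X t \<omega> \<noteq> None"
    if pY: "path_process (Suc J) Y" and Y: "\<And>t z. Y t z \<noteq> None" and t: "0 \<le> t" and \<omega>: "\<omega> \<in> mkt_Omega J" for Y t \<omega>
  proof (cases "X t \<omega> = None")
    case True
    then show ?thesis using lift_None[of t X \<omega> J Y, OF t True] by simp
  next
    case False
    obtain z where z: "extends J X t \<omega> z" using extends_exists[of J X \<omega> t, OF X \<omega> t False] by blast
    show ?thesis using lift_eq[of J X Y \<omega> t z, OF X pY \<omega> t False z] Y[of t z] False by simp
  qed
  show "lift_process J X Y \<in> elem_mart Jstar J"
  proof (rule elem_mart.lim[of _ _ _ "\<lambda>k. lift_process J X (\<lambda>t z. Some (K k t z))"])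
    have "pdom J (lift_process J X Y) = pdom J X"
      using dom[OF pY] unfolding Y_def by (auto simp: pdom_def)
    then show "continuous_process Jstar J (lift_process J X Y)"
      using elem_mart_continuous[OF mart J] path_process_lift[OF X pY]
      unfolding continuous_process_alt by simp
    show "lift_process J X (\<lambda>t z. Some (K k t z)) \<in> elem_mart Jstar J" for k
      by (rule lift_elem_mart_elem[OF K mart J]) simp
    fix t \<omega> assume *: "0 \<le> t" "\<omega> \<in> mkt_Omega J" "lift_process J X Y t \<omega> \<noteq> None"
    obtain z where z: "X t \<omega> \<noteq> None" "extends J X t \<omega> z"
      using lift_dom[OF X pY *(2,1,3)] by blast
    show "lift_process J X (\<lambda>t z. Some (K k t z)) t \<omega> \<noteq> None" for k
      using dom[OF pK _ *(1,2)] z(1) by simp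
    show "uniform_limit {0..t} (\<lambda>k s. the (lift_process J X (\<lambda>t z. Some (K k t z)) s \<omega>))
        (\<lambda>s. the (lift_process J X Y s \<omega>)) sequentially"
      by (rule lift_uniform_limit[of J X Y _ \<omega> t z, OF X pY pK *(2) z])
        (simp add: Y_def lim[OF extends_Omega[OF z(2)]])
  qed
qed

section \<open>Nonnegative supermartingales\<close>

text \<open>The hitting time of (-oo,0]. It is infinite for a path that stays positive, being then
  the infimum of the empty set in \<open>ereal\<close>.\<close>

definition first_nonpos :: "(real \<Rightarrow> real) \<Rightarrow> ereal" where
  "first_nonpos f = Inf {ereal t | t. 0 \<le> t \<and> f t \<le> 0}"

text \<open>For a continuous path the nonpositive times form a closed set, so the infimum is
  attained whenever it is finite.\<close>

lemma first_nonpos_le_iff: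
  assumes cont: "\<And>T. continuous_on {0..T} f" and t: "0 \<le> t"
  shows "first_nonpos f \<le> ereal t \<longleftrightarrow> (\<exists>s\<in>{0..t}. f s \<le> 0)"
proof
  assume "\<exists>s\<in>{0..t}. f s \<le> 0"
  then obtain s where s: "0 \<le> s" "s \<le> t" "f s \<le> 0" by auto
  then have "first_nonpos f \<le> ereal s" unfolding first_nonpos_def by (intro Inf_lower) blast
  also have "\<dots> \<le> ereal t" using s by simp
  finally show "first_nonpos f \<le> ereal t" .
next
  assume le: "first_nonpos f \<le> ereal t"
  show "\<exists>s\<in>{0..t}. f s \<le> 0"
  proof (rule ccontr)
    assume "\<not> (\<exists>s\<in>{0..t}. f s \<le> 0)"
    then have pos: "s \<in> {0..t} \<Longrightarrow> 0 < f s" for s by force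
    \<comment> \<open>The added point \<open>t + 1\<close> makes the compact set nonempty without
      bringing its minimum down to \<open>t\<close>.\<close>
    define S where "S = insert (t + 1) {s \<in> {0..t + 1}. f s \<le> 0}"
    have "closed {s \<in> {0..t + 1}. f s \<le> 0}"
      by (rule continuous_on_closed_Collect_le[OF cont continuous_on_const]) simp
    moreover have "bounded {s \<in> {0..t + 1}. f s \<le> 0}"
      by (rule bounded_subset[of "{0..t + 1}"]) auto
    ultimately have "compact S" unfolding S_def by (simp add: compact_eq_bounded_closed)
    then obtain m where m: "m \<in> S" "\<And>s. s \<in> S \<Longrightarrow> m \<le> s"
      using compact_attains_inf[of S] unfolding S_def by blast
    have "t < m" using m(1) pos[of m] unfolding S_def by force
    moreover have "ereal m \<le> first_nonpos f"
      unfolding first_nonpos_def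
    proof (rule Inf_greatest)
      fix x assume "x \<in> {ereal t | t. 0 \<le> t \<and> f t \<le> 0}"
      then obtain r where r: "x = ereal r" "0 \<le> r" "f r \<le> 0" by blast
      have "m \<le> r"
      proof (cases "r \<le> t + 1")
        case True
        then show ?thesis using r by (intro m(2)) (simp add: S_def)
      next
        case False
        then show ?thesis using m(2)[of "t + 1"] by (simp add: S_def)
      qed
      then show "ereal m \<le> x" using r by simp
    qed
    ultimately show False using le by (meson ereal_less_eq(3) not_less order_trans)
  qed
qed

lemma first_nonpos_nonneg: "0 \<le> first_nonpos f"
  unfolding first_nonpos_def by (rule Inf_greatest) auto

text \<open>A path that starts nonnegative can become negative only after passing through 0, so the
  value at the hitting time itself is still nonnegative.\<close>

lemma nonneg_upto_first_nonpos:
  assumes cont: "continuous_on {0..t} f" and f0: "0 \<le> f 0" and t: "0 \<le> t" "ereal t \<le> first_nonpos f"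
  shows "0 \<le> f t"
proof (rule ccontr)
  assume neg: "\<not> 0 \<le> f t"
  then obtain x where x: "0 \<le> x" "x \<le> t" "f x = 0"
    using IVT2'[of f t 0 0] f0 t(1) cont by auto
  then have "first_nonpos f \<le> ereal x" unfolding first_nonpos_def by (intro Inf_lower) auto
  then have "ereal t \<le> ereal x" using t(2) order_trans by blast
  then have "x = t" using x by simp
  then show False using neg x by simp
qed

text \<open>By compactness, 0 is reached by time \<open>t\<close> iff the infimum of
  \<open>K\<close> over the rational times in [0,t] is not positive, a condition on countably many
  random variables. The stopping property holds because the path up to the hitting time already
  displays the nonpositive value.\<close>

lemma stopping_time_first_nonpos:
  assumes K: "K \<in> elem Jstar J" and J: "Jstar \<le> J"
  shows "mkt_stopping_time J (\<lambda>\<omega>. first_nonpos (\<lambda>t. K t \<omega>))"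
proof (rule stopping_timeI_le)
  have le_iff: "first_nonpos (\<lambda>t. K t \<omega>) \<le> ereal t \<longleftrightarrow> (\<exists>s\<in>{0..t}. K s \<omega> \<le> 0)"
    if "\<omega> \<in> mkt_Omega J" "0 \<le> t" for \<omega> t
    by (rule first_nonpos_le_iff[OF elem_cont[OF K J that(1)] that(2)])
  show "(\<lambda>\<omega>. first_nonpos (\<lambda>t. K t \<omega>)) \<in> borel_measurable (mkt_F J)"
  proof (rule borel_measurableI_le)
    fix y :: ereal
    consider (neg) "y < 0" | (inf) "y = \<infinity>" | (real) t where "y = ereal t" "0 \<le> t"
      by (cases y) force+
    then show "{\<omega> \<in> space (mkt_F J). first_nonpos (\<lambda>t. K t \<omega>) \<le> y} \<in> sets (mkt_F J)"
    proof cases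
      case neg
      then have "\<not> first_nonpos f \<le> y" for f using first_nonpos_nonneg[of f] by (meson not_le less_le_trans)
      then show ?thesis by simp
    next
      case inf
      then show ?thesis using sets.top[of "mkt_F J"] by simp
    next
      case real
      define Q where "Q = \<rat> \<inter> {0..t}"
      have Q: "countable Q" unfolding Q_def by (intro countable_Int1 countable_rat)
      \<comment> \<open>The existential over \<open>Q\<close> appears as a negated universal to fit
        \<open>sets_Collect_Ball_countable\<close>.\<close>
      have "first_nonpos (\<lambda>t. K t \<omega>) \<le> y \<longleftrightarrow> (\<forall>n::nat. \<not> (\<forall>q\<in>Q. \<not> K q \<omega> < inverse (real (Suc n))))"
        if \<omega>: "\<omega> \<in> mkt_Omega J" for \<omega>
        unfolding real(1) le_iff[OF \<omega> real(2)]
      proof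
        assume "\<exists>s\<in>{0..t}. K s \<omega> \<le> 0"
        then obtain s where s: "s \<in> {0..t}" "K s \<omega> \<le> 0" by blast
        have frac: "floor_frac k s \<in> Q" for k
          using floor_frac(1)[of k s] floor_frac(2)[of k s] floor_frac(3)[of s k] s unfolding Q_def by simp
        have "(\<lambda>k. K (floor_frac k s) \<omega>) \<longlonglongrightarrow> K s \<omega>"
          by (rule continuous_on_tendsto_compose[OF elem_cont[OF K J \<omega>, of t] floor_frac(4) s(1)])
            (use frac in \<open>auto simp: Q_def intro!: always_eventually\<close>)
        show "\<forall>n::nat. \<not> (\<forall>q\<in>Q. \<not> K q \<omega> < inverse (real (Suc n)))"
        proof
          fix n :: nat
          have "K s \<omega> < inverse (real (Suc n))" using s(2) by (rule le_less_trans) simp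
          with \<open>(\<lambda>k. K (floor_frac k s) \<omega>) \<longlonglongrightarrow> K s \<omega>\<close>
          have "eventually (\<lambda>k. K (floor_frac k s) \<omega> < inverse (real (Suc n))) sequentially"
            by (rule order_tendstoD)
          then obtain k where "K (floor_frac k s) \<omega> < inverse (real (Suc n))"
            unfolding eventually_sequentially by blast
          then show "\<not> (\<forall>q\<in>Q. \<not> K q \<omega> < inverse (real (Suc n)))" using frac by blast
        qed
      next
        assume *: "\<forall>n::nat. \<not> (\<forall>q\<in>Q. \<not> K q \<omega> < inverse (real (Suc n)))"
        obtain s where s: "s \<in> {0..t}" "\<And>q. q \<in> {0..t} \<Longrightarrow> K s \<omega> \<le> K q \<omega>"
          using continuous_attains_inf[OF _ _ elem_cont[OF K J \<omega>, of t]] real(2) by auto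
        have "K s \<omega> \<le> 0"
        proof (rule ccontr)
          assume "\<not> K s \<omega> \<le> 0"
          then have "0 < K s \<omega>" by simp
          then obtain n where n: "inverse (real (Suc n)) < K s \<omega>" using reals_Archimedean by blast
          from * obtain q where "q \<in> Q" "K q \<omega> < inverse (real (Suc n))" by blast
          then show False using s(2)[of q] n unfolding Q_def by simp
        qed
        with s(1) show "\<exists>s\<in>{0..t}. K s \<omega> \<le> 0" by blast
      qed
      then have "{\<omega> \<in> space (mkt_F J). first_nonpos (\<lambda>t. K t \<omega>) \<le> y} =
          {\<omega> \<in> space (mkt_F J). \<forall>n::nat. \<not> (\<forall>q\<in>Q. \<not> K q \<omega> < inverse (real (Suc n)))}"
        by (intro Collect_cong conj_cong refl) simp
      also have "\<dots> \<in> sets (mkt_F J)"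
      proof (intro sets.sets_Collect_countable_All sets.sets_Collect_neg sets_Collect_Ball_countable[OF Q])
        fix n :: nat and q assume "q \<in> Q"
        then have [measurable]: "K q \<in> borel_measurable (mkt_F J)"
          unfolding Q_def by (intro elem_measurable[OF K J]) simp
        show "{\<omega> \<in> space (mkt_F J). K q \<omega> < inverse (real (Suc n))} \<in> sets (mkt_F J)"
          by measurable
      qed
      finally show ?thesis .
    qed
  qed
  fix \<omega> \<omega>'
  assume \<omega>: "\<omega> \<in> mkt_Omega J" "\<omega>' \<in> mkt_Omega J" "agree_upto J (first_nonpos (\<lambda>t. K t \<omega>)) \<omega> \<omega>'"
  show "first_nonpos (\<lambda>t. K t \<omega>') \<le> first_nonpos (\<lambda>t. K t \<omega>)"
  proof (cases "first_nonpos (\<lambda>t. K t \<omega>)")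
    case (real t)
    then have t: "0 \<le> t" using first_nonpos_nonneg[of "\<lambda>t. K t \<omega>"] by simp
    from le_iff[OF \<omega>(1) t] real obtain s where s: "s \<in> {0..t}" "K s \<omega> \<le> 0" by auto
    have "agree_upto J (ereal s) \<omega> \<omega>'"
      using s(1) real by (intro agree_upto_mono[OF \<omega>(3)]) simp
    then have "K s \<omega> = K s \<omega>'" using s(1) by (intro elem_adapted[OF K J _ \<omega>(1,2)]) simp_all
    then show ?thesis unfolding real using le_iff[OF \<omega>(2) t] s by auto
  qed (use first_nonpos_nonneg[of "\<lambda>t. K t \<omega>"] in simp_all)
qed (rule first_nonpos_nonneg)

text \<open>Stopped on reaching 0, a process with positive start stays nonnegative, and as long as
  it has been positive it has not been stopped. If the initial constant is not positive, the
  condition on [0,t] is void and the zero process will do.\<close>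

lemma elem_positive_supermart:
  assumes K: "K \<in> elem Jstar J" and J: "Jstar \<le> J"
  shows "\<exists>V\<in>nn_supermart Jstar J. \<forall>t \<omega>. 0 \<le> t \<longrightarrow> \<omega> \<in> mkt_Omega J \<longrightarrow>
    (\<forall>s\<in>{0..t}. 0 < K s \<omega>) \<longrightarrow> V t \<omega> = ereal (K t \<omega>)"
proof -
  obtain c where c: "\<And>\<omega>. K 0 \<omega> = c" using elem_at_0[OF K] by blast
  show ?thesis
  proof (cases "0 < c")
    case False
    show ?thesis
    proof (intro bexI[of _ "\<lambda>t \<omega>. ereal 0"] allI impI)
      fix t :: real and \<omega> assume "0 \<le> t" "\<forall>s\<in>{0..t}. 0 < K s \<omega>"
      then have "0 < K 0 \<omega>" by simp
      with False c show "ereal 0 = ereal (K t \<omega>)" by simp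
    qed (rule nn_supermart_const[OF J order_refl])
  next
    case True
    define \<tau> where "\<tau> \<omega> = first_nonpos (\<lambda>t. K t \<omega>)" for \<omega>
    have \<tau>: "mkt_stopping_time J \<tau>" unfolding \<tau>_def by (rule stopping_time_first_nonpos[OF K J])
    define V where "V t \<omega> = ereal (K (real_of_ereal (min (\<tau> \<omega>) (ereal t))) \<omega>)" for t \<omega>
    have "V \<in> nn_supermart Jstar J"
    proof (rule elem_nn_supermart[OF K J \<tau>])
      fix t :: real and \<omega> assume t: "0 \<le> t" and \<omega>: "\<omega> \<in> mkt_Omega J"
      show "V t \<omega> = ereal (K (real_of_ereal (min (\<tau> \<omega>) (ereal t))) \<omega>)" by (simp add: V_def)
      have "0 \<le> \<tau> \<omega>" unfolding \<tau>_def by (rule first_nonpos_nonneg)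
      then have "0 \<le> min (\<tau> \<omega>) (ereal t)" "min (\<tau> \<omega>) (ereal t) \<le> ereal t" using t by simp_all
      moreover have "\<exists>r. m = ereal r \<and> 0 \<le> r" if "0 \<le> m" "m \<le> ereal t" for m
        using that by (cases m) simp_all
      ultimately have "\<exists>r. min (\<tau> \<omega>) (ereal t) = ereal r \<and> 0 \<le> r" by blast
      then obtain r where r: "min (\<tau> \<omega>) (ereal t) = ereal r" "0 \<le> r" by (elim exE conjE)
      have "ereal r \<le> \<tau> \<omega>" unfolding r(1)[symmetric] by (rule min.cobounded1)
      then have le: "ereal r \<le> first_nonpos (\<lambda>t. K t \<omega>)" unfolding \<tau>_def .
      have "0 \<le> K r \<omega>"
        by (rule nonneg_upto_first_nonpos[OF elem_cont[OF K J \<omega>] _ r(2) le]) (use True c in simp)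
      then show "0 \<le> K (real_of_ereal (min (\<tau> \<omega>) (ereal t))) \<omega>" unfolding r by simp
    qed
    moreover have "V t \<omega> = ereal (K t \<omega>)"
      if t: "0 \<le> t" and \<omega>: "\<omega> \<in> mkt_Omega J" and pos: "\<forall>s\<in>{0..t}. 0 < K s \<omega>" for t \<omega>
    proof -
      have "\<not> \<tau> \<omega> \<le> ereal t"
        unfolding \<tau>_def first_nonpos_le_iff[OF elem_cont[OF K J \<omega>] t] using pos by force
      then have "min (\<tau> \<omega>) (ereal t) = ereal t" by (intro min_absorb2) simp
      then show ?thesis by (simp add: V_def)
    qed
    ultimately show ?thesis by blast
  qed
qed

text \<open>The approximants of a nonnegative martingale may be negative, but strict positivity on \<open>[0, t]\<close>
  is inherited by them eventually; this is why the induction needs the shift by \<open>e\<close>.\<close>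
lemma positive_supermart:
  assumes "W \<in> elem_mart Jstar J" and J: "Jstar \<le> J"
  shows "\<exists>V\<in>nn_supermart Jstar J. \<forall>t \<omega>. 0 \<le> t \<longrightarrow> \<omega> \<in> mkt_Omega J \<longrightarrow> W t \<omega> \<noteq> None \<longrightarrow>
    (\<forall>s\<in>{0..t}. 0 < e + the (W s \<omega>)) \<longrightarrow> V t \<omega> = ereal (e + the (W t \<omega>))"
  using assms(1)
proof (induction rule: elem_mart.induct)
  case (elem K W)
  obtain V where V: "V \<in> nn_supermart Jstar J" "\<And>t \<omega>. 0 \<le> t \<Longrightarrow> \<omega> \<in> mkt_Omega J \<Longrightarrow>
      (\<forall>s\<in>{0..t}. 0 < e + K s \<omega>) \<Longrightarrow> V t \<omega> = ereal (e + K t \<omega>)"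
    using elem_positive_supermart[OF elem_add[OF elem.const[of e] elem.hyps(1)] J] by blast
  show ?case
  proof (intro bexI[OF _ V(1)] allI impI)
    fix t \<omega> assume t: "0 \<le> t" and \<omega>: "\<omega> \<in> mkt_Omega J" and pos: "\<forall>s\<in>{0..t}. 0 < e + the (W s \<omega>)"
    have "the (W s \<omega>) = K s \<omega>" if "0 \<le> s" for s by (simp add: elem.hyps(2)[OF that \<omega>])
    then show "V t \<omega> = ereal (e + the (W t \<omega>))" using V(2)[OF t \<omega>] pos t by simp
  qed
next
  case (lim W Ws)
  have W: "path_process J W" using lim.hyps(1) unfolding continuous_process_alt by blast
  have "\<forall>k. \<exists>V. V \<in> nn_supermart Jstar J \<and> (\<forall>t \<omega>. 0 \<le> t \<longrightarrow> \<omega> \<in> mkt_Omega J \<longrightarrow> Ws k t \<omega> \<noteq> None \<longrightarrow>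
    (\<forall>s\<in>{0..t}. 0 < e + the (Ws k s \<omega>)) \<longrightarrow> V t \<omega> = ereal (e + the (Ws k t \<omega>)))"
    using lim.IH by fast
  from choice[OF this] obtain V where V: "\<forall>k. V k \<in> nn_supermart Jstar J \<and>
    (\<forall>t \<omega>. 0 \<le> t \<longrightarrow> \<omega> \<in> mkt_Omega J \<longrightarrow> Ws k t \<omega> \<noteq> None \<longrightarrow>
    (\<forall>s\<in>{0..t}. 0 < e + the (Ws k s \<omega>)) \<longrightarrow> V k t \<omega> = ereal (e + the (Ws k t \<omega>)))"
    by (rule exE)
  have V_eq: "V k t \<omega> = ereal (e + the (Ws k t \<omega>))"
    if "0 \<le> t" "\<omega> \<in> mkt_Omega J" "Ws k t \<omega> \<noteq> None" "\<forall>s\<in>{0..t}. 0 < e + the (Ws k s \<omega>)" for k t \<omega>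
    using conjunct2[OF spec[OF V, of k]] that by blast
  define V' where "V' t \<omega> = liminf (\<lambda>k. V k t \<omega>)" for t \<omega>
  have "V' \<in> nn_supermart Jstar J"
    by (rule nn_supermart.liminf[of V]) (use V in \<open>simp_all add: V'_def\<close>)
  moreover have "V' t \<omega> = ereal (e + the (W t \<omega>))"
    if t: "0 \<le> t" and \<omega>: "\<omega> \<in> mkt_Omega J" and W_t: "W t \<omega> \<noteq> None"
      and pos: "\<forall>s\<in>{0..t}. 0 < e + the (W s \<omega>)" for t \<omega>
  proof -
    have cont: "continuous_on {0..t} (\<lambda>s. e + the (W s \<omega>))"
      by (intro continuous_on_add continuous_on_const path_process_cont[of J W \<omega> t, OF W \<omega> W_t])
    obtain m where m: "m \<in> {0..t}" "\<And>s. s \<in> {0..t} \<Longrightarrow> e + the (W m \<omega>) \<le> e + the (W s \<omega>)"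
      using continuous_attains_inf[OF _ _ cont] t by auto
    have Ws_dom: "Ws k s \<omega> \<noteq> None" if "s \<in> {0..t}" for k s
      by (rule lim.hyps(3)[OF _ \<omega>]) (use that path_process_down[of J W \<omega> t s, OF W \<omega> W_t] in auto)
    have ulim: "uniform_limit {0..t} (\<lambda>k s. the (Ws k s \<omega>)) (\<lambda>s. the (W s \<omega>)) sequentially"
      by (rule lim.hyps(4)[OF t \<omega> W_t])
    \<comment> \<open>The minimum of the shifted path on [0,t] is the tolerance: an approximant
      closer than this is positive, after the shift, on all of [0,t].\<close>
    have "0 < e + the (W m \<omega>)" using pos m(1) by blast
    from uniform_limitD[OF ulim this]
    have ev: "eventually (\<lambda>k. V k t \<omega> = ereal (e + the (Ws k t \<omega>))) sequentially"
    proof eventually_elim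
      case (elim k)
      have "\<forall>s\<in>{0..t}. 0 < e + the (Ws k s \<omega>)"
      proof
        fix s assume s: "s \<in> {0..t}"
        have "\<bar>the (Ws k s \<omega>) - the (W s \<omega>)\<bar> < e + the (W m \<omega>)"
          using elim s unfolding dist_real_def by blast
        then show "0 < e + the (Ws k s \<omega>)" using m(2)[OF s] by linarith
      qed
      then show ?case using t by (intro V_eq \<omega> Ws_dom) simp_all
    qed
    have "(\<lambda>k. the (Ws k t \<omega>)) \<longlonglongrightarrow> the (W t \<omega>)"
      using tendsto_uniform_limitI[OF ulim, of t] t by simp
    then have "(\<lambda>k. ereal (e + the (Ws k t \<omega>))) \<longlonglongrightarrow> ereal (e + the (W t \<omega>))"
      by (intro tendsto_ereal tendsto_add tendsto_const)
    then have "(\<lambda>k. V k t \<omega>) \<longlonglongrightarrow> ereal (e + the (W t \<omega>))"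
      using tendsto_cong[OF ev] by blast
    then show ?thesis unfolding V'_def by (intro lim_imp_Liminf) simp_all
  qed
  ultimately show ?case by blast
qed

text \<open>Every shift by \<open>inverse (real (Suc m))\<close> makes \<open>W\<close> strictly
  positive on its domain, and the limit inferior over \<open>m\<close> removes the shift
  again.\<close>

lemma nonneg_mart_supermart:
  assumes W: "W \<in> elem_mart Jstar J" and J: "Jstar \<le> J"
    and nonneg: "\<And>t \<omega>. 0 \<le> t \<Longrightarrow> \<omega> \<in> mkt_Omega J \<Longrightarrow> W t \<omega> \<noteq> None \<Longrightarrow> 0 \<le> the (W t \<omega>)"
  obtains V where "V \<in> nn_supermart Jstar J"
    and "\<And>t \<omega>. 0 \<le> t \<Longrightarrow> \<omega> \<in> mkt_Omega J \<Longrightarrow> W t \<omega> \<noteq> None \<Longrightarrow> V t \<omega> = ereal (the (W t \<omega>))"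
proof -
  have "\<forall>m::nat. \<exists>V. V \<in> nn_supermart Jstar J \<and> (\<forall>t \<omega>. 0 \<le> t \<longrightarrow> \<omega> \<in> mkt_Omega J \<longrightarrow> W t \<omega> \<noteq> None \<longrightarrow>
    (\<forall>s\<in>{0..t}. 0 < inverse (real (Suc m)) + the (W s \<omega>)) \<longrightarrow>
    V t \<omega> = ereal (inverse (real (Suc m)) + the (W t \<omega>)))"
    using positive_supermart[OF W J] by fast
  from choice[OF this] obtain V where V: "\<forall>m. V m \<in> nn_supermart Jstar J \<and>
    (\<forall>t \<omega>. 0 \<le> t \<longrightarrow> \<omega> \<in> mkt_Omega J \<longrightarrow> W t \<omega> \<noteq> None \<longrightarrow>
    (\<forall>s\<in>{0..t}. 0 < inverse (real (Suc m)) + the (W s \<omega>)) \<longrightarrow>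
    V m t \<omega> = ereal (inverse (real (Suc m)) + the (W t \<omega>)))"
    by (rule exE)
  note pW = elem_mart_path_process[OF W J]
  define V' where "V' t \<omega> = liminf (\<lambda>m. V m t \<omega>)" for t \<omega>
  have "V' \<in> nn_supermart Jstar J"
    by (rule nn_supermart.liminf[of V]) (use V in \<open>simp_all add: V'_def\<close>)
  moreover have "V' t \<omega> = ereal (the (W t \<omega>))"
    if t: "0 \<le> t" and \<omega>: "\<omega> \<in> mkt_Omega J" and W_t: "W t \<omega> \<noteq> None" for t \<omega>
  proof -
    have "0 < inverse (real (Suc m)) + the (W s \<omega>)" if s: "s \<in> {0..t}" for m s
    proof -
      have "W s \<omega> \<noteq> None" by (rule path_process_down[of J W \<omega> t s, OF pW \<omega> W_t]) (use s in simp_all)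
      then have "0 \<le> the (W s \<omega>)" using s by (intro nonneg \<omega>) simp_all
      moreover have "0 < inverse (real (Suc m))" by simp
      ultimately show ?thesis by linarith
    qed
    then have V_eq: "V m t \<omega> = ereal (inverse (real (Suc m)) + the (W t \<omega>))" for m
      using conjunct2[OF spec[OF V, of m]] t \<omega> W_t by blast
    have "(\<lambda>m. ereal (inverse (real (Suc m)) + the (W t \<omega>))) \<longlonglongrightarrow> ereal (0 + the (W t \<omega>))"
      by (intro tendsto_ereal tendsto_add tendsto_const LIMSEQ_inverse_real_of_nat)
    then have "liminf (\<lambda>m. ereal (inverse (real (Suc m)) + the (W t \<omega>))) = ereal (0 + the (W t \<omega>))"
      by (intro lim_imp_Liminf) simp_all
    then show ?thesis unfolding V'_def V_eq by simp
  qed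
  ultimately show ?thesis by (rule that)
qed

section \<open>Averages of nonnegative supermartingales\<close>

lemma capital_at_0:
  assumes "simple_strategy Jstar J \<tau> h" "\<omega> \<in> mkt_Omega J"
  shows "capital Jstar \<tau> h c 0 \<omega> = c"
proof -
  have "min (\<tau> n \<omega>) (ereal 0) = 0" for n
    using stopping_timeD(2)[OF simple_strategyD(1)[OF assms(1)] assms(2), of n]
    by (simp add: min_absorb2 zero_ereal_def[symmetric])
  then show ?thesis unfolding capital_def by simp
qed

lemma nn_supermart_nonneg:
  assumes "A \<in> nn_supermart Jstar J" "0 \<le> t" "\<omega> \<in> mkt_Omega J"
  shows "0 \<le> A t \<omega>"
  using assms(1)
proof (induction rule: nn_supermart.induct)
  case (simple \<tau> h c X)
  then show ?case using assms(2,3) by simp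
next
  case (liminf Xs X)
  have "0 \<le> liminf (\<lambda>k. Xs k t \<omega>)"
    using liminf.IH by (intro Liminf_bounded always_eventually allI) blast
  then show ?case using liminf.hyps assms(2,3) by simp
qed

text \<open>A deterministic initial value lets one subsequence serve all samples at once in
  \<open>combined_liminf\<close>.\<close>

lemma nn_supermart_const_at_0:
  assumes "A \<in> nn_supermart Jstar J"
  shows "\<exists>a. \<forall>\<omega>\<in>mkt_Omega J. A 0 \<omega> = a"
  using assms
proof (induction rule: nn_supermart.induct)
  case (simple \<tau> h c X)
  then show ?case using capital_at_0[OF simple.hyps(1)] by (intro exI[of _ "ereal c"]) simp
next
  case (liminf Xs X)
  have "\<forall>k. \<exists>a. \<forall>\<omega>\<in>mkt_Omega J. Xs k 0 \<omega> = a" using liminf.IH by blast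
  from choice[OF this] obtain a where a: "\<forall>k. \<forall>\<omega>\<in>mkt_Omega J. Xs k 0 \<omega> = a k" by (rule exE)
  show ?case
    using a liminf.hyps by (intro exI[of _ "liminf a"]) simp
qed

text \<open>The set of nonnegative supermartingales need not be closed under sums, since the limit inferior
  is not additive; being dominated by a supermartingale with the same initial value is all we need.\<close>
definition combined :: "nat \<Rightarrow> nat \<Rightarrow> (real \<Rightarrow> sample \<Rightarrow> ereal) \<Rightarrow> (real \<Rightarrow> sample \<Rightarrow> ereal) \<Rightarrow> bool" where
  "combined Jstar J A B \<longleftrightarrow> (\<exists>C\<in>nn_supermart Jstar J.
     (\<forall>\<omega>\<in>mkt_Omega J. C 0 \<omega> = ereal (1/2) * (A 0 \<omega> + B 0 \<omega>)) \<and>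
     (\<forall>t\<ge>0. \<forall>\<omega>\<in>mkt_Omega J. ereal (1/2) * A t \<omega> \<le> C t \<omega> \<and> ereal (1/2) * B t \<omega> \<le> C t \<omega>))"

lemma combined_sym: "combined Jstar J A B \<Longrightarrow> combined Jstar J B A"
  unfolding combined_def by (simp add: add.commute conj_commute)

text \<open>Adding two strategies directly would require merging their trading times. Instead the
  average of the capitals is recognised as a uniform limit of averages of elementary processes, and
  its nonnegativity yields the supermartingale.\<close>

lemma combined_simple:
  assumes J: "Jstar \<le> J" and sA: "simple_strategy Jstar J \<tau> h" and sB: "simple_strategy Jstar J \<sigma> g"
    and A: "\<forall>t\<ge>0. \<forall>\<omega>\<in>mkt_Omega J. A t \<omega> = ereal (capital Jstar \<tau> h a t \<omega>)"
    and B: "\<forall>t\<ge>0. \<forall>\<omega>\<in>mkt_Omega J. B t \<omega> = ereal (capital Jstar \<sigma> g b t \<omega>)"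
    and nA: "\<forall>t\<ge>0. \<forall>\<omega>\<in>mkt_Omega J. 0 \<le> capital Jstar \<tau> h a t \<omega>"
    and nB: "\<forall>t\<ge>0. \<forall>\<omega>\<in>mkt_Omega J. 0 \<le> capital Jstar \<sigma> g b t \<omega>"
  shows "combined Jstar J A B"
proof -
  define P where "P t \<omega> = 1/2 * (capital Jstar \<tau> h a t \<omega> + capital Jstar \<sigma> g b t \<omega>)" for t \<omega>
  obtain K where K: "\<And>k. K k \<in> elem Jstar J"
    and K_lim: "\<And>\<omega> t. \<omega> \<in> mkt_Omega J \<Longrightarrow>
      uniform_limit {0..t} (\<lambda>k s. K k s \<omega>) (\<lambda>s. capital Jstar \<tau> h a s \<omega>) sequentially"
    using capital_approx[OF sA J, of a] by blast
  obtain L where L: "\<And>k. L k \<in> elem Jstar J"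
    and L_lim: "\<And>\<omega> t. \<omega> \<in> mkt_Omega J \<Longrightarrow>
      uniform_limit {0..t} (\<lambda>k s. L k s \<omega>) (\<lambda>s. capital Jstar \<sigma> g b s \<omega>) sequentially"
    using capital_approx[OF sB J, of b] by blast
  have "(\<lambda>t \<omega>. Some (P t \<omega>)) \<in> elem_mart Jstar J"
  proof (rule elem_mart_uniform_limit[OF J, of "\<lambda>k t \<omega>. 1/2 * (K k t \<omega> + L k t \<omega>)"])
    show "(\<lambda>t \<omega>. 1/2 * (K k t \<omega> + L k t \<omega>)) \<in> elem Jstar J" for k
      by (rule elem_scale[OF elem_add[OF K L]])
    show "uniform_limit {0..t} (\<lambda>k s. 1/2 * (K k s \<omega> + L k s \<omega>)) (\<lambda>s. P s \<omega>) sequentially"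
      if "\<omega> \<in> mkt_Omega J" for \<omega> t
      unfolding P_def
      by (rule bounded_linear.uniform_limit[OF bounded_linear_mult_right
            uniform_limit_add[OF K_lim[OF that] L_lim[OF that]]])
  qed
  from nonneg_mart_supermart[OF this J] obtain C where C: "C \<in> nn_supermart Jstar J"
    "\<And>t \<omega>. 0 \<le> t \<Longrightarrow> \<omega> \<in> mkt_Omega J \<Longrightarrow> C t \<omega> = ereal (P t \<omega>)"
    using nA nB by (simp add: P_def) blast
  show ?thesis
    unfolding combined_def
  proof (intro bexI[OF _ C(1)] conjI ballI allI impI)
    fix \<omega> assume \<omega>: "\<omega> \<in> mkt_Omega J"
    show "C 0 \<omega> = ereal (1/2) * (A 0 \<omega> + B 0 \<omega>)" using A B C(2)[OF order_refl \<omega>] \<omega> by (simp add: P_def)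
    fix t :: real assume t: "0 \<le> t"
    show "ereal (1/2) * A t \<omega> \<le> C t \<omega>" "ereal (1/2) * B t \<omega> \<le> C t \<omega>"
      using A B C(2)[OF t \<omega>] nA nB \<omega> t by (simp_all add: P_def)
  qed
qed

text \<open>Along a subsequence the initial values of the \<open>Bs k\<close> converge, so that they add up in the limit.\<close>
lemma combined_liminf:
  assumes A: "A \<in> nn_supermart Jstar J" and Bs: "\<And>k. Bs k \<in> nn_supermart Jstar J"
    and comb: "\<And>k. combined Jstar J A (Bs k)"
    and B: "\<forall>t\<ge>0. \<forall>\<omega>\<in>mkt_Omega J. B t \<omega> = liminf (\<lambda>k. Bs k t \<omega>)"
  shows "combined Jstar J A B"
proof -
  have "\<forall>k. \<exists>b. \<forall>\<omega>\<in>mkt_Omega J. Bs k 0 \<omega> = b" using nn_supermart_const_at_0[OF Bs] by blast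
  from choice[OF this] obtain b where "\<forall>k. \<forall>\<omega>\<in>mkt_Omega J. Bs k 0 \<omega> = b k" by (rule exE)
  then have b: "Bs k 0 \<omega> = b k" if "\<omega> \<in> mkt_Omega J" for k \<omega> using that by blast
  obtain r :: "nat \<Rightarrow> nat" where r: "strict_mono r" "(b \<circ> r) \<longlonglongrightarrow> liminf b"
    using liminf_subseq_lim[of b] by blast
  have "\<forall>k. \<exists>C. C \<in> nn_supermart Jstar J \<and>
     (\<forall>\<omega>\<in>mkt_Omega J. C 0 \<omega> = ereal (1/2) * (A 0 \<omega> + Bs k 0 \<omega>)) \<and>
     (\<forall>t\<ge>0. \<forall>\<omega>\<in>mkt_Omega J. ereal (1/2) * A t \<omega> \<le> C t \<omega> \<and> ereal (1/2) * Bs k t \<omega> \<le> C t \<omega>)"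
    using comb unfolding combined_def by fast
  from choice[OF this] obtain C where C: "\<forall>k. C k \<in> nn_supermart Jstar J \<and>
     (\<forall>\<omega>\<in>mkt_Omega J. C k 0 \<omega> = ereal (1/2) * (A 0 \<omega> + Bs k 0 \<omega>)) \<and>
     (\<forall>t\<ge>0. \<forall>\<omega>\<in>mkt_Omega J. ereal (1/2) * A t \<omega> \<le> C k t \<omega> \<and> ereal (1/2) * Bs k t \<omega> \<le> C k t \<omega>)"
    by (rule exE)
  define D where "D t \<omega> = liminf (\<lambda>k. C (r k) t \<omega>)" for t \<omega>
  have D: "D \<in> nn_supermart Jstar J"
    by (rule nn_supermart.liminf[of "\<lambda>k. C (r k)"]) (use C in \<open>simp_all add: D_def\<close>)
  show ?thesis
    unfolding combined_def
  proof (intro bexI[OF _ D] conjI ballI allI impI)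
    fix \<omega> assume \<omega>: "\<omega> \<in> mkt_Omega J"
    have C_0: "C k 0 \<omega> = ereal (1/2) * (A 0 \<omega> + b k)" for k
      using conjunct1[OF conjunct2[OF spec[OF C, of k]]] \<omega> b[OF \<omega>] by simp
    have A_0: "0 \<le> A 0 \<omega>" by (rule nn_supermart_nonneg[OF A order_refl \<omega>])
    have b_0: "0 \<le> b k" for k using nn_supermart_nonneg[OF Bs order_refl \<omega>, of k] b[OF \<omega>] by simp
    \<comment> \<open>Initial values may be infinite; nonnegativity is what makes their addition
      continuous.\<close>
    have "0 \<le> liminf b" by (intro Liminf_bounded always_eventually allI b_0)
    then have "(\<lambda>k. A 0 \<omega> + b (r k)) \<longlonglongrightarrow> A 0 \<omega> + liminf b"
      using r(2) A_0 b_0 by (intro tendsto_add_ereal_nonneg) (auto simp: o_def)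
    then have "(\<lambda>k. C (r k) 0 \<omega>) \<longlonglongrightarrow> ereal (1/2) * (A 0 \<omega> + liminf b)"
      unfolding C_0 by (intro tendsto_cmult_ereal) simp_all
    then have "D 0 \<omega> = ereal (1/2) * (A 0 \<omega> + liminf b)"
      unfolding D_def by (intro lim_imp_Liminf) simp_all
    moreover have "B 0 \<omega> = liminf b" using B \<omega> b[OF \<omega>] by simp
    ultimately show "D 0 \<omega> = ereal (1/2) * (A 0 \<omega> + B 0 \<omega>)" by simp
    fix t :: real assume t: "0 \<le> t"
    have ge: "ereal (1/2) * A t \<omega> \<le> C k t \<omega>" "ereal (1/2) * Bs k t \<omega> \<le> C k t \<omega>" for k
      using conjunct2[OF conjunct2[OF spec[OF C, of k]]] \<omega> t by blast+
    show "ereal (1/2) * A t \<omega> \<le> D t \<omega>"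
      unfolding D_def by (intro Liminf_bounded always_eventually allI ge)
    have "B t \<omega> = liminf (\<lambda>k. Bs k t \<omega>)" using B \<omega> t by blast
    \<comment> \<open>Passing to a subsequence can only raise the limit inferior, so the domination
      of \<open>B\<close> survives.\<close>
    also have "\<dots> \<le> liminf (\<lambda>k. Bs (r k) t \<omega>)"
      using liminf_subseq_mono[OF r(1), of "\<lambda>k. Bs k t \<omega>"] by (simp add: o_def)
    finally have "ereal (1/2) * B t \<omega> \<le> ereal (1/2) * liminf (\<lambda>k. Bs (r k) t \<omega>)"
      by (rule ereal_mult_left_mono) simp
    also have "\<dots> = liminf (\<lambda>k. ereal (1/2) * Bs (r k) t \<omega>)"
      by (rule Liminf_ereal_mult_left[symmetric]) simp_all
    also have "\<dots> \<le> D t \<omega>"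
      unfolding D_def by (intro Liminf_mono always_eventually allI ge)
    finally show "ereal (1/2) * B t \<omega> \<le> D t \<omega>" .
  qed
qed

text \<open>Two nested inductions: for a simple \<open>A\<close>, induct on \<open>B\<close>; the
  limit step in \<open>A\<close> reduces to the one in \<open>B\<close> by symmetry.\<close>

lemma nn_supermart_combined:
  assumes A: "A \<in> nn_supermart Jstar J" and B: "B \<in> nn_supermart Jstar J" and J: "Jstar \<le> J"
  shows "combined Jstar J A B"
  using A
proof (induction rule: nn_supermart.induct)
  case (simple \<tau> h a A)
  note A_simple = simple.hyps
  show ?case
    using B
  proof (induction rule: nn_supermart.induct)
    case (simple \<sigma> g b B)
    show ?case
      by (rule combined_simple[OF J A_simple(1) simple.hyps(1) A_simple(3) simple.hyps(3) A_simple(2) simple.hyps(2)])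
  next
    case (liminf Bs B)
    show ?case
      by (rule combined_liminf[OF nn_supermart.simple[OF A_simple] _ _ liminf.hyps]) (use liminf.IH in blast)+
  qed
next
  case (liminf As A)
  show ?case
  proof (rule combined_sym[OF combined_liminf[OF B _ _ liminf.hyps]])
    show "As k \<in> nn_supermart Jstar J" for k using liminf.IH by blast
    show "combined Jstar J B (As k)" for k using liminf.IH combined_sym by blast
  qed
qed

text \<open>Values are matched only where \<open>X\<close> is real; elsewhere \<open>V'\<close> is
  not controlled, so the explosion of \<open>X\<close> needs a supermartingale of its own. In the
  base case the lifted capital is a continuous martingale that is nonnegative on its domain.\<close>

lemma lift_supermart:
  assumes "V \<in> nn_supermart (Suc Jstar) (Suc J)" and mart: "X \<in> elem_mart Jstar J" and J: "Jstar \<le> J"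
  shows "\<exists>V'\<in>nn_supermart Jstar J. \<forall>t \<omega> z. 0 \<le> t \<longrightarrow> \<omega> \<in> mkt_Omega J \<longrightarrow> X t \<omega> \<noteq> None \<longrightarrow>
    extends J X t \<omega> z \<longrightarrow> V' t \<omega> = V t z"
  using assms(1)
proof (induction rule: nn_supermart.induct)
  case (simple \<tau> h c V)
  note X = elem_mart_path_process[OF mart J]
  define Y where "Y t z = Some (capital (Suc Jstar) \<tau> h c t z)" for t z
  have Y: "path_process (Suc J) Y" "lift_process J X Y \<in> elem_mart Jstar J"
    using lift_capital[OF simple.hyps(1) mart J, of c] unfolding Y_def[abs_def] by blast+
  have eq: "lift_process J X Y t \<omega> = Y t z"
    if "0 \<le> t" "\<omega> \<in> mkt_Omega J" "X t \<omega> \<noteq> None" "extends J X t \<omega> z" for t \<omega> z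
    by (rule lift_eq[of J X Y \<omega> t z, OF X Y(1) that(2,1,3,4)])
  obtain V' where V': "V' \<in> nn_supermart Jstar J" "\<And>t \<omega>. 0 \<le> t \<Longrightarrow> \<omega> \<in> mkt_Omega J \<Longrightarrow>
      lift_process J X Y t \<omega> \<noteq> None \<Longrightarrow> V' t \<omega> = ereal (the (lift_process J X Y t \<omega>))"
  proof (rule nonneg_mart_supermart[OF Y(2) J])
    fix t \<omega> assume *: "0 \<le> t" "\<omega> \<in> mkt_Omega J" "lift_process J X Y t \<omega> \<noteq> None"
    obtain z where z: "X t \<omega> \<noteq> None" "extends J X t \<omega> z"
      using lift_dom[OF X Y(1) *(2,1,3)] by blast
    show "0 \<le> the (lift_process J X Y t \<omega>)"
      unfolding eq[OF *(1,2) z] Y_def using simple.hyps(2) *(1) extends_Omega[OF z(2)] by simp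
  qed blast
  show ?case
  proof (intro bexI[OF _ V'(1)] allI impI)
    fix t \<omega> z assume *: "0 \<le> t" "\<omega> \<in> mkt_Omega J" "X t \<omega> \<noteq> None" "extends J X t \<omega> z"
    show "V' t \<omega> = V t z"
      using V'(2)[OF *(1,2)] eq[OF *] simple.hyps(3) *(1) extends_Omega[OF *(4)] by (simp add: Y_def)
  qed
next
  case (liminf Vs V)
  have "\<forall>k. \<exists>V'. V' \<in> nn_supermart Jstar J \<and> (\<forall>t \<omega> z. 0 \<le> t \<longrightarrow> \<omega> \<in> mkt_Omega J \<longrightarrow> X t \<omega> \<noteq> None \<longrightarrow>
    extends J X t \<omega> z \<longrightarrow> V' t \<omega> = Vs k t z)"
    using liminf.IH by fast
  from choice[OF this] obtain V' where V': "\<forall>k. V' k \<in> nn_supermart Jstar J \<and>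
    (\<forall>t \<omega> z. 0 \<le> t \<longrightarrow> \<omega> \<in> mkt_Omega J \<longrightarrow> X t \<omega> \<noteq> None \<longrightarrow> extends J X t \<omega> z \<longrightarrow> V' k t \<omega> = Vs k t z)"
    by (rule exE)
  show ?case
  proof (intro bexI[of _ "\<lambda>t \<omega>. liminf (\<lambda>k. V' k t \<omega>)"] allI impI)
    show "(\<lambda>t \<omega>. liminf (\<lambda>k. V' k t \<omega>)) \<in> nn_supermart Jstar J"
      by (rule nn_supermart.liminf[of V']) (use V' in simp_all)
    fix t \<omega> z assume *: "0 \<le> t" "\<omega> \<in> mkt_Omega J" "X t \<omega> \<noteq> None" "extends J X t \<omega> z"
    have "V' k t \<omega> = Vs k t z" for k using conjunct2[OF spec[OF V', of k]] * by blast
    moreover have "V t z = liminf (\<lambda>k. Vs k t z)"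
      using liminf.hyps *(1) extends_Omega[OF *(4)] by blast
    ultimately show "liminf (\<lambda>k. V' k t \<omega>) = V t z" by simp
  qed
qed

lemma quasi_always_lift:
  assumes mart: "X \<in> elem_mart Jstar J" and J: "Jstar \<le> J"
    and Y: "continuous_process (Suc Jstar) (Suc J) Y"
  shows "quasi_always Jstar J (pdom J (lift_process J X Y))"
proof -
  note X = elem_mart_path_process[OF mart J]
  have pY: "path_process (Suc J) Y" and qY: "quasi_always (Suc Jstar) (Suc J) (pdom (Suc J) Y)"
    using Y unfolding continuous_process_alt by blast+
  have qX: "quasi_always Jstar J (pdom J X)"
    using elem_mart_continuous[OF mart J] unfolding continuous_process_alt by blast
  obtain U where U: "U \<in> nn_supermart Jstar J" "\<forall>\<omega>\<in>mkt_Omega J. U 0 \<omega> = 1"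
    "\<forall>t\<ge>0. \<forall>\<omega>\<in>mkt_Omega J. (t, \<omega>) \<notin> pdom J X \<longrightarrow> U t \<omega> = \<infinity>"
    using qX unfolding quasi_always_def by blast
  obtain V where V: "V \<in> nn_supermart (Suc Jstar) (Suc J)" "\<forall>z\<in>mkt_Omega (Suc J). V 0 z = 1"
    "\<forall>t\<ge>0. \<forall>z\<in>mkt_Omega (Suc J). (t, z) \<notin> pdom (Suc J) Y \<longrightarrow> V t z = \<infinity>"
    using qY unfolding quasi_always_def by blast
  obtain V' where V': "V' \<in> nn_supermart Jstar J" "\<And>t \<omega> z. 0 \<le> t \<Longrightarrow> \<omega> \<in> mkt_Omega J \<Longrightarrow>
      X t \<omega> \<noteq> None \<Longrightarrow> extends J X t \<omega> z \<Longrightarrow> V' t \<omega> = V t z"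
    using lift_supermart[OF V(1) mart J] by blast
  obtain C where C: "C \<in> nn_supermart Jstar J"
    and C_0: "\<And>\<omega>. \<omega> \<in> mkt_Omega J \<Longrightarrow> C 0 \<omega> = ereal (1/2) * (U 0 \<omega> + V' 0 \<omega>)"
    and ge: "\<And>t \<omega>. 0 \<le> t \<Longrightarrow> \<omega> \<in> mkt_Omega J \<Longrightarrow>
      ereal (1/2) * U t \<omega> \<le> C t \<omega> \<and> ereal (1/2) * V' t \<omega> \<le> C t \<omega>"
    using nn_supermart_combined[OF U(1) V'(1) J] unfolding combined_def by blast
  show ?thesis
    unfolding quasi_always_def
  proof (intro bexI[OF _ C] conjI ballI allI impI)
    fix \<omega> assume \<omega>: "\<omega> \<in> mkt_Omega J"
    have X_0: "X 0 \<omega> \<noteq> None" by (rule path_process_0[OF X \<omega>])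
    then obtain z where z: "extends J X 0 \<omega> z" using extends_exists[OF X \<omega> order_refl] by blast
    have "V' 0 \<omega> = 1" using V'(2)[OF order_refl \<omega> X_0 z] V(2) extends_Omega[OF z] by simp
    then show "C 0 \<omega> = 1" unfolding C_0[OF \<omega>] using U(2) \<omega> by (simp add: one_ereal_def)
  next
    fix t \<omega> assume t: "0 \<le> t" and \<omega>: "\<omega> \<in> mkt_Omega J" and "(t, \<omega>) \<notin> pdom J (lift_process J X Y)"
    then have none: "lift_process J X Y t \<omega> = None" unfolding pdom_iff by blast
    \<comment> \<open>Either \<open>X\<close> is no longer real at \<open>t\<close>, and
      \<open>U\<close> is infinite, or \<open>Y\<close> is undefined at an extension of
      \<open>X\<close>, where \<open>V\<close> and hence \<open>V'\<close> is infinite. The weights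
      1/2 preserve infinity and keep the initial value 1.\<close>
    have "U t \<omega> = \<infinity> \<or> V' t \<omega> = \<infinity>"
    proof (cases "X t \<omega> = None")
      case True
      then show ?thesis using U(3) t \<omega> by (simp add: pdom_iff)
    next
      case False
      then obtain z where z: "extends J X t \<omega> z" using extends_exists[of J X \<omega> t, OF X \<omega> t] by blast
      have "Y t z = None" using none lift_eq[of J X Y \<omega> t z, OF X pY \<omega> t False z] by simp
      then have "V t z = \<infinity>" using V(3) t extends_Omega[OF z] by (simp add: pdom_iff)
      then show ?thesis using V'(2)[OF t \<omega> False z] by simp
    qed
    then show "C t \<omega> = \<infinity>" using ge[OF t \<omega>] by auto
  qed
qed

lemma lift_elem_mart:
  assumes mart: "X \<in> elem_mart Jstar J" and J: "Jstar \<le> J"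
    and "Y \<in> elem_mart (Suc Jstar) (Suc J)"
  shows "lift_process J X Y \<in> elem_mart Jstar J"
  using assms(3)
proof (induction rule: elem_mart.induct)
  case (elem K Y)
  show ?case by (rule lift_elem_mart_elem[OF elem.hyps(1) mart J elem.hyps(2)])
next
  case (lim Y Ys)
  note X = elem_mart_path_process[OF mart J]
  have J': "Suc Jstar \<le> Suc J" using J by simp
  have Y: "path_process (Suc J) Y" using lim.hyps(1) unfolding continuous_process_alt by blast
  have Ys: "path_process (Suc J) (Ys k)" for k by (rule elem_mart_path_process[OF lim.hyps(2) J'])
  show ?case
  proof (rule elem_mart.lim[OF _ lim.IH])
    show "continuous_process Jstar J (lift_process J X Y)"
      unfolding continuous_process_alt
      by (intro conjI path_process_lift[OF X Y] quasi_always_lift[OF mart J lim.hyps(1)])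
    fix t \<omega> assume *: "0 \<le> t" "\<omega> \<in> mkt_Omega J" "lift_process J X Y t \<omega> \<noteq> None"
    obtain z where z: "X t \<omega> \<noteq> None" "extends J X t \<omega> z" "Y t z \<noteq> None"
      using lift_dom[OF X Y *(2,1,3)] by blast
    show "lift_process J X (Ys k) t \<omega> \<noteq> None" for k
      unfolding lift_eq[of J X "Ys k" \<omega> t z, OF X Ys *(2,1) z(1,2)]
      by (rule lim.hyps(3)[OF *(1) extends_Omega[OF z(2)] z(3)])
    show "uniform_limit {0..t} (\<lambda>k s. the (lift_process J X (Ys k) s \<omega>))
        (\<lambda>s. the (lift_process J X Y s \<omega>)) sequentially"
      by (rule lift_uniform_limit[of J X Y Ys \<omega> t z, OF X Y Ys *(2) z(1,2)
            lim.hyps(4)[OF *(1) extends_Omega[OF z(2)] z(3)]])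
  qed
qed

theorem theorem4:
  fixes Jstar J :: nat
    and X :: "real \<Rightarrow> sample \<Rightarrow> real option"
    and Y :: "real \<Rightarrow> sample \<Rightarrow> real option"
  assumes "1 \<le> Jstar" and "Jstar \<le> J"
    and "X \<in> cont_mart Jstar J"
    and "Y \<in> cont_mart (Suc Jstar) (Suc J)"
  shows "lift_process J X Y \<in> cont_mart Jstar J"
proof (rule elem_mart_subset_cont_mart[OF assms(2)])
  show "lift_process J X Y \<in> elem_mart Jstar J"
    by (rule lift_elem_mart[OF cont_mart_subset_elem_mart[OF assms(2,3)] assms(2)
          cont_mart_subset_elem_mart[OF _ assms(4)]]) (use assms(2) in simp)
qed

end
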